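(* For each $u\in\mathbb{R}\setminus\mathbb{Z}$, let $\mu^{*u}$ be the unique tempered distribution on $\mathbb{R}$ whose Fourier transform is $\widehat{\mu^{*u}}(\lambda)=e^{-2iu\arctan(2\lambda)}$. Then $$\mu^{*u}=\cos(\pi u)\,\delta_0(x)+\frac{\sin(\pi u)}{\pi}\,\mathrm{pv}(1/x)+\Phi_u(x),$$ where $\mathrm{pv}$ denotes the principal value and $\Phi_u\in L^2(\mathbb{R})$ is the function given (for $x\neq0$) by $$\Phi_u(x)=e^{-|x|/2}\left(-\frac{u\sin(\pi u)}{\pi}\sum_{k=0}^{\infty}\frac{(1-u\,\mathrm{sgn}(x))_k\,|x|^k}{k!\,(k+1)!}\left[\frac{\Gamma'}{\Gamma}(1+k-u\,\mathrm{sgn}(x))-\frac{\Gamma'}{\Gamma}(1+k)-\frac{\Gamma'}{\Gamma}(2+k)+\log|x|\right]+\frac{\sin(\pi u)}{\pi x}\right)-\frac{\sin(\pi u)}{\pi x}.$$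
   Context: Fourier transform convention: $\widehat\mu(\lambda)=\int_{\mathbb{R}}e^{-i\lambda x}\,d\mu(x)$ for finite signed measures, extended to tempered distributions in the usual way. $\Gamma'/\Gamma$ is the logarithmic derivative of the Euler gamma function, $(a)_k=a(a+1)\cdots(a+k-1)$ (with $(a)_0=1$) is the Pochhammer symbol, $\mathrm{sgn}$ is the sign function, and $\delta_0$ is the Dirac mass at $0$. *)

theory Defs
  imports "HOL-Analysis.Analysis"
begin

definition higher_vderiv :: "nat \<Rightarrow> (real \<Rightarrow> complex) \<Rightarrow> real \<Rightarrow> complex" where
  "higher_vderiv n f = ((\<lambda>g x. vector_derivative g (at x)) ^^ n) f"

definition schwartz :: "(real \<Rightarrow> complex) set" where
  "schwartz = {f. (\<forall>n x. higher_vderiv n f differentiable (at x)) \<and>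
     (\<forall>m n. bdd_above (range (\<lambda>x. \<bar>x\<bar> ^ m * norm (higher_vderiv n f x))))}"

definition schwartz_seminorm :: "nat \<Rightarrow> nat \<Rightarrow> (real \<Rightarrow> complex) \<Rightarrow> real" where
  "schwartz_seminorm m n f = (SUP x. \<bar>x\<bar> ^ m * norm (higher_vderiv n f x))"

(* The last conjunct is continuity for the locally convex topology given by the seminorms.
   Distributions are undefined off the Schwartz space, so that equality of functionals
   is equality of tempered distributions. *)
definition tempered_distributions :: "((real \<Rightarrow> complex) \<Rightarrow> complex) set" where
  "tempered_distributions = {T \<in> extensional schwartz.
     (\<forall>f\<in>schwartz. \<forall>g\<in>schwartz. T (\<lambda>x. f x + g x) = T f + T g) \<and>
     (\<forall>c. \<forall>f\<in>schwartz. T (\<lambda>x. c * f x) = c * T f) \<and>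
     (\<exists>C N. \<forall>f\<in>schwartz. norm (T f) \<le> C * (\<Sum>m\<le>N. \<Sum>n\<le>N. schwartz_seminorm m n f))}"

definition fourier :: "(real \<Rightarrow> complex) \<Rightarrow> real \<Rightarrow> complex" where
  "fourier f l = (LINT x|lborel. exp (- \<i> * of_real (l * x)) * f x)"

definition fourier_distribution ::
    "((real \<Rightarrow> complex) \<Rightarrow> complex) \<Rightarrow> (real \<Rightarrow> complex) \<Rightarrow> complex" where
  "fourier_distribution T = restrict (\<lambda>\<phi>. T (fourier \<phi>)) schwartz"

definition regular_distribution ::
    "(real \<Rightarrow> complex) \<Rightarrow> (real \<Rightarrow> complex) \<Rightarrow> complex" where
  "regular_distribution f = restrict (\<lambda>\<phi>. LINT x|lborel. f x * \<phi> x) schwartz"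

definition dirac_zero :: "(real \<Rightarrow> complex) \<Rightarrow> complex" where
  "dirac_zero = restrict (\<lambda>\<phi>. \<phi> 0) schwartz"

definition pv_inverse :: "(real \<Rightarrow> complex) \<Rightarrow> complex" where
  "pv_inverse = restrict
     (\<lambda>\<phi>. Lim (at_right 0) (\<lambda>e. LINT x:{x. e < \<bar>x\<bar>}|lborel. \<phi> x / of_real x)) schwartz"

definition mu_symbol :: "real \<Rightarrow> real \<Rightarrow> complex" where
  "mu_symbol u l = exp (- 2 * \<i> * of_real u * of_real (arctan (2 * l)))"

definition mu_conv_power :: "real \<Rightarrow> (real \<Rightarrow> complex) \<Rightarrow> complex" where
  "mu_conv_power u = (THE T. T \<in> tempered_distributions \<and>
     fourier_distribution T = regular_distribution (mu_symbol u))"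

definition Gamma_log_deriv :: "real \<Rightarrow> real" where
  "Gamma_log_deriv x = deriv Gamma x / Gamma x"

definition Phi_term :: "real \<Rightarrow> real \<Rightarrow> nat \<Rightarrow> real" where
  "Phi_term u x k =
     pochhammer (1 - u * sgn x) k * \<bar>x\<bar> ^ k / (fact k * fact (k + 1)) *
     (Gamma_log_deriv (1 + real k - u * sgn x) - Gamma_log_deriv (1 + real k)
       - Gamma_log_deriv (2 + real k) + ln \<bar>x\<bar>)"

(* The value at 0 is irrelevant. *)
definition Phi :: "real \<Rightarrow> real \<Rightarrow> real" where
  "Phi u x =
     exp (- \<bar>x\<bar> / 2) *
       (- (u * sin (pi * u) / pi) * (\<Sum>k. Phi_term u x k) + sin (pi * u) / (pi * x))
     - sin (pi * u) / (pi * x)"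

definition square_integrable :: "(real \<Rightarrow> real) \<Rightarrow> bool" where
  "square_integrable f \<longleftrightarrow> f \<in> borel_measurable lborel \<and> integrable lborel (\<lambda>x. (f x)\<^sup>2)"

end

theory Submission
  imports Defs
    "HOL-Probability.Characteristic_Functions"
    "HOL-Probability.Sinc_Integral"
    "HOL-Real_Asymp.Real_Asymp"
begin

text \<open>
  Away from 0, the right-hand side of the decomposition has the density \<open>sin (pi * u) / pi * w x / x\<close>, where
  \<open>w\<close> is the decaying solution \<open>\<Gamma>(1 - u) W\<^bsub>u, 1/2\<^esub>(x)\<close> of Whittaker's equation \<open>w'' = (1 / 4 - u / x) w\<close> for
  \<open>x > 0\<close>, and the same function of \<open>\<bar>x\<bar>\<close> with \<open>- u\<close> in place of \<open>u\<close> for \<open>x < 0\<close>: the series in \<open>Phi\<close> is the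
  logarithmic part of a Tricomi function (\<open>Phi_eq\<close>). Three facts about \<open>w\<close> give the theorem.

  First, \<open>w\<close> decays exponentially (\<open>whittaker_decay\<close>). The power series alone suggests growth like
  \<open>exp (\<bar>x\<bar> / 2)\<close>. But divided by the growing solution it is, up to a factor and vanishing terms, an
  average of \<open>ln (x / n)\<close> over weights that concentrate at \<open>n\<close> close to \<open>x\<close>. Hence the quotient tends
  to 0 (\<open>tricomi_over_kummer_tendsto_0\<close>), and the Wronskian turns this into an exponential bound. With the
  logarithmic behaviour at 0 it follows that \<open>Phi\<close> is square integrable.

  Second, as a distribution, \<open>(1 / 4 - d\<^sup>2 / dx\<^sup>2) w\<close> is \<open>u\<close> times the principal value of \<open>w / x\<close> plus a
  point mass at 0 given by the jump of \<open>w'\<close>. The reflection formula for the digamma function evaluates the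
  jump, and after multiplication by \<open>sin (pi * u) / pi\<close> the point mass becomes \<open>u * cos (pi * u)\<close>
  (\<open>whittaker_green_line\<close>). So the right-hand side of the decomposition, times \<open>u\<close>, is
  \<open>sin (pi * u) / pi * (1 / 4 - d\<^sup>2 / dx\<^sup>2) w\<close>.

  Third, Whittaker's equation becomes a first-order equation for the Fourier transform of \<open>w\<close>, solved by the
  multiples of \<open>mu_symbol u l / (1 / 4 + l\<^sup>2)\<close>. Fourier inversion at 0, where \<open>w 0 = 1\<close>, fixes the factor
  (\<open>fourier_whittaker_line\<close>). Hence the Fourier transform of the right-hand side is the symbol.

  The Fourier transform maps the Schwartz space onto itself, so it suffices to test on Fourier transforms
  of Schwartz functions. The same surjectivity gives the uniqueness of \<open>mu_conv_power u\<close>, and its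
  existence is a continuity estimate.
\<close>

section \<open>Calculus on the line\<close>

lemma integrable_inverse_one_plus_square: "integrable lborel (\<lambda>x::real. inverse (1 + x\<^sup>2))"
  using integrable_inverse_1_plus_square by (simp add: set_integrable_def)

lemma integral_inverse_one_plus_square: "(LINT x|lborel. inverse (1 + x\<^sup>2)) = (pi::real)"
  using LBINT_inverse_1_plus_square by (simp add: interval_lebesgue_integral_def set_lebesgue_integral_def)

lemma nonneg_of_decreasing_to_0:
  fixes g g' :: "real \<Rightarrow> real"
  assumes d: "\<And>y. y \<ge> x \<Longrightarrow> (g has_real_derivative g' y) (at y)" "\<And>y. y \<ge> x \<Longrightarrow> g' y \<le> 0"
    and lim: "(g \<longlongrightarrow> 0) at_top"
  shows "0 \<le> g x"
proof (rule tendsto_upperbound[OF lim])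
  show "\<forall>\<^sub>F y in at_top. g y \<le> g x"
    using eventually_ge_at_top[of x]
  proof eventually_elim
    case (elim y)
    then show ?case using d by (intro DERIV_nonpos_imp_nonincreasing[of x y g]) blast+
  qed
qed simp

lemma bounded_near_0:
  fixes f :: "real \<Rightarrow> real"
  assumes f: "continuous_on {0<..} f" and lim: "(f \<longlongrightarrow> l) (at_right 0)"
  shows "\<exists>C. \<forall>x\<in>{0<..b}. \<bar>f x\<bar> \<le> C"
proof -
  have "\<forall>\<^sub>F x in at_right 0. \<bar>f x\<bar> < \<bar>l\<bar> + 1"
    using tendsto_rabs[OF lim] by (rule order_tendstoD) simp
  then obtain a where a: "a > 0" "\<And>x. 0 < x \<Longrightarrow> x < a \<Longrightarrow> \<bar>f x\<bar> < \<bar>l\<bar> + 1"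
    by (auto simp: eventually_at_right_field)
  have "compact (f ` {a..b})"
    using a(1) by (intro compact_continuous_image continuous_on_subset[OF f]) auto
  then obtain C where C: "\<And>x. x \<in> {a..b} \<Longrightarrow> \<bar>f x\<bar> \<le> C"
    by (meson bounded_real compact_imp_bounded imageI)
  have "\<bar>f x\<bar> \<le> max C (\<bar>l\<bar> + 1)" if "x \<in> {0<..b}" for x
    using a(2)[of x] C[of x] that by (cases "x < a") auto
  then show ?thesis by blast
qed

lemma integral_derivative_line:
  fixes F f :: "real \<Rightarrow> complex"
  assumes F: "\<And>x. (F has_vector_derivative f x) (at x)"
    and f: "\<And>x. isCont f x" "integrable lborel f"
    and lim: "(F \<longlongrightarrow> A) at_bot" "(F \<longlongrightarrow> B) at_top"
  shows "(LINT x|lborel. f x) = B - A"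
proof -
  have "(LBINT x=-\<infinity>..\<infinity>. f x) = B - A"
    by (rule interval_integral_FTC_integrable[where F=F])
       (use assms in \<open>auto simp: set_integrable_def ereal_tendsto_simps\<close>)
  then show ?thesis
    by (simp add: interval_lebesgue_integral_def set_lebesgue_integral_def)
qed

lemma integral_derivative_half_line:
  fixes F f :: "real \<Rightarrow> complex"
  assumes F: "\<And>x. x \<ge> a \<Longrightarrow> (F has_vector_derivative f x) (at x)"
    and f: "\<And>x. x > a \<Longrightarrow> isCont f x" "set_integrable lborel {a<..} f"
    and lim: "(F \<longlongrightarrow> 0) at_top"
  shows "(LINT x:{a<..}|lborel. f x) = - F a"
proof -
  have e: "einterval (ereal a) \<infinity> = {a<..}"
    by (auto simp: einterval_def)
  have "isCont F a"
    using F[of a] by (auto intro: has_vector_derivative_continuous)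
  then have "(F \<longlongrightarrow> F a) (at_right a)"
    by (auto simp: isCont_def intro: tendsto_within_subset)
  then have "(LBINT x=ereal a..\<infinity>. f x) = 0 - F a"
    by (intro interval_integral_FTC_integrable[where F=F])
       (use assms in \<open>auto simp: e ereal_tendsto_simps\<close>)
  then show ?thesis
    by (simp add: interval_lebesgue_integral_def e)
qed

lemma integrable_inverse_sqrt: "set_integrable lborel {0<..<1} (\<lambda>x::real. x powr (- 1 / 2))"
proof -
  have "set_integrable lborel (einterval 0 1) (\<lambda>x::real. x powr (- 1 / 2))"
  proof (rule interval_integral_FTC_nonneg(1)[where F="\<lambda>x. 2 * x powr (1 / 2)" and A=0 and B=2])
    show "((\<lambda>x. 2 * x powr (1 / 2)) has_real_derivative x powr (- 1 / 2)) (at x)" if "0 < ereal x" for x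
      using that by (auto intro!: derivative_eq_intros)
    show "isCont (\<lambda>x. x powr (- 1 / 2)) x" if "0 < ereal x" for x
      using that by (auto intro!: continuous_intros)
    have "((\<lambda>x::real. 2 * x powr (1 / 2)) \<longlongrightarrow> 0) (at_right 0)" "((\<lambda>x::real. 2 * x powr (1 / 2)) \<longlongrightarrow> 2) (at_left 1)"
      by real_asymp+
    then show "(((\<lambda>x. 2 * x powr (1 / 2)) \<circ> real_of_ereal) \<longlongrightarrow> 0) (at_right 0)"
        "(((\<lambda>x. 2 * x powr (1 / 2)) \<circ> real_of_ereal) \<longlongrightarrow> 2) (at_left 1)"
      by (simp_all add: zero_ereal_def one_ereal_def ereal_tendsto_simps)
  qed auto
  moreover have "einterval 0 1 = {0<..<1}"
    by (auto simp: einterval_def zero_ereal_def one_ereal_def)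
  ultimately show ?thesis by simp
qed

abbreviation outside :: "real \<Rightarrow> real set" where
  "outside e \<equiv> {x. e < \<bar>x\<bar>}"

lemma integrable_outside_tendsto:
  fixes g :: "real \<Rightarrow> complex"
  assumes g: "integrable lborel g"
  shows "((\<lambda>e. LINT x:outside e|lborel. g x) \<longlongrightarrow> (LINT x|lborel. g x)) (at_right 0)"
  unfolding tendsto_at_iff_sequentially
proof (intro allI impI)
  fix X :: "nat \<Rightarrow> real" assume X: "\<forall>i. X i \<in> {0<..} - {0}" "X \<longlonglongrightarrow> 0"
  have [measurable]: "g \<in> borel_measurable borel" using g by (simp add: integrable_iff_bounded)
  have "(\<lambda>n. LINT x|lborel. indicator {x. X n < \<bar>x\<bar>} x *\<^sub>R g x) \<longlonglongrightarrow> (LINT x|lborel. g x)"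
  proof (rule integral_dominated_convergence[where w="\<lambda>x. norm (g x)"])
    show "AE x in lborel. (\<lambda>n. indicator {x. X n < \<bar>x\<bar>} x *\<^sub>R g x) \<longlonglongrightarrow> g x"
      using AE_lborel_singleton[of 0]
    proof eventually_elim
      case (elim x)
      have "\<forall>\<^sub>F n in sequentially. X n < \<bar>x\<bar>"
        by (rule order_tendstoD(2)[OF X(2)]) (use elim in simp)
      then show ?case by (intro tendsto_eventually) (auto elim!: eventually_mono)
    qed
    show "AE x in lborel. norm (indicator {x. X n < \<bar>x\<bar>} x *\<^sub>R g x) \<le> norm (g x)" for n
      by (auto simp: indicator_def)
  qed (use g in auto)
  then show "((\<lambda>e. LINT x:outside e|lborel. g x) \<circ> X) \<longlonglongrightarrow> (LINT x|lborel. g x)"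
    by (simp add: o_def set_lebesgue_integral_def)
qed

lemma set_integrable_of_integrable:
  fixes f :: "'a \<Rightarrow> complex"
  shows "integrable M f \<Longrightarrow> A \<in> sets M \<Longrightarrow> set_integrable M A f"
  using integrable_mult_indicator[of A M f] by (simp add: set_integrable_def)

lemma set_integral_reflect:
  fixes f :: "real \<Rightarrow> complex"
  shows "(LINT x:{a<..}|lborel. f (- x)) = (LINT x:{..<- a}|lborel. f x)"
    and "set_integrable lborel {a<..} (\<lambda>x. f (- x)) \<longleftrightarrow> set_integrable lborel {..<- a} f"
proof -
  let ?g = "\<lambda>x. indicator {..<- a} x *\<^sub>R f x"
  have g: "?g (0 + - 1 * x) = indicator {a<..} x *\<^sub>R f (- x)" for x
    by (auto simp: indicator_def)
  have "(LINT x|lborel. ?g x) = \<bar>- 1\<bar> *\<^sub>R (LINT x|lborel. ?g (0 + - 1 * x))"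
    by (rule lborel_integral_real_affine) simp
  then show "(LINT x:{a<..}|lborel. f (- x)) = (LINT x:{..<- a}|lborel. f x)"
    unfolding g set_lebesgue_integral_def by simp
  show "set_integrable lborel {a<..} (\<lambda>x. f (- x)) \<longleftrightarrow> set_integrable lborel {..<- a} f"
    using lborel_integrable_real_affine_iff[of "- 1" ?g 0] unfolding g set_integrable_def by simp
qed

lemma has_vector_derivative_exp_mult:
  assumes "(h has_real_derivative h') (at x)"
  shows "((\<lambda>x. exp (c * complex_of_real (h x))) has_vector_derivative c * of_real h' * exp (c * of_real (h x))) (at x)"
  using field_vector_diff_chain_at[OF has_vector_derivative_mult_right[OF has_vector_derivative_of_real[OF assms], of c] DERIV_exp]
  by (simp add: o_def)

section \<open>The Fourier transform of integrable functions\<close>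

lemma norm_exp_i [simp]: "norm (exp (- (\<i> * complex_of_real t))) = 1"
  by (simp add: norm_exp_eq_Re)

lemma integrable_fourier_kernel:
  assumes "integrable lborel f"
  shows "integrable lborel (\<lambda>x. exp (- \<i> * of_real (l * x)) * f x)"
  by (rule Bochner_Integration.integrable_bound[OF assms])
     (use assms in \<open>auto simp: norm_mult\<close>)

lemma norm_fourier_le:
  assumes "integrable lborel f"
  shows "norm (fourier f l) \<le> (LINT x|lborel. norm (f x))"
proof -
  have "norm (fourier f l) \<le> (LINT x|lborel. norm (exp (- \<i> * of_real (l * x)) * f x))"
    unfolding fourier_def by (rule integral_norm_bound)
  then show ?thesis by (simp add: norm_mult)
qed

lemma fourier_add:
  assumes "integrable lborel f" "integrable lborel g"
  shows "fourier (\<lambda>x. f x + g x) l = fourier f l + fourier g l"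
  using integrable_fourier_kernel[OF assms(1)] integrable_fourier_kernel[OF assms(2)]
  by (simp add: fourier_def distrib_left)

lemma fourier_cmult: "fourier (\<lambda>x. c * f x) l = c * fourier f l"
proof -
  have "fourier (\<lambda>x. c * f x) l = (LINT x|lborel. c * (exp (- \<i> * of_real (l * x)) * f x))"
    by (simp add: fourier_def mult.left_commute)
  then show ?thesis unfolding fourier_def by simp
qed

lemma fourier_reflect: "fourier (\<lambda>x. f (- x)) l = fourier f (- l)"
proof -
  let ?g = "\<lambda>x. exp (- \<i> * of_real (- l * x)) * f x"
  have "(LINT x|lborel. ?g x) = \<bar>- 1\<bar> *\<^sub>R (LINT x|lborel. ?g (0 + - 1 * x))"
    by (rule lborel_integral_real_affine) simp
  then show ?thesis unfolding fourier_def by simp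
qed

text \<open>Dominated convergence: \<open>2 * \<bar>x\<bar> * norm (f x)\<close> bounds the remainders of the difference quotients.\<close>

lemma fourier_has_vector_derivative:
  assumes f: "integrable lborel f" and xf: "integrable lborel (\<lambda>x. of_real x * f x)"
  shows "(fourier f has_vector_derivative fourier (\<lambda>x. - \<i> * of_real x * f x) l) (at l)"
proof -
  define r where "r h x = exp (- \<i> * of_real (l * x)) * f x *
      ((exp (- \<i> * of_real (h * x)) - 1 + \<i> * of_real (h * x)) / of_real h)" for h x
  have mf [measurable]: "f \<in> borel_measurable borel"
    using f by (simp add: integrable_iff_bounded)
  have bnd1: "norm (exp (- \<i> * of_real t) - 1 + \<i> * of_real t) \<le> 2 * \<bar>t\<bar>" for t :: real
    using iexp_approx2[of "-t" 1] by (simp add: algebra_simps)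
  have bnd2: "norm (exp (- \<i> * of_real t) - 1 + \<i> * of_real t) \<le> t\<^sup>2" for t :: real
  proof -
    have "2 * norm (exp (- \<i> * of_real t) - 1 + \<i> * of_real t) \<le> t\<^sup>2"
      using iexp_approx1[of "-t" 1] by (simp add: algebra_simps power2_eq_square)
    then show ?thesis
      using norm_ge_zero[of "exp (- \<i> * of_real t) - 1 + \<i> * of_real t"] by linarith
  qed
  have r_bound: "norm (r h x) \<le> 2 * norm (of_real x * f x)" if "h \<noteq> 0" for h x
  proof -
    have "norm (r h x) = norm (f x) * (norm (exp (- \<i> * of_real (h * x)) - 1 + \<i> * of_real (h * x)) / \<bar>h\<bar>)"
      by (simp add: r_def norm_mult norm_divide)
    also have "\<dots> \<le> norm (f x) * ((2 * \<bar>h * x\<bar>) / \<bar>h\<bar>)"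
      by (intro mult_left_mono divide_right_mono bnd1) auto
    finally show ?thesis using that by (simp add: abs_mult norm_mult mult_ac)
  qed
  have r_lim: "((\<lambda>h. r h x) \<longlongrightarrow> 0) (at 0)" for x
  proof (rule Lim_null_comparison)
    show "\<forall>\<^sub>F h in at 0. norm (r h x) \<le> norm (f x) * x\<^sup>2 * \<bar>h\<bar>"
    proof (rule eventually_mono[OF eventually_neq_at_within[of 0]])
      fix h :: real assume h: "h \<noteq> 0"
      have "norm (r h x) = norm (f x) * (norm (exp (- \<i> * of_real (h * x)) - 1 + \<i> * of_real (h * x)) / \<bar>h\<bar>)"
        by (simp add: r_def norm_mult norm_divide)
      also have "\<dots> \<le> norm (f x) * ((h * x)\<^sup>2 / \<bar>h\<bar>)"
        by (intro mult_left_mono divide_right_mono bnd2) auto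
      also have "(h * x)\<^sup>2 / \<bar>h\<bar> = x\<^sup>2 * \<bar>h\<bar>"
        using h by (simp add: power2_eq_square field_simps abs_if)
      finally show "norm (r h x) \<le> norm (f x) * x\<^sup>2 * \<bar>h\<bar>" by (simp add: mult_ac)
    qed
    show "((\<lambda>h. norm (f x) * x\<^sup>2 * \<bar>h\<bar>) \<longlongrightarrow> 0) (at 0)"
      by (rule tendsto_eq_intros | simp)+
  qed
  have r_meas [measurable]: "r h \<in> borel_measurable borel" for h
    unfolding r_def by measurable
  have lim: "((\<lambda>h. LINT x|lborel. r h x) \<longlongrightarrow> 0) (at 0)"
    unfolding tendsto_at_iff_sequentially
  proof (intro allI impI)
    fix X :: "nat \<Rightarrow> real" assume X: "\<forall>i. X i \<in> UNIV - {0}" "X \<longlonglongrightarrow> 0"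
    have "(\<lambda>n. LINT x|lborel. r (X n) x) \<longlonglongrightarrow> (LINT x|(lborel::real measure). (0::complex))"
    proof (rule integral_dominated_convergence[where w="\<lambda>x. 2 * norm (of_real x * f x)"])
      show "integrable lborel (\<lambda>x. 2 * norm (complex_of_real x * f x))"
        using xf by (intro integrable_mult_right integrable_norm)
      show "AE x in lborel. (\<lambda>n. r (X n) x) \<longlonglongrightarrow> 0"
        using r_lim X by (auto simp: tendsto_at_iff_sequentially o_def)
    qed (use X r_bound in auto)
    then show "((\<lambda>h. LINT x|lborel. r h x) \<circ> X) \<longlonglongrightarrow> 0" by (simp add: o_def)
  qed
  have quot: "(LINT x|lborel. r h x) =
      (fourier f (l + h) - fourier f l - of_real h * fourier (\<lambda>x. - \<i> * of_real x * f x) l) / of_real h"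
    if "h \<noteq> 0" for h
  proof -
    have xf': "integrable lborel (\<lambda>x. - \<i> * of_real x * f x)"
      using integrable_mult_right[OF xf, of "-\<i>"] by (simp add: mult.assoc)
    have "(\<lambda>x. r h x) = (\<lambda>x. (exp (- \<i> * of_real ((l + h) * x)) * f x - exp (- \<i> * of_real (l * x)) * f x
          - of_real h * (exp (- \<i> * of_real (l * x)) * (- \<i> * of_real x * f x))) / of_real h)"
      unfolding r_def by (rule ext) (simp add: algebra_simps exp_add exp_diff exp_minus divide_simps)
    then show ?thesis
      using integrable_fourier_kernel[OF f, of l] integrable_fourier_kernel[OF f, of "l + h"]
        integrable_fourier_kernel[OF xf', of l] by (simp add: fourier_def)
  qed
  have "((\<lambda>h. (fourier f (l + h) - fourier f l - of_real h * fourier (\<lambda>x. - \<i> * of_real x * f x) l)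
      / of_real h) \<longlongrightarrow> 0) (at 0)"
    by (rule Lim_transform_eventually[OF lim])
       (auto simp: quot eventually_at_filter)
  from tendsto_norm_zero[OF this] show ?thesis
    unfolding has_vector_derivative_def has_derivative_at
    by (auto simp: norm_divide scaleR_conv_of_real intro: bounded_linear_compose[OF bounded_linear_mult_left bounded_linear_of_real])
qed

lemma fourier_measurable [measurable]:
  assumes "integrable lborel f"
  shows "fourier f \<in> borel_measurable borel"
proof -
  have [measurable]: "f \<in> borel_measurable borel"
    using assms by (simp add: integrable_iff_bounded)
  show ?thesis unfolding fourier_def[abs_def]
    by (rule sigma_finite_measure.borel_measurable_lebesgue_integral[OF sigma_finite_lborel]) measurable
qed

text \<open>By Fubini, both sides are the double integral of \<open>exp (- \<i> l x) * f x * g l\<close>.\<close>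

lemma fourier_multiplication_formula:
  assumes f: "integrable lborel f" and g: "integrable lborel g"
  shows "(LINT l|lborel. fourier f l * g l) = (LINT x|lborel. f x * fourier g x)"
proof -
  have [measurable]: "f \<in> borel_measurable borel" "g \<in> borel_measurable borel"
    using assms by (auto simp: integrable_iff_bounded)
  define k where "k = (\<lambda>(x, l). exp (- \<i> * of_real (l * x)) * f x * g l)"
  have "integrable (lborel \<Otimes>\<^sub>M lborel) k"
  proof (rule lborel_pair.Fubini_integrable)
    show "k \<in> borel_measurable (lborel \<Otimes>\<^sub>M lborel)"
      unfolding k_def by measurable
    have "(\<lambda>x. LINT l|lborel. norm (k (x, l))) = (\<lambda>x. norm (f x) * (LINT l|lborel. norm (g l)))"
      by (simp add: k_def norm_mult)
    then show "integrable lborel (\<lambda>x. LINT l|lborel. norm (k (x, l)))"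
      using f by simp
    show "AE x in lborel. integrable lborel (\<lambda>l. k (x, l))"
    proof (rule AE_I2)
      fix x
      have "integrable lborel (\<lambda>l. f x * (exp (- \<i> * of_real (x * l)) * g l))"
        by (intro integrable_mult_right integrable_fourier_kernel g)
      then show "integrable lborel (\<lambda>l. k (x, l))" by (simp add: k_def mult_ac)
    qed
  qed
  from lborel_pair.Fubini_integral[OF _, of "\<lambda>x l. k (x, l)"] this
  have "(LINT l|lborel. LINT x|lborel. k (x, l)) = (LINT x|lborel. LINT l|lborel. k (x, l))"
    by simp
  moreover have "(LINT x|lborel. k (x, l)) = fourier f l * g l" for l
    unfolding fourier_def k_def by simp
  moreover have "(LINT l|lborel. k (x, l)) = f x * fourier g x" for x
  proof -
    have "(LINT l|lborel. k (x, l)) = (LINT l|lborel. f x * (exp (- \<i> * of_real (x * l)) * g l))"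
      unfolding k_def by (simp add: mult_ac)
    then show ?thesis unfolding fourier_def by simp
  qed
  ultimately show ?thesis by simp
qed

section \<open>The Schwartz space\<close>

lemma higher_vderiv_0 [simp]: "higher_vderiv 0 f = f"
  by (simp add: higher_vderiv_def)

lemma higher_vderiv_Suc:
  "higher_vderiv (Suc n) f = (\<lambda>x. vector_derivative (higher_vderiv n f) (at x))"
  by (simp add: higher_vderiv_def)

lemma higher_vderiv_higher_vderiv: "higher_vderiv m (higher_vderiv n f) = higher_vderiv (m + n) f"
  by (simp add: higher_vderiv_def funpow_add)

lemma higher_vderiv_eqI:
  assumes "\<And>n x. (g n has_vector_derivative g (Suc n) x) (at x)"
  shows "higher_vderiv n (g 0) = g n"
  by (induction n) (use assms in \<open>auto simp: higher_vderiv_Suc vector_derivative_at\<close>)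

text \<open>
  Membership is shown by exhibiting the whole sequence of derivatives, since \<open>higher_vderiv\<close> is
  defined by iterated choice and cannot be computed term by term.
\<close>

lemma schwartzI:
  assumes g: "\<And>n x. (g n has_vector_derivative g (Suc n) x) (at x)"
    and bound: "\<And>m n. \<exists>K. \<forall>x. \<bar>x\<bar> ^ m * norm (g n x) \<le> K"
  shows "g 0 \<in> schwartz"
proof -
  have "g n differentiable (at x)" for n x
    using g differentiableI_vector by blast
  moreover have "bdd_above (range (\<lambda>x. \<bar>x\<bar> ^ m * norm (g n x)))" for m n
    using bound[of m n] by (auto simp: bdd_above_def)
  ultimately show ?thesis
    by (simp add: schwartz_def higher_vderiv_eqI[where g=g, OF g])
qed

lemma schwartz_higher_vderiv: "f \<in> schwartz \<Longrightarrow> higher_vderiv n f \<in> schwartz"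
  by (simp add: schwartz_def higher_vderiv_higher_vderiv)

lemma schwartz_vderiv:
  "f \<in> schwartz \<Longrightarrow> (higher_vderiv n f has_vector_derivative higher_vderiv (Suc n) f x) (at x)"
  by (auto simp: schwartz_def higher_vderiv_Suc vector_derivative_works)

lemma schwartz_seminorm_upper:
  "f \<in> schwartz \<Longrightarrow> \<bar>x\<bar> ^ m * norm (higher_vderiv n f x) \<le> schwartz_seminorm m n f"
  unfolding schwartz_seminorm_def by (rule cSUP_upper) (auto simp: schwartz_def)

lemma schwartz_seminorm_nonneg: "f \<in> schwartz \<Longrightarrow> 0 \<le> schwartz_seminorm m n f"
  by (rule order.trans[OF _ schwartz_seminorm_upper[where x=0]]) auto

lemma schwartz_continuous: "f \<in> schwartz \<Longrightarrow> isCont (higher_vderiv n f) x"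
  using schwartz_vderiv has_vector_derivative_continuous by blast

lemma schwartz_measurable: "f \<in> schwartz \<Longrightarrow> f \<in> borel_measurable borel"
  using schwartz_continuous[where f=f and n=0]
  by (intro borel_measurable_continuous_onI continuous_at_imp_continuous_on) auto

lemma schwartz_add:
  assumes f: "f \<in> schwartz" and g: "g \<in> schwartz"
  shows "(\<lambda>x. f x + g x) \<in> schwartz"
proof -
  have "\<exists>K. \<forall>x. \<bar>x\<bar> ^ m * norm (higher_vderiv n f x + higher_vderiv n g x) \<le> K" for m n
  proof (intro exI allI)
    fix x :: real
    have "\<bar>x\<bar> ^ m * norm (higher_vderiv n f x + higher_vderiv n g x)
        \<le> \<bar>x\<bar> ^ m * (norm (higher_vderiv n f x) + norm (higher_vderiv n g x))"
      by (intro mult_left_mono norm_triangle_ineq) auto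
    also have "\<dots> \<le> schwartz_seminorm m n f + schwartz_seminorm m n g"
      using schwartz_seminorm_upper[OF f, of x m n] schwartz_seminorm_upper[OF g, of x m n]
      by (simp add: distrib_left)
    finally show "\<bar>x\<bar> ^ m * norm (higher_vderiv n f x + higher_vderiv n g x)
        \<le> schwartz_seminorm m n f + schwartz_seminorm m n g" .
  qed
  from schwartzI[of "\<lambda>n x. higher_vderiv n f x + higher_vderiv n g x", OF _ this] show ?thesis
    using f g by (auto intro!: derivative_intros schwartz_vderiv)
qed

lemma schwartz_cmult:
  assumes f: "f \<in> schwartz"
  shows "(\<lambda>x. c * f x) \<in> schwartz"
proof -
  have "\<exists>K. \<forall>x. \<bar>x\<bar> ^ m * norm (c * higher_vderiv n f x) \<le> K" for m n
  proof (intro exI allI)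
    fix x :: real
    show "\<bar>x\<bar> ^ m * norm (c * higher_vderiv n f x) \<le> norm c * schwartz_seminorm m n f"
      using mult_left_mono[OF schwartz_seminorm_upper[OF f, of x m n], of "norm c"]
      by (simp add: norm_mult mult_ac)
  qed
  from schwartzI[of "\<lambda>n x. c * higher_vderiv n f x", OF _ this] show ?thesis
    using f by (auto intro!: derivative_intros schwartz_vderiv)
qed

lemma schwartz_reflect:
  assumes f: "f \<in> schwartz"
  shows "(\<lambda>x. f (- x)) \<in> schwartz"
proof -
  have "\<exists>K. \<forall>x. \<bar>x\<bar> ^ m * norm ((-1) ^ n * higher_vderiv n f (- x)) \<le> K" for m n
    using schwartz_seminorm_upper[OF f, of "- _" m n] by (auto simp: norm_mult norm_power)
  moreover have "((\<lambda>x. (-1) ^ n * higher_vderiv n f (- x)) has_vector_derivative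
      (-1) ^ Suc n * higher_vderiv (Suc n) f (- x)) (at x)" for n x
  proof -
    have "((higher_vderiv n f \<circ> uminus) has_vector_derivative (- 1) *\<^sub>R higher_vderiv (Suc n) f (- x)) (at x)"
      by (rule vector_diff_chain_at) (auto intro!: derivative_eq_intros schwartz_vderiv f)
    then show ?thesis
      by (auto simp: o_def intro!: derivative_eq_intros)
  qed
  ultimately show ?thesis
    using schwartzI[of "\<lambda>n x. (-1) ^ n * higher_vderiv n f (- x)"] by simp
qed

lemma schwartz_mult_ident:
  assumes f: "f \<in> schwartz"
  shows "(\<lambda>x. of_real x * f x) \<in> schwartz"
proof -
  \<comment> \<open>Leibniz rule; for \<open>n = 0\<close> the truncated index \<open>n - 1\<close> is harmless because of the factor \<open>n\<close>.\<close>
  let ?g = "\<lambda>n x. of_real x * higher_vderiv n f x + of_nat n * higher_vderiv (n - 1) f x"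
  have "\<exists>K. \<forall>x. \<bar>x\<bar> ^ m * norm (?g n x) \<le> K" for m n
  proof (intro exI allI)
    fix x :: real
    have "\<bar>x\<bar> ^ m * norm (?g n x) \<le> \<bar>x\<bar> ^ m * (norm (of_real x * higher_vderiv n f x) +
        norm (of_nat n * higher_vderiv (n - 1) f x))"
      by (intro mult_left_mono norm_triangle_ineq) auto
    also have "\<dots> = \<bar>x\<bar> ^ Suc m * norm (higher_vderiv n f x) +
        real n * (\<bar>x\<bar> ^ m * norm (higher_vderiv (n - 1) f x))"
      by (simp add: algebra_simps norm_mult)
    also have "\<dots> \<le> schwartz_seminorm (Suc m) n f + real n * schwartz_seminorm m (n - 1) f"
      by (intro add_mono mult_left_mono schwartz_seminorm_upper f) auto
    finally show "\<bar>x\<bar> ^ m * norm (?g n x) \<le> \<dots>" .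
  qed
  moreover have "(?g n has_vector_derivative ?g (Suc n) x) (at x)" for n x
  proof (cases n)
    case 0
    then show ?thesis
      by (auto intro!: derivative_eq_intros has_vector_derivative_of_real schwartz_vderiv[OF f, of 0, simplified]
          simp: algebra_simps)
  next
    case (Suc k)
    then show ?thesis
      by (auto intro!: derivative_eq_intros has_vector_derivative_of_real schwartz_vderiv[OF f] simp: algebra_simps)
  qed
  ultimately show ?thesis
    using schwartzI[of ?g] by simp
qed

lemma schwartz_norm_le:
  assumes f: "f \<in> schwartz"
  shows "norm (f x) \<le> (schwartz_seminorm 0 0 f + schwartz_seminorm 2 0 f) * inverse (1 + x\<^sup>2)"
proof -
  have "norm (f x) * (1 + x\<^sup>2) \<le> schwartz_seminorm 0 0 f + schwartz_seminorm 2 0 f"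
    using schwartz_seminorm_upper[OF f, of x 0 0] schwartz_seminorm_upper[OF f, of x 2 0]
    by (simp add: algebra_simps)
  moreover have "1 + x\<^sup>2 > 0" by (rule add_pos_nonneg) auto
  ultimately show ?thesis by (simp add: field_simps)
qed

lemma schwartz_integrable:
  assumes f: "f \<in> schwartz"
  shows "integrable lborel f"
proof (rule Bochner_Integration.integrable_bound)
  show "integrable lborel (\<lambda>x. (schwartz_seminorm 0 0 f + schwartz_seminorm 2 0 f) * inverse (1 + x\<^sup>2))"
    by (intro integrable_mult_right integrable_inverse_one_plus_square)
  show "AE x in lborel. norm (f x) \<le> norm ((schwartz_seminorm 0 0 f + schwartz_seminorm 2 0 f) * inverse (1 + x\<^sup>2))"
    by (auto intro!: order.trans[OF schwartz_norm_le[OF f] abs_ge_self])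
qed (use schwartz_measurable[OF f] in auto)

lemma schwartz_integral_norm_le:
  assumes f: "f \<in> schwartz"
  shows "(LINT x|lborel. norm (f x)) \<le> pi * (schwartz_seminorm 0 0 f + schwartz_seminorm 2 0 f)"
proof -
  have "(LINT x|lborel. norm (f x)) \<le>
      (LINT x|lborel. (schwartz_seminorm 0 0 f + schwartz_seminorm 2 0 f) * inverse (1 + x\<^sup>2))"
    by (intro integral_mono integrable_norm schwartz_integrable f integrable_mult_right
        integrable_inverse_one_plus_square schwartz_norm_le)
  then show ?thesis by (simp add: integral_inverse_one_plus_square mult.commute)
qed

lemma schwartz_tendsto_0:
  assumes f: "f \<in> schwartz" and F: "filterlim (\<lambda>x::real. \<bar>x\<bar>) at_top F"
  shows "(f \<longlongrightarrow> 0) F"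
proof (rule Lim_null_comparison)
  show "\<forall>\<^sub>F x in F. norm (f x) \<le> schwartz_seminorm 1 0 f / \<bar>x\<bar>"
    using filterlim_at_top_dense[THEN iffD1, OF F, rule_format, of 0]
  proof eventually_elim
    case (elim x)
    then show ?case
      using schwartz_seminorm_upper[OF f, of x 1 0] by (simp add: field_simps)
  qed
  show "((\<lambda>x. schwartz_seminorm 1 0 f / \<bar>x\<bar>) \<longlongrightarrow> 0) F"
    by (intro tendsto_divide_0[OF tendsto_const] filterlim_at_top_imp_at_infinity F)
qed

section \<open>The Fourier transform on the Schwartz space\<close>

text \<open>
  Integration by parts: the derivative of \<open>exp (- \<i> l x) * f x\<close> integrates to 0.
\<close>

lemma fourier_derivative:
  assumes f: "f \<in> schwartz"
  shows "fourier (higher_vderiv 1 f) l = \<i> * of_real l * fourier f l"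
proof -
  let ?e = "\<lambda>x. exp (- \<i> * of_real (l * x))"
  have e: "((\<lambda>x. ?e x * f x) has_vector_derivative
      ?e x * higher_vderiv 1 f x - \<i> * of_real l * (?e x * f x)) (at x)" for x
  proof -
    have "(?e has_vector_derivative - \<i> * of_real l * ?e x) (at x)"
      by (rule has_vector_derivative_exp_mult) (auto intro!: derivative_eq_intros)
    from has_vector_derivative_mult[OF this schwartz_vderiv[OF f, of 0]] show ?thesis
      by (simp add: algebra_simps)
  qed
  have lim: "((\<lambda>x. ?e x * f x) \<longlongrightarrow> 0) F" if "filterlim (\<lambda>x::real. \<bar>x\<bar>) at_top F" for F
    by (rule tendsto_norm_zero_cancel)
       (use tendsto_norm_zero[OF schwartz_tendsto_0[OF f that]] in \<open>simp add: norm_mult\<close>)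
  note int = integrable_fourier_kernel[OF schwartz_integrable[OF f], of l]
    integrable_fourier_kernel[OF schwartz_integrable[OF schwartz_higher_vderiv[OF f, of 1]], of l]
  have "(LINT x|lborel. ?e x * higher_vderiv 1 f x - \<i> * of_real l * (?e x * f x)) = 0 - 0"
  proof (rule integral_derivative_line[where F="\<lambda>x. ?e x * f x", OF e])
    show "isCont (\<lambda>x. ?e x * higher_vderiv 1 f x - \<i> * of_real l * (?e x * f x)) x" for x
      using schwartz_continuous[OF f, where n=0] schwartz_continuous[OF f, where n=1] by (intro continuous_intros) auto
    show "integrable lborel (\<lambda>x. ?e x * higher_vderiv 1 f x - \<i> * of_real l * (?e x * f x))"
      using int by (intro Bochner_Integration.integrable_diff integrable_mult_right) auto
    show "((\<lambda>x. ?e x * f x) \<longlongrightarrow> 0) at_top"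
      by (rule lim) (rule filterlim_abs_real)
    show "((\<lambda>x. ?e x * f x) \<longlongrightarrow> 0) at_bot"
      by (rule lim) real_asymp
  qed
  then show ?thesis
    using int by (simp add: fourier_def)
qed

lemma fourier_higher_derivative:
  assumes f: "f \<in> schwartz"
  shows "fourier (higher_vderiv m f) l = (\<i> * of_real l) ^ m * fourier f l"
proof (induction m)
  case (Suc m)
  have "fourier (higher_vderiv (Suc m) f) l = fourier (higher_vderiv 1 (higher_vderiv m f)) l"
    by (simp add: higher_vderiv_higher_vderiv)
  also have "\<dots> = \<i> * of_real l * fourier (higher_vderiv m f) l"
    by (rule fourier_derivative[OF schwartz_higher_vderiv[OF f]])
  finally show ?case by (simp add: Suc)
qed simp

lemma fourier_vderiv:
  assumes f: "f \<in> schwartz"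
  shows "(fourier f has_vector_derivative fourier (\<lambda>x. - \<i> * of_real x * f x) l) (at l)"
  using f by (intro fourier_has_vector_derivative schwartz_integrable schwartz_mult_ident)

text \<open>
  The transform turns derivatives in \<open>l\<close> into powers of \<open>x\<close>, and powers of \<open>l\<close> into derivatives in
  \<open>x\<close>, so every weighted derivative of \<open>fourier f\<close> is bounded by the \<open>L\<^sup>1\<close> norm of a Schwartz function.
\<close>

lemma
  assumes f: "f \<in> schwartz"
  shows fourier_schwartz: "fourier f \<in> schwartz"
    and higher_vderiv_fourier: "higher_vderiv n (fourier f) = fourier (\<lambda>x. (- \<i> * of_real x) ^ n * f x)"
proof -
  have xf: "(\<lambda>x. (- \<i> * of_real x) ^ n * f x) \<in> schwartz" for n
  proof (induction n)
    case (Suc n)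
    from schwartz_cmult[OF schwartz_mult_ident[OF this], of "-\<i>"] show ?case
      by (simp add: mult_ac)
  qed (use f in simp)
  let ?g = "\<lambda>n. fourier (\<lambda>x. (- \<i> * of_real x) ^ n * f x)"
  have g: "(?g n has_vector_derivative ?g (Suc n) x) (at x)" for n x
    using fourier_vderiv[OF xf[of n], of x] by (simp add: mult_ac)
  have "\<exists>K. \<forall>l. \<bar>l\<bar> ^ m * norm (?g n l) \<le> K" for m n
  proof (intro exI allI)
    fix l :: real
    have "\<bar>l\<bar> ^ m * norm (?g n l) = norm (fourier (higher_vderiv m (\<lambda>x. (- \<i> * of_real x) ^ n * f x)) l)"
      by (subst fourier_higher_derivative[OF xf]) (simp add: norm_mult norm_power)
    also have "\<dots> \<le> (LINT x|lborel. norm (higher_vderiv m (\<lambda>x. (- \<i> * of_real x) ^ n * f x) x))"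
      by (intro norm_fourier_le schwartz_integrable schwartz_higher_vderiv xf)
    finally show "\<bar>l\<bar> ^ m * norm (?g n l) \<le> \<dots>" .
  qed
  from schwartzI[of ?g, OF g this] higher_vderiv_eqI[of ?g, OF g]
  show "fourier f \<in> schwartz" "higher_vderiv n (fourier f) = ?g n" by simp_all
qed

lemma fourier_gaussian:
  "fourier (\<lambda>l. of_real (exp (- l\<^sup>2 / 2))) x = of_real (sqrt (2 * pi) * exp (- x\<^sup>2 / 2))"
proof -
  have "of_real (exp (- (- x)\<^sup>2 / 2)) = char std_normal_distribution (- x)"
    by (simp add: char_std_normal_distribution)
  also have "\<dots> = (LINT l|lborel. std_normal_density l *\<^sub>R iexp (- x * l))"
    unfolding char_def by (subst integral_density) (auto simp: normal_density_nonneg)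
  also have "\<dots> = (LINT l|lborel. (1 / sqrt (2 * pi)) *\<^sub>R (exp (- \<i> * of_real (x * l)) * of_real (exp (- l\<^sup>2 / 2))))"
    by (intro Bochner_Integration.integral_cong) (auto simp: std_normal_density_def scaleR_conv_of_real)
  also have "\<dots> = (1 / sqrt (2 * pi)) *\<^sub>R fourier (\<lambda>l. of_real (exp (- l\<^sup>2 / 2))) x"
    unfolding fourier_def by (rule integral_scaleR_right)
  finally show ?thesis
    by (simp add: scaleR_conv_of_real field_simps)
qed

lemma integrable_gaussian: "integrable lborel (\<lambda>l::real. complex_of_real (exp (- l\<^sup>2 / 2)))"
proof -
  have "integrable lborel (\<lambda>l::real. sqrt (2 * pi) * std_normal_density l)"
    by (intro integrable_mult_right) (use integrable_std_normal_moment[of 0] in simp)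
  then have "integrable lborel (\<lambda>l::real. exp (- l\<^sup>2 / 2))"
    by (simp add: std_normal_density_def)
  then show ?thesis by (rule integrable_of_real)
qed

text \<open>
  Testing against the Gaussians \<open>exp (- (l / (n + 1))\<^sup>2 / 2)\<close>, which increase to the constant 1, turns
  the integral of \<open>fourier f\<close> into averages of \<open>f\<close> against Gaussians that concentrate at 0.
\<close>

lemma fourier_inversion_at_0:
  fixes f :: "real \<Rightarrow> complex"
  assumes f: "integrable lborel f" and Ff: "integrable lborel (fourier f)"
    and bound: "\<And>x. norm (f x) \<le> B" and cont: "isCont f 0"
  shows "(LINT l|lborel. fourier f l) = 2 * pi * f 0"
proof -
  let ?g = "\<lambda>t::real. complex_of_real (exp (- t\<^sup>2 / 2))"
  let ?s = "\<lambda>n. inverse (real (Suc n))"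
  have [measurable]: "f \<in> borel_measurable borel"
    using f by (simp add: integrable_iff_bounded)
  note [measurable] = fourier_measurable[OF f]
  have s: "?s \<longlonglongrightarrow> 0" by (rule LIMSEQ_inverse_real_of_nat)
  have eq: "(LINT l|lborel. fourier f l * ?g (?s n * l)) =
      of_real (sqrt (2 * pi)) * (LINT y|lborel. f (?s n * y) * ?g y)" for n
  proof -
    have gs: "integrable lborel (\<lambda>l. ?g (?s n * l))"
      using lborel_integrable_real_affine[OF integrable_gaussian, of "?s n" 0] by simp
    have fg: "fourier (\<lambda>l. ?g (?s n * l)) x =
        of_real (Suc n) * of_real (sqrt (2 * pi)) * ?g (Suc n * x)" for x :: real
    proof -
      have "fourier ?g (Suc n * x) =
          \<bar>?s n\<bar> *\<^sub>R (LINT l|lborel. exp (- \<i> * of_real ((Suc n * x) * (0 + ?s n * l))) * ?g (0 + ?s n * l))"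
        unfolding fourier_def by (rule lborel_integral_real_affine) auto
      also have "\<dots> = ?s n *\<^sub>R fourier (\<lambda>l. ?g (?s n * l)) x"
      proof -
        have "(Suc n * x) * (0 + ?s n * l) = x * l" for l by (simp add: field_simps del: of_nat_Suc)
        then show ?thesis unfolding fourier_def by (simp only: add_0_left abs_inverse abs_of_nat)
      qed
      finally show ?thesis
        using fourier_gaussian[of "Suc n * x"]
        by (simp add: scaleR_conv_of_real field_simps del: of_nat_Suc)
    qed
    have "(LINT l|lborel. fourier f l * ?g (?s n * l)) =
        (LINT x|lborel. f x * (of_real (Suc n) * of_real (sqrt (2 * pi)) * ?g (Suc n * x)))"
      using fourier_multiplication_formula[OF f gs] by (simp only: fg)
    also have "\<dots> = \<bar>?s n\<bar> *\<^sub>R (LINT y|lborel. f (0 + ?s n * y) *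
        (of_real (Suc n) * of_real (sqrt (2 * pi)) * ?g (Suc n * (0 + ?s n * y))))"
      by (rule lborel_integral_real_affine) auto
    also have "\<dots> = \<bar>?s n\<bar> *\<^sub>R (LINT y|lborel.
        (of_real (Suc n) * of_real (sqrt (2 * pi))) * (f (?s n * y) * ?g y))"
      by (intro arg_cong[where f="scaleR _"] Bochner_Integration.integral_cong)
         (auto simp: field_simps simp del: of_nat_Suc)
    also have "\<dots> = of_real (sqrt (2 * pi)) * (LINT y|lborel. f (?s n * y) * ?g y)"
      unfolding integral_mult_right_zero by (simp add: scaleR_conv_of_real field_simps del: of_nat_Suc)
    finally show ?thesis .
  qed
  have lim1: "(\<lambda>n. LINT l|lborel. fourier f l * ?g (?s n * l)) \<longlonglongrightarrow> (LINT l|lborel. fourier f l)"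
  proof (rule integral_dominated_convergence[where w="\<lambda>l. norm (fourier f l)"])
    show "AE l in lborel. (\<lambda>n. fourier f l * ?g (?s n * l)) \<longlonglongrightarrow> fourier f l"
    proof (rule AE_I2)
      fix l
      have "(\<lambda>n. fourier f l * ?g (?s n * l)) \<longlonglongrightarrow> fourier f l * ?g (0 * l)"
        by (intro tendsto_intros s) auto
      then show "(\<lambda>n. fourier f l * ?g (?s n * l)) \<longlonglongrightarrow> fourier f l" by simp
    qed
    show "AE l in lborel. norm (fourier f l * ?g (?s n * l)) \<le> norm (fourier f l)" for n
      by (auto simp: norm_mult intro!: mult_left_le)
  qed (use Ff in auto)
  have lim2: "(\<lambda>n. LINT y|lborel. f (?s n * y) * ?g y) \<longlonglongrightarrow> (LINT y|lborel. f 0 * ?g y)"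
  proof (rule integral_dominated_convergence[where w="\<lambda>y. B * norm (?g y)"])
    show "AE y in lborel. (\<lambda>n. f (?s n * y) * ?g y) \<longlonglongrightarrow> f 0 * ?g y"
    proof (rule AE_I2)
      fix y
      have "(\<lambda>n. ?s n * y) \<longlonglongrightarrow> 0 * y" by (intro tendsto_intros s)
      then have "(\<lambda>n. f (?s n * y)) \<longlonglongrightarrow> f 0"
        using isCont_tendsto_compose[OF cont] by simp
      then show "(\<lambda>n. f (?s n * y) * ?g y) \<longlonglongrightarrow> f 0 * ?g y" by (intro tendsto_intros)
    qed
    show "integrable lborel (\<lambda>y. B * norm (?g y))"
      by (intro integrable_mult_right integrable_norm integrable_gaussian)
    show "AE y in lborel. norm (f (?s n * y) * ?g y) \<le> B * norm (?g y)" for n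
      unfolding norm_mult by (intro AE_I2 mult_right_mono bound) auto
  qed auto
  have "(LINT y|lborel. ?g y) = of_real (sqrt (2 * pi))"
    using fourier_gaussian[of 0] by (simp add: fourier_def)
  then have "(LINT l|lborel. fourier f l) = of_real (sqrt (2 * pi)) * (f 0 * of_real (sqrt (2 * pi)))"
    using LIMSEQ_unique[OF lim1[unfolded eq] tendsto_mult_left[OF lim2]] by simp
  also have "\<dots> = of_real (sqrt (2 * pi) * sqrt (2 * pi)) * f 0"
    unfolding of_real_mult by (simp add: mult_ac)
  finally show ?thesis by simp
qed

text \<open>
  Inversion at 0, applied to the translates of \<open>f\<close>.
\<close>

lemma schwartz_fourier_inversion:
  assumes f: "f \<in> schwartz"
  shows "fourier (\<lambda>l. 1 / (2 * pi) * fourier f (- l)) = f"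
proof
  fix x
  let ?h = "\<lambda>y. f (x + y)"
  have h: "integrable lborel ?h"
    using lborel_integrable_real_affine[OF schwartz_integrable[OF f], of 1 x] by simp
  have Fh: "fourier ?h l = exp (\<i> * of_real (l * x)) * fourier f l" for l
  proof -
    have "fourier f l = \<bar>1\<bar> *\<^sub>R (LINT y|lborel. exp (- \<i> * of_real (l * (x + 1 * y))) * f (x + 1 * y))"
      unfolding fourier_def by (rule lborel_integral_real_affine) auto
    also have "\<dots> = (LINT y|lborel. exp (- \<i> * of_real (l * x)) * (exp (- \<i> * of_real (l * y)) * ?h y))"
      by (simp add: algebra_simps exp_diff exp_add exp_minus divide_simps)
    also have "\<dots> = exp (- \<i> * of_real (l * x)) * fourier ?h l"
      unfolding fourier_def by simp
    finally show ?thesis by (simp add: exp_minus field_simps)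
  qed
  have "(LINT l|lborel. fourier ?h l) = 2 * pi * ?h 0"
  proof (rule fourier_inversion_at_0[OF h])
    show "integrable lborel (fourier ?h)"
      using integrable_fourier_kernel[OF schwartz_integrable[OF fourier_schwartz[OF f]], of "- x"]
      by (simp add: Fh[abs_def] mult.commute)
    show "norm (?h y) \<le> schwartz_seminorm 0 0 f" for y
      using schwartz_seminorm_upper[OF f, of "x + y" 0 0] by simp
    show "isCont ?h 0"
      by (rule isCont_o2[where g=f]) (use schwartz_continuous[OF f, where n=0] in auto)
  qed
  moreover have "(LINT l|lborel. fourier ?h l) = fourier (\<lambda>l. fourier f (- l)) x"
    unfolding fourier_def[of _ x] Fh
    by (subst lborel_integral_real_affine[of "-1" _ 0]) (auto simp: mult.commute)
  ultimately show "fourier (\<lambda>l. 1 / (2 * pi) * fourier f (- l)) x = f x"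
    using fourier_cmult[of "1 / (2 * pi)" "\<lambda>l. fourier f (- l)" x] by simp
qed

section \<open>Growth of entire power series\<close>

abbreviation powser :: "(nat \<Rightarrow> real) \<Rightarrow> real \<Rightarrow> real" where
  "powser a x \<equiv> \<Sum>n. a n * x ^ n"

lemma powser_norm_summable:
  fixes a :: "nat \<Rightarrow> real"
  assumes "\<And>x. summable (\<lambda>n. a n * x ^ n)"
  shows "summable (\<lambda>n. \<bar>a n * x ^ n\<bar>)"
  using powser_insidea[OF assms[of "\<bar>x\<bar> + 1"], of x] by simp

text \<open>
  The factor \<open>2 ^ n\<close> is absorbed by evaluating the series of \<open>a\<close> at \<open>2 * x\<close>. It leaves room for
  logarithmic factors in the coefficients.
\<close>

lemma powser_summable_compare:
  fixes a b :: "nat \<Rightarrow> real"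
  assumes a: "\<And>x. summable (\<lambda>n. a n * x ^ n)"
    and ab: "\<forall>\<^sub>F n in sequentially. \<bar>b n\<bar> \<le> K * 2 ^ n * \<bar>a n\<bar>"
  shows "summable (\<lambda>n. b n * x ^ n)"
proof (rule summable_comparison_test_ev)
  show "summable (\<lambda>n. K * \<bar>a n * (2 * x) ^ n\<bar>)"
    by (intro summable_mult powser_norm_summable a)
  show "\<forall>\<^sub>F n in sequentially. norm (b n * x ^ n) \<le> K * \<bar>a n * (2 * x) ^ n\<bar>"
    using ab
  proof eventually_elim
    case (elim n)
    have "\<bar>b n\<bar> * \<bar>x ^ n\<bar> \<le> K * 2 ^ n * \<bar>a n\<bar> * \<bar>x ^ n\<bar>"
      by (rule mult_right_mono[OF elim]) simp
    then show ?case by (simp add: abs_mult power_mult_distrib mult_ac)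
  qed
qed

lemma powser_summable_of_ratio:
  fixes a b :: "nat \<Rightarrow> real"
  assumes a: "\<And>x. summable (\<lambda>n. a n * x ^ n)" and nz: "\<forall>\<^sub>F n in sequentially. a n \<noteq> 0"
    and L: "(\<lambda>n. b n / a n / 2 ^ n) \<longlonglongrightarrow> L"
  shows "summable (\<lambda>n. b n * x ^ n)"
proof (rule powser_summable_compare[OF a])
  have "\<forall>\<^sub>F n in sequentially. \<bar>b n / a n / 2 ^ n\<bar> < \<bar>L\<bar> + 1"
    using tendsto_rabs[OF L] by (rule order_tendstoD) simp
  then show "\<forall>\<^sub>F n in sequentially. \<bar>b n\<bar> \<le> (\<bar>L\<bar> + 1) * 2 ^ n * \<bar>a n\<bar>"
    using nz
  proof eventually_elim
    case (elim n)
    then show ?case by (simp add: field_simps abs_mult)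
  qed
qed

lemma powser_shift:
  fixes b :: "nat \<Rightarrow> real"
  assumes "summable (\<lambda>n. b n * x ^ n)"
  shows "(\<lambda>n. (case n of 0 \<Rightarrow> 0 | Suc m \<Rightarrow> b m) * x ^ n) sums (x * powser b x)"
proof -
  have "(\<lambda>n. x * (b n * x ^ n)) sums (x * powser b x)"
    by (intro sums_mult summable_sums assms)
  then have "(\<lambda>n. (case Suc n of 0 \<Rightarrow> 0 | Suc m \<Rightarrow> b m) * x ^ Suc n) sums (x * powser b x)"
    by (simp add: mult_ac)
  from sums_Suc[OF this] show ?thesis by simp
qed

lemma powser_euler_operator:
  fixes b :: "nat \<Rightarrow> real"
  assumes "summable (\<lambda>n. diffs b n * x ^ n)"
  shows "(\<lambda>n. real n * b n * x ^ n) sums (x * (\<Sum>n. diffs b n * x ^ n))"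
proof -
  have "(\<lambda>n. x * (real n * b n * x ^ (n - Suc 0))) sums (x * (\<Sum>n. diffs b n * x ^ n))"
    by (intro sums_mult diffs_equiv assms)
  moreover have "x * (real n * b n * x ^ (n - Suc 0)) = real n * b n * x ^ n" for n
    by (cases n) auto
  ultimately show ?thesis by simp
qed

text \<open>
  A single positive coefficient of large index outgrows the finitely many coefficients before it,
  whatever their signs.
\<close>

lemma powser_dominates_power:
  fixes a :: "nat \<Rightarrow> real"
  assumes a: "\<And>x. summable (\<lambda>n. a n * x ^ n)" and pos: "\<forall>\<^sub>F n in sequentially. 0 < a n"
  shows "\<forall>\<^sub>F x in at_top. 0 < powser a x"
    and "((\<lambda>x. x ^ M / powser a x) \<longlongrightarrow> 0) at_top"
proof -
  have lower: "\<exists>A K. A > 0 \<and> (\<forall>x\<ge>1. A * x - K \<ge> 0 \<longrightarrow> powser a x \<ge> x ^ M * (A * x - K))" for M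
  proof -
    from pos obtain n1 where n1: "\<And>n. n \<ge> n1 \<Longrightarrow> 0 < a n"
      by (auto simp: eventually_sequentially)
    define m where "m = max n1 M"
    define K where "K = (\<Sum>n\<le>m. \<bar>a n\<bar>)"
    have "powser a x \<ge> x ^ M * (a (Suc m) * x - K)"
      if x: "x \<ge> 1" "a (Suc m) * x - K \<ge> 0" for x
    proof -
      have "(\<Sum>n\<le>m. a n * x ^ n) \<ge> (\<Sum>n\<le>m. - (\<bar>a n\<bar> * x ^ m))"
      proof (rule sum_mono)
        fix n assume "n \<in> {..m}"
        then have "\<bar>a n\<bar> * x ^ n \<le> \<bar>a n\<bar> * x ^ m"
          using x by (intro mult_left_mono power_increasing) auto
        moreover have "\<bar>a n * x ^ n\<bar> = \<bar>a n\<bar> * x ^ n"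
          using x by (simp add: abs_mult)
        ultimately show "- (\<bar>a n\<bar> * x ^ m) \<le> a n * x ^ n" by linarith
      qed
      moreover have "x ^ M * (a (Suc m) * x - K) \<le> x ^ m * (a (Suc m) * x - K)"
        using x by (intro mult_right_mono power_increasing) (auto simp: m_def)
      ultimately have "x ^ M * (a (Suc m) * x - K) \<le> (\<Sum>n\<le>Suc m. a n * x ^ n)"
        by (simp add: sum_negf sum_distrib_right[symmetric] K_def algebra_simps)
      also have "\<dots> \<le> powser a x"
      proof (rule sum_le_suminf[OF a])
        fix n assume "n \<in> - {..Suc m}"
        then show "0 \<le> a n * x ^ n" using n1[of n] x by (auto simp: m_def intro!: mult_nonneg_nonneg less_imp_le)
      qed auto
      finally show ?thesis .
    qed
    moreover have "a (Suc m) > 0" by (intro n1) (simp add: m_def)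
    ultimately show ?thesis by blast
  qed
  have ev: "\<forall>\<^sub>F x in at_top. A * x - K > 0" if "A > 0" for A K :: real
    using that by real_asymp
  obtain A K where AK: "A > 0" "\<And>x. x \<ge> 1 \<Longrightarrow> A * x - K \<ge> 0 \<Longrightarrow> powser a x \<ge> x ^ M * (A * x - K)"
    using lower[of M] by blast
  show pos': "\<forall>\<^sub>F x in at_top. 0 < powser a x"
    using ev[OF AK(1), of K] eventually_ge_at_top[of 1]
  proof eventually_elim
    case (elim x)
    then have "0 < x ^ M * (A * x - K)" by simp
    with AK(2)[of x] elim show ?case by linarith
  qed
  show "((\<lambda>x. x ^ M / powser a x) \<longlongrightarrow> 0) at_top"
  proof (rule Lim_null_comparison)
    show "\<forall>\<^sub>F x in at_top. norm (x ^ M / powser a x) \<le> 1 / (A * x - K)"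
      using ev[OF AK(1), of K] eventually_ge_at_top[of 1] pos'
    proof eventually_elim
      case (elim x)
      then show ?case using AK(2)[of x] by (simp add: field_simps)
    qed
    show "((\<lambda>x. 1 / (A * x - K)) \<longlongrightarrow> 0) at_top"
      using AK(1) by real_asymp
  qed
qed

text \<open>
  An Abelian theorem at infinity: all but finitely many terms have a ratio close to \<open>L\<close>, and the
  remaining ones are negligible because the series with coefficients \<open>a\<close> outgrows every power.
\<close>

lemma powser_ratio_tendsto_pos:
  fixes a b :: "nat \<Rightarrow> real"
  assumes a: "\<And>x. summable (\<lambda>n. a n * x ^ n)" and pos: "\<forall>\<^sub>F n in sequentially. 0 < a n"
    and L: "(\<lambda>n. b n / a n) \<longlonglongrightarrow> L"
  shows "((\<lambda>x. powser b x / powser a x) \<longlongrightarrow> L) at_top"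
proof -
  let ?A = "powser a" and ?B = "powser b"
  have nz: "\<forall>\<^sub>F n in sequentially. a n \<noteq> 0" using pos by eventually_elim simp
  have "(\<lambda>n. b n / a n * (1 / 2) ^ n) \<longlonglongrightarrow> L * 0"
    by (intro tendsto_mult L LIMSEQ_power_zero) simp
  then have b: "summable (\<lambda>n. b n * x ^ n)" for x
    by (intro powser_summable_of_ratio[OF a nz, where L=0]) (simp add: power_divide)
  show ?thesis
  proof (rule tendstoI)
    fix e :: real assume e: "e > 0"
    have "\<forall>\<^sub>F n in sequentially. \<bar>b n / a n - L\<bar> < e / 2"
      using tendstoD[OF L, of "e / 2"] e by (simp add: dist_real_def)
    with pos obtain m where m: "\<And>n. n \<ge> m \<Longrightarrow> 0 < a n" "\<And>n. n \<ge> m \<Longrightarrow> \<bar>b n / a n - L\<bar> < e / 2"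
      unfolding eventually_sequentially by (meson nle_le order_trans)
    define K where "K = (\<Sum>n<m. \<bar>b n - L * a n\<bar> + e / 2 * \<bar>a n\<bar>)"
    have K: "0 \<le> K" unfolding K_def using e by (intro sum_nonneg) auto
    have main: "\<bar>?B x - L * ?A x\<bar> \<le> K * x ^ m + e / 2 * ?A x" if x: "x \<ge> 1" for x
    proof -
      define k where "k n = (if n < m then \<bar>b n - L * a n\<bar> + e / 2 * \<bar>a n\<bar> else 0)" for n
      have k_sum: "summable (\<lambda>n. k n * x ^ m)" "(\<Sum>n. k n * x ^ m) = K * x ^ m"
      proof -
        have "(\<lambda>n. k n * x ^ m) sums (\<Sum>n<m. k n * x ^ m)"
          by (rule sums_finite) (auto simp: k_def)
        moreover have "(\<Sum>n<m. k n * x ^ m) = K * x ^ m"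
          unfolding K_def sum_distrib_right by (rule sum.cong) (auto simp: k_def)
        ultimately show "summable (\<lambda>n. k n * x ^ m)" "(\<Sum>n. k n * x ^ m) = K * x ^ m"
          by (auto simp: sums_iff)
      qed
      have abs_eq: "\<bar>b n * x ^ n - L * (a n * x ^ n)\<bar> = \<bar>b n - L * a n\<bar> * x ^ n" for n
      proof -
        have "b n * x ^ n - L * (a n * x ^ n) = (b n - L * a n) * x ^ n" by (simp add: algebra_simps)
        then show ?thesis using x by (simp add: abs_mult)
      qed
      have le: "\<bar>b n * x ^ n - L * (a n * x ^ n)\<bar> \<le> k n * x ^ m + e / 2 * (a n * x ^ n)" for n
      proof (cases "n < m")
        case True
        have "\<bar>b n * x ^ n - L * (a n * x ^ n)\<bar> = \<bar>b n - L * a n\<bar> * x ^ n"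
          by (rule abs_eq)
        also have "\<dots> \<le> (\<bar>b n - L * a n\<bar> + e / 2 * \<bar>a n\<bar>) * x ^ n + e / 2 * (a n * x ^ n)"
        proof -
          have "0 \<le> e / 2 * ((\<bar>a n\<bar> + a n) * x ^ n)" using e x by auto
          then show ?thesis by (simp add: algebra_simps)
        qed
        also have "\<dots> \<le> k n * x ^ m + e / 2 * (a n * x ^ n)"
          using True x e by (auto simp: k_def intro!: mult_left_mono power_increasing)
        finally show ?thesis .
      next
        case False
        then have "\<bar>b n - L * a n\<bar> \<le> e / 2 * a n"
          using m[of n] by (simp add: abs_if field_simps split: if_splits)
        then have "\<bar>b n - L * a n\<bar> * x ^ n \<le> e / 2 * a n * x ^ n"
          using x by (intro mult_right_mono) auto
        moreover have "\<bar>b n * x ^ n - L * (a n * x ^ n)\<bar> = \<bar>b n - L * a n\<bar> * x ^ n"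
          by (rule abs_eq)
        ultimately show ?thesis using False by (simp add: k_def)
      qed
      have s1: "summable (\<lambda>n. k n * x ^ m + e / 2 * (a n * x ^ n))"
        by (intro summable_add summable_mult k_sum a)
      have s2: "summable (\<lambda>n. \<bar>b n * x ^ n - L * (a n * x ^ n)\<bar>)"
        by (rule summable_comparison_test'[OF s1, of 0]) (use le in auto)
      have "?B x - L * ?A x = (\<Sum>n. b n * x ^ n - L * (a n * x ^ n))"
        using a b by (simp add: suminf_diff[symmetric] suminf_mult summable_mult)
      also have "\<bar>\<dots>\<bar> \<le> (\<Sum>n. k n * x ^ m + e / 2 * (a n * x ^ n))"
        by (rule order.trans[OF summable_rabs[OF s2] suminf_le[OF le s2 s1]])
      also have "\<dots> = K * x ^ m + e / 2 * ?A x"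
        using k_sum suminf_add[OF k_sum(1) summable_mult[OF a], of "e / 2" x] suminf_mult[OF a, of "e / 2" x]
        by simp
      finally show ?thesis .
    qed
    have "((\<lambda>x. K * (x ^ m / ?A x)) \<longlongrightarrow> K * 0) at_top"
      by (intro tendsto_intros powser_dominates_power[OF a pos])
    then have "\<forall>\<^sub>F x in at_top. K * (x ^ m / ?A x) < e / 2"
      by (rule order_tendstoD) (use e in simp)
    with eventually_ge_at_top[of 1] powser_dominates_power(1)[OF a pos]
    show "\<forall>\<^sub>F x in at_top. dist (?B x / ?A x) L < e"
    proof eventually_elim
      case (elim x)
      have "dist (?B x / ?A x) L = \<bar>?B x - L * ?A x\<bar> / ?A x"
        using elim by (simp add: dist_real_def field_simps abs_if)
      also have "\<dots> \<le> (K * x ^ m + e / 2 * ?A x) / ?A x"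
        using elim main by (intro divide_right_mono) auto
      also have "\<dots> = K * (x ^ m / ?A x) + e / 2"
        using elim by (simp add: field_simps)
      finally show ?case using elim by linarith
    qed
  qed
qed

lemma powser_ratio_tendsto:
  fixes a b :: "nat \<Rightarrow> real"
  assumes a: "\<And>x. summable (\<lambda>n. a n * x ^ n)"
    and sign: "(\<forall>\<^sub>F n in sequentially. 0 < a n) \<or> (\<forall>\<^sub>F n in sequentially. a n < 0)"
    and L: "(\<lambda>n. b n / a n) \<longlonglongrightarrow> L"
  shows "((\<lambda>x. powser b x / powser a x) \<longlongrightarrow> L) at_top"
  using sign
proof
  assume neg: "\<forall>\<^sub>F n in sequentially. a n < 0"
  have *: "(\<lambda>n. b n / a n * (1 / 2) ^ n) \<longlonglongrightarrow> L * 0"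
    by (intro tendsto_mult L LIMSEQ_power_zero) simp
  have "\<forall>\<^sub>F n in sequentially. a n \<noteq> 0" using neg by eventually_elim simp
  then have b: "summable (\<lambda>n. b n * x ^ n)" for x
    by (rule powser_summable_of_ratio[OF a, where L=0]) (use * in \<open>simp add: power_divide\<close>)
  have "((\<lambda>x. (\<Sum>n. - b n * x ^ n) / (\<Sum>n. - a n * x ^ n)) \<longlongrightarrow> L) at_top"
    using neg L by (intro powser_ratio_tendsto_pos) (auto intro: summable_minus a)
  then show ?thesis using a b by (simp add: suminf_minus)
qed (use assms powser_ratio_tendsto_pos in blast)

lemma powser_log_weights_summable:
  fixes a :: "nat \<Rightarrow> real"
  assumes a: "\<And>x. summable (\<lambda>n. a n * x ^ n)" and nz: "\<forall>\<^sub>F n in sequentially. a n \<noteq> 0"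
  shows "summable (\<lambda>n. a n * (c - ln (real n)) * x ^ n)"
proof -
  have "summable (\<lambda>n. a n * ln (real n) * x ^ n)"
  proof (rule powser_summable_of_ratio[OF a nz])
    have "(\<lambda>n. ln (real n) / 2 ^ n) \<longlonglongrightarrow> 0" by real_asymp
    then show "(\<lambda>n. a n * ln (real n) / a n / 2 ^ n) \<longlonglongrightarrow> 0"
      by (rule Lim_transform_eventually) (use nz in eventually_elim, simp)
  qed
  from summable_diff[OF summable_mult[OF a[of x], of c] this] show ?thesis
    by (simp add: algebra_simps)
qed

text \<open>
  The weights \<open>a n * x ^ n\<close> concentrate at \<open>n\<close> close to \<open>x\<close>, so that \<open>ln (x / n)\<close> averages out to 0.
  The bounds \<open>1 - n / x \<le> ln (x / n) \<le> x / n - 1\<close> reduce this to two ratios of power series.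
\<close>

lemma powser_log_average_tendsto_0_pos:
  fixes a :: "nat \<Rightarrow> real"
  assumes a: "\<And>x. summable (\<lambda>n. a n * x ^ n)" and pos: "\<forall>\<^sub>F n in sequentially. 0 < a n"
    and a0: "a 0 = 0" and ratio: "(\<lambda>n. diffs a n / a n) \<longlonglongrightarrow> 1"
  shows "((\<lambda>x. (\<Sum>n. a n * (ln x - ln (real n)) * x ^ n) / powser a x) \<longlongrightarrow> 0) at_top"
proof -
  let ?R = "\<lambda>x. \<Sum>n. a n * (ln x - ln (real n)) * x ^ n"
  let ?A = "powser a"
  from pos obtain m where m: "\<And>n. n \<ge> m \<Longrightarrow> 0 < a n"
    by (auto simp: eventually_sequentially)
  \<comment> \<open>The sequence \<open>k\<close> pays for the finitely many terms whose coefficient may be negative.\<close>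
  define k where "k n = (if n < m then \<bar>a n\<bar> * (2 * real n + 2) else 0)" for n
  define q where "q n = a n / real n" for n
  define q1 where "q1 n = (case n of 0 \<Rightarrow> 0 | Suc j \<Rightarrow> q j)" for n
  define k1 where "k1 n = (case n of 0 \<Rightarrow> 0 | Suc j \<Rightarrow> k j)" for n
  have nz: "\<forall>\<^sub>F n in sequentially. a n \<noteq> 0" using pos by eventually_elim simp
  have s_diffs: "summable (\<lambda>n. diffs a n * x ^ n)" for x by (rule termdiff_converges_all[OF a])
  have s_q: "summable (\<lambda>n. q n * x ^ n)" for x
  proof (rule powser_summable_of_ratio[OF a nz])
    have "(\<lambda>n. 1 / real n / 2 ^ n) \<longlonglongrightarrow> 0" by real_asymp
    then show "(\<lambda>n. q n / a n / 2 ^ n) \<longlonglongrightarrow> 0"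
      by (rule Lim_transform_eventually) (use nz in eventually_elim, simp add: q_def)
  qed
  have s_k: "summable (\<lambda>n. k n * x ^ n)" for x
    by (rule summable_finite[of "{..<m}"]) (auto simp: k_def)
  have shift_q: "(\<lambda>n. q1 n * x ^ n) sums (x * powser q x)" for x
    using powser_shift[OF s_q] by (simp add: q1_def)
  have shift_k: "(\<lambda>n. k1 n * x ^ n) sums (x * powser k x)" for x
    using powser_shift[OF s_k] by (simp add: k1_def)
  have ratio_diffs: "((\<lambda>x. powser (diffs a) x / ?A x) \<longlongrightarrow> 1) at_top"
    by (rule powser_ratio_tendsto_pos[OF a pos ratio])
  have ratio_k: "((\<lambda>x. x * powser k x / ?A x) \<longlongrightarrow> 0) at_top"
  proof -
    have "(\<lambda>n. k1 n / a n) \<longlonglongrightarrow> 0"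
      by (rule tendsto_eventually)
         (auto simp: eventually_sequentially k1_def k_def split: nat.split intro!: exI[of _ "Suc m"])
    from powser_ratio_tendsto_pos[OF a pos this] show ?thesis
      using shift_k by (simp add: sums_iff)
  qed
  have ratio_q: "((\<lambda>x. x * powser q x / ?A x) \<longlongrightarrow> 1) at_top"
  proof -
    have "(\<lambda>n. (real (Suc n) / real n) * inverse (diffs a n / a n)) \<longlonglongrightarrow> 1 * inverse 1"
      by (intro tendsto_intros ratio) (real_asymp | simp)+
    moreover have "(real (Suc n) / real n) * inverse (diffs a n / a n) = q1 (Suc n) / a (Suc n)" for n
      by (simp add: q1_def q_def diffs_def del: of_nat_Suc)
    ultimately have "(\<lambda>n. q1 (Suc n) / a (Suc n)) \<longlonglongrightarrow> 1" by simp
    then have "(\<lambda>n. q1 n / a n) \<longlonglongrightarrow> 1" by (rule LIMSEQ_imp_Suc)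
    from powser_ratio_tendsto_pos[OF a pos this] show ?thesis
      using shift_q by (simp add: sums_iff)
  qed
  note s_log = powser_log_weights_summable[OF a nz]
  have term_bounds:
    "a n * x ^ n - real n * a n * x ^ n / x - x * (k n * x ^ n) \<le> a n * (ln x - ln (real n)) * x ^ n"
    "a n * (ln x - ln (real n)) * x ^ n \<le> x * (q n * x ^ n) - a n * x ^ n + x * (k n * x ^ n)"
    if x: "x \<ge> 1" for n x
  proof -
    consider "n = 0" | "n > 0" "n < m" | "n > 0" "n \<ge> m" by linarith
    then have "a n * (1 - real n / x) - k n * x \<le> a n * (ln x - ln (real n)) \<and>
        a n * (ln x - ln (real n)) \<le> a n * (x / real n - 1) + k n * x"
    proof cases
      case 2
      have ln_n: "0 \<le> ln (real n)" "ln (real n) \<le> real n" using 2 ln_le_minus_one[of "real n"] by auto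
      have ln_x: "0 \<le> ln x" "ln x \<le> x" using x ln_le_minus_one[of x] by auto
      have nx: "real n / x \<le> real n * x" "x / real n \<le> x" "0 \<le> real n / x" "0 \<le> x / real n"
        "real n \<le> real n * x" "real n \<ge> 1"
      proof -
        show "real n \<le> real n * x" using x mult_left_mono[of 1 x "real n"] by simp
        moreover have "real n / x \<le> real n" using x mult_left_mono[of 1 x "real n"] by (simp add: field_simps)
        ultimately show "real n / x \<le> real n * x" by linarith
        show "x / real n \<le> x" using 2 x by (simp add: field_simps)
      qed (use 2 x in auto)
      have "\<bar>(1 - real n / x) - (ln x - ln (real n))\<bar> \<le> (2 * real n + 2) * x"
        "\<bar>(ln x - ln (real n)) - (x / real n - 1)\<bar> \<le> (2 * real n + 2) * x"
        using ln_n ln_x nx x unfolding abs_le_iff distrib_right mult.assoc by linarith+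
      then have "\<bar>a n * ((1 - real n / x) - (ln x - ln (real n)))\<bar> \<le> k n * x"
        "\<bar>a n * ((ln x - ln (real n)) - (x / real n - 1))\<bar> \<le> k n * x"
        using 2 by (auto simp: k_def abs_mult mult.assoc intro!: mult_left_mono)
      then show ?thesis by (auto simp: algebra_simps abs_le_iff)
    next
      case 3
      have "ln (x / n) \<le> x / n - 1" "ln (n / x) \<le> n / x - 1"
        using 3 x by (auto intro!: ln_le_minus_one)
      then have "1 - real n / x \<le> ln x - ln (real n)" "ln x - ln (real n) \<le> x / real n - 1"
        using 3 x by (auto simp: ln_div)
      then show ?thesis
        using 3 m[of n] by (auto simp: k_def intro!: mult_left_mono)
    qed (simp add: a0 k_def)
    then have "(a n * (1 - real n / x) - k n * x) * x ^ n \<le> a n * (ln x - ln (real n)) * x ^ n"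
        "a n * (ln x - ln (real n)) * x ^ n \<le> (a n * (x / real n - 1) + k n * x) * x ^ n"
      using x by (auto intro!: mult_right_mono)
    then show "a n * x ^ n - real n * a n * x ^ n / x - x * (k n * x ^ n) \<le> a n * (ln x - ln (real n)) * x ^ n"
      "a n * (ln x - ln (real n)) * x ^ n \<le> x * (q n * x ^ n) - a n * x ^ n + x * (k n * x ^ n)"
      by (auto simp: algebra_simps q_def)
  qed
  have euler: "(\<lambda>n. real n * a n * x ^ n / x) sums powser (diffs a) x" if "x \<ge> 1" for x
    using sums_divide[OF powser_euler_operator[OF s_diffs[of x]], of x] that by simp
  have lower: "?A x - powser (diffs a) x - x * powser k x
      \<le> ?R x" if x: "x \<ge> 1" for x
    by (rule sums_le[OF _ sums_diff[OF sums_diff[OF summable_sums[OF a] euler[OF x]]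
          sums_mult[OF summable_sums[OF s_k]]] summable_sums[OF s_log]]) (rule term_bounds(1)[OF x])
  have upper: "?R x
      \<le> x * powser q x - ?A x + x * powser k x" if x: "x \<ge> 1" for x
    by (rule sums_le[OF _ summable_sums[OF s_log] sums_add[OF sums_diff[OF
          sums_mult[OF summable_sums[OF s_q]] summable_sums[OF a]] sums_mult[OF summable_sums[OF s_k]]]])
       (rule term_bounds(2)[OF x])
  show ?thesis
  proof (rule tendsto_sandwich)
    show "((\<lambda>x. 1 - powser (diffs a) x / ?A x - x * powser k x / ?A x) \<longlongrightarrow> 0) at_top"
      using tendsto_diff[OF tendsto_diff[OF tendsto_const ratio_diffs] ratio_k, of 1] by simp
    show "((\<lambda>x. x * powser q x / ?A x - 1 + x * powser k x / ?A x) \<longlongrightarrow> 0) at_top"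
      using tendsto_add[OF tendsto_diff[OF ratio_q tendsto_const] ratio_k, of 1] by simp
    show "\<forall>\<^sub>F x in at_top. 1 - powser (diffs a) x / ?A x - x * powser k x / ?A x
        \<le> ?R x / ?A x"
      using powser_dominates_power(1)[OF a pos] eventually_ge_at_top[of 1]
    proof eventually_elim
      case (elim x)
      then show ?case using divide_right_mono[OF lower[of x], of "?A x"] by (simp add: diff_divide_distrib)
    qed
    show "\<forall>\<^sub>F x in at_top. ?R x / ?A x
        \<le> x * powser q x / ?A x - 1 + x * powser k x / ?A x"
      using powser_dominates_power(1)[OF a pos] eventually_ge_at_top[of 1]
    proof eventually_elim
      case (elim x)
      then show ?case using divide_right_mono[OF upper[of x], of "?A x"]
        by (simp add: diff_divide_distrib add_divide_distrib)
    qed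
  qed
qed

lemma powser_log_average_tendsto_0:
  fixes a :: "nat \<Rightarrow> real"
  assumes a: "\<And>x. summable (\<lambda>n. a n * x ^ n)"
    and sign: "(\<forall>\<^sub>F n in sequentially. 0 < a n) \<or> (\<forall>\<^sub>F n in sequentially. a n < 0)"
    and a0: "a 0 = 0" and ratio: "(\<lambda>n. diffs a n / a n) \<longlonglongrightarrow> 1"
  shows "((\<lambda>x. (\<Sum>n. a n * (ln x - ln (real n)) * x ^ n) / powser a x) \<longlongrightarrow> 0) at_top"
  using sign
proof
  assume neg: "\<forall>\<^sub>F n in sequentially. a n < 0"
  then have nz: "\<forall>\<^sub>F n in sequentially. a n \<noteq> 0" by eventually_elim simp
  have "((\<lambda>x. (\<Sum>n. - a n * (ln x - ln (real n)) * x ^ n) / (\<Sum>n. - a n * x ^ n)) \<longlongrightarrow> 0) at_top"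
    using neg a0 ratio summable_minus[OF a]
    by (intro powser_log_average_tendsto_0_pos) (auto simp: diffs_def)
  moreover have "(\<Sum>n. - a n * (ln x - ln (real n)) * x ^ n) = - (\<Sum>n. a n * (ln x - ln (real n)) * x ^ n)" for x
    using suminf_minus[OF powser_log_weights_summable[OF a nz]] by simp
  moreover have "(\<Sum>n. - a n * x ^ n) = - powser a x" for x
    using suminf_minus[OF a] by simp
  ultimately show ?thesis by simp
qed (use assms powser_log_average_tendsto_0_pos in blast)

section \<open>The Kummer equation \<open>x y'' - x y' + u y = 0\<close>\<close>

text \<open>The coefficients of \<open>x M(1 - u, 2, x)\<close>, the solution of Kummer's equation that vanishes at 0.\<close>

definition kummer_coeff :: "real \<Rightarrow> nat \<Rightarrow> real" where
  "kummer_coeff u n = (case n of 0 \<Rightarrow> 0 | Suc k \<Rightarrow> pochhammer (1 - u) k / (fact k * fact (Suc k)))"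

definition digamma_diff :: "real \<Rightarrow> nat \<Rightarrow> real" where
  "digamma_diff u n = Digamma (real n - u) - Digamma (real n) - Digamma (real n + 1)"

text \<open>
  As a quotient of Gamma values, \<open>kummer_coeff u n\<close> makes sense for real \<open>n\<close>. For \<open>n > 0\<close>, \<open>log_coeff u n\<close> is
  its derivative with respect to \<open>n\<close>, as Frobenius' method prescribes. At \<open>n = 0\<close> that derivative is
  \<open>- 1 / u\<close>, which becomes the separate constant 1 in \<open>tricomi\<close>.
\<close>

definition log_coeff :: "real \<Rightarrow> nat \<Rightarrow> real" where
  "log_coeff u n = kummer_coeff u n * digamma_diff u n"

abbreviation kummer :: "real \<Rightarrow> real \<Rightarrow> real" where
  "kummer u \<equiv> powser (kummer_coeff u)"

abbreviation kummer' :: "real \<Rightarrow> real \<Rightarrow> real" where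
  "kummer' u \<equiv> powser (diffs (kummer_coeff u))"

abbreviation kummer'' :: "real \<Rightarrow> real \<Rightarrow> real" where
  "kummer'' u \<equiv> powser (diffs (diffs (kummer_coeff u)))"

abbreviation log_part :: "real \<Rightarrow> real \<Rightarrow> real" where
  "log_part u \<equiv> powser (log_coeff u)"

abbreviation log_part' :: "real \<Rightarrow> real \<Rightarrow> real" where
  "log_part' u \<equiv> powser (diffs (log_coeff u))"

abbreviation log_part'' :: "real \<Rightarrow> real \<Rightarrow> real" where
  "log_part'' u \<equiv> powser (diffs (diffs (log_coeff u)))"

text \<open>This is \<open>\<Gamma>(1 - u) U(-u, 0, x)\<close> for the Tricomi function \<open>U\<close>.\<close>

definition tricomi :: "real \<Rightarrow> real \<Rightarrow> real" where
  "tricomi u x = 1 - u * (ln x * kummer u x + log_part u x)"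

definition tricomi' :: "real \<Rightarrow> real \<Rightarrow> real" where
  "tricomi' u x = - u * (kummer u x / x + ln x * kummer' u x + log_part' u x)"

lemma powser_unit: "(\<lambda>n. (if n = 0 then 1 else 0) * x ^ n) sums (1::real)"
  using sums_finite[of "{0::nat}" "\<lambda>n. (if n = 0 then 1 else 0) * x ^ n"] by simp

lemma powser_tendsto_at_right_0:
  assumes "\<And>x. summable (\<lambda>n. a n * x ^ n)"
  shows "(powser a \<longlongrightarrow> a 0) (at_right 0)" (is ?A)
    and "((\<lambda>x. (powser a x - a 0) / x) \<longlongrightarrow> diffs a 0) (at_right 0)" (is ?B)
proof -
  have d: "(powser a has_real_derivative powser (diffs a) 0) (at 0)"
    by (rule termdiffs_strong_converges_everywhere[OF assms])
  from DERIV_isCont[OF this] show ?A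
    by (auto simp: isCont_def powser_zero intro: tendsto_within_subset)
  from d show ?B
    by (auto simp: has_field_derivative_iff powser_zero intro: tendsto_within_subset)
qed

lemma Digamma_minus_ln_tendsto_0:
  fixes z :: real
  assumes z: "\<And>n. z \<noteq> - real n"
  shows "(\<lambda>n. Digamma (z + real n) - ln (real n)) \<longlonglongrightarrow> 0"
proof -
  have eq: "Digamma (z + real n) = Digamma z + (\<Sum>k<n. inverse (z + real k))" for n
  proof (induction n)
    case (Suc n)
    have "Digamma (z + real n + 1) = Digamma (z + real n) + 1 / (z + real n)"
      by (rule Digamma_plus1) (use z[of n] in linarith)
    then show ?case by (simp add: Suc add_ac inverse_eq_divide)
  qed simp
  have "(\<lambda>n. Digamma z - (ln (real n) - (\<Sum>k<n. inverse (z + real k)))) \<longlonglongrightarrow> Digamma z - Digamma z"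
    using Digamma_LIMSEQ[of z] z[of 0] by (intro tendsto_intros) simp_all
  then show ?thesis by (simp add: eq algebra_simps)
qed

context
  fixes u :: real
  assumes nonint: "u \<notin> \<int>"
begin

lemma neq_int: "u \<noteq> real n" "u \<noteq> - real n" "u \<noteq> 0"
  using nonint Ints_of_nat[where ?'a=real, of n] Ints_minus[OF Ints_of_nat[where ?'a=real, of n]] Ints_0 by auto

lemma kummer_coeff_0 [simp]: "kummer_coeff u 0 = 0" "log_coeff u 0 = 0"
  by (simp_all add: kummer_coeff_def log_coeff_def)

lemma kummer_coeff_1 [simp]: "kummer_coeff u (Suc 0) = 1"
  by (simp add: kummer_coeff_def)

lemma kummer_coeff_rec: "real n * real (Suc n) * kummer_coeff u (Suc n) = (real n - u) * kummer_coeff u n"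
proof (cases n)
  case (Suc k)
  then show ?thesis
    by (simp add: kummer_coeff_def pochhammer_Suc divide_simps)
qed simp

lemma kummer_coeff_nonzero: "n > 0 \<Longrightarrow> kummer_coeff u n \<noteq> 0"
proof -
  have "1 - u \<noteq> - real k" for k
    using neq_int(1)[of "Suc k"] by (simp add: algebra_simps)
  then show "n > 0 \<Longrightarrow> kummer_coeff u n \<noteq> 0"
    by (auto simp: kummer_coeff_def pochhammer_eq_0_iff split: nat.split)
qed

lemma kummer_coeff_Suc: "n > 0 \<Longrightarrow> kummer_coeff u (Suc n) = (real n - u) / (real n * real (Suc n)) * kummer_coeff u n"
  using kummer_coeff_rec[of n] by (simp add: divide_simps mult_ac)

lemma kummer_coeff_sign:
  "(\<forall>\<^sub>F n in sequentially. 0 < kummer_coeff u n) \<or> (\<forall>\<^sub>F n in sequentially. kummer_coeff u n < 0)"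
proof -
  define m where "m = Suc (nat \<lceil>u\<rceil>)"
  have m: "real n > u" "n > 0" if "n \<ge> m" for n
    using that unfolding m_def by linarith+
  have "0 < kummer_coeff u n" if "0 < kummer_coeff u m" "n \<ge> m" for n
    using that(2)
  proof (induction n rule: dec_induct)
    case (step n)
    then show ?case using m[of n] by (simp add: kummer_coeff_Suc)
  qed (use that in simp)
  moreover have "kummer_coeff u n < 0" if "kummer_coeff u m < 0" "n \<ge> m" for n
    using that(2)
  proof (induction n rule: dec_induct)
    case (step n)
    then show ?case using m[of n] by (simp add: kummer_coeff_Suc divide_neg_pos mult_pos_neg)
  qed (use that in simp)
  moreover have "kummer_coeff u m \<noteq> 0"
    by (rule kummer_coeff_nonzero) (simp add: m_def)
  ultimately show ?thesis
    unfolding eventually_sequentially by (meson linorder_neqE_linordered_idom)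
qed

lemma kummer_coeff_eventually_nonzero: "\<forall>\<^sub>F n in sequentially. kummer_coeff u n \<noteq> 0"
  using eventually_gt_at_top[of 0] by eventually_elim (rule kummer_coeff_nonzero)

lemma summable_kummer: "summable (\<lambda>n. kummer_coeff u n * x ^ n)"
proof -
  have "(\<lambda>n. (real n - u) / (real n * real (Suc n))) \<longlonglongrightarrow> 0" by real_asymp
  then have "(\<lambda>n. (real n - u) / (real n * real (Suc n)) * x) \<longlonglongrightarrow> 0 * x" by (intro tendsto_intros)
  then have "\<forall>\<^sub>F n in sequentially. dist ((real n - u) / (real n * real (Suc n)) * x) 0 < 1 / 2"
    by (intro tendstoD) auto
  then have "\<forall>\<^sub>F n in sequentially. n > 0 \<and> \<bar>(real n - u) / (real n * real (Suc n)) * x\<bar> < 1 / 2"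
    using eventually_gt_at_top[of 0] by eventually_elim (simp add: dist_real_def)
  then obtain m where m: "\<And>n. n \<ge> m \<Longrightarrow> n > 0 \<and> \<bar>(real n - u) / (real n * real (Suc n)) * x\<bar> < 1 / 2"
    unfolding eventually_sequentially by blast
  show ?thesis
  proof (rule summable_ratio_test[of "1 / 2" m])
    fix n assume n: "n \<ge> m"
    have "norm (kummer_coeff u (Suc n) * x ^ Suc n) =
        \<bar>(real n - u) / (real n * real (Suc n)) * x\<bar> * norm (kummer_coeff u n * x ^ n)"
      using m[OF n] by (subst kummer_coeff_Suc) (auto simp: abs_mult)
    also have "\<dots> \<le> 1 / 2 * norm (kummer_coeff u n * x ^ n)"
      using m[OF n] by (intro mult_right_mono) auto
    finally show "norm (kummer_coeff u (Suc n) * x ^ Suc n) \<le> 1 / 2 * norm (kummer_coeff u n * x ^ n)" .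
  qed simp
qed

lemma digamma_diff_asymptotics:
  "(\<lambda>n. digamma_diff u n + ln (real n)) \<longlonglongrightarrow> 0"
proof -
  have "(\<lambda>n. (Digamma (- u + real n) - ln (real n)) - 2 * (Digamma (1 + real n) - ln (real n)) + 1 / real n)
      \<longlonglongrightarrow> 0 - 2 * 0 + 0"
    using neq_int by (intro tendsto_intros Digamma_minus_ln_tendsto_0 lim_1_over_n) auto
  moreover have "\<forall>\<^sub>F n in sequentially. (Digamma (- u + real n) - ln (real n)) - 2 * (Digamma (1 + real n) - ln (real n))
      + 1 / real n = digamma_diff u n + ln (real n)"
    using eventually_gt_at_top[of 0]
  proof eventually_elim
    case (elim n)
    then show ?case
      using Digamma_plus1[of "real n"] by (simp add: digamma_diff_def add_ac)
  qed
  ultimately show ?thesis by (auto intro: Lim_transform_eventually)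
qed

lemma summable_log: "summable (\<lambda>n. log_coeff u n * x ^ n)"
proof (rule powser_summable_of_ratio[OF summable_kummer kummer_coeff_eventually_nonzero])
  have "(\<lambda>n. (digamma_diff u n + ln (real n)) * (1 / 2) ^ n - ln (real n) / 2 ^ n) \<longlonglongrightarrow> 0 * 0 - 0"
    by (intro tendsto_intros digamma_diff_asymptotics LIMSEQ_power_zero) (simp, real_asymp)
  then have "(\<lambda>n. digamma_diff u n / 2 ^ n) \<longlonglongrightarrow> 0"
    by (simp add: power_divide add_divide_distrib)
  then show "(\<lambda>n. log_coeff u n / kummer_coeff u n / 2 ^ n) \<longlonglongrightarrow> 0"
    by (rule Lim_transform_eventually)
       (use kummer_coeff_eventually_nonzero in eventually_elim, simp add: log_coeff_def)
qed

text \<open>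
  For \<open>n > 0\<close> this is the derivative of \<open>kummer_coeff_rec\<close> with respect to \<open>n\<close>. The extra 1 at \<open>n = 0\<close> is cancelled
  by the constant term of \<open>tricomi\<close> in the differential equation.
\<close>

lemma log_coeff_rec:
  "real n * real (Suc n) * log_coeff u (Suc n) = (real n - u) * log_coeff u n + kummer_coeff u n
     - (2 * real n + 1) * kummer_coeff u (Suc n) + (if n = 0 then 1 else 0)"
proof (cases "n = 0")
  case False
  have "real n - u \<noteq> 0" using neq_int(1)[of n] by simp
  then have "Digamma (real n - u + 1) = Digamma (real n - u) + 1 / (real n - u)"
    by (rule Digamma_plus1)
  moreover have "Digamma (real n + 1) = Digamma (real n) + 1 / real n"
    using False by (intro Digamma_plus1) auto
  moreover have "Digamma (real n + 1 + 1) = Digamma (real n + 1) + 1 / (real n + 1)"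
    by (intro Digamma_plus1) linarith
  moreover have "real n - u + 1 = real (Suc n) - u" by simp
  ultimately have d: "digamma_diff u (Suc n) = digamma_diff u n + 1 / (real n - u) - 1 / real n - 1 / (real n + 1)"
    by (simp add: digamma_diff_def algebra_simps)
  have "real n * real (Suc n) * log_coeff u (Suc n) =
      (real n - u) * kummer_coeff u n * digamma_diff u (Suc n)"
    using kummer_coeff_rec[of n] by (simp only: log_coeff_def mult.assoc[symmetric])
  also have "\<dots> = (real n - u) * log_coeff u n + kummer_coeff u n
      - (real n - u) * kummer_coeff u n * (1 / real n + 1 / (real n + 1))"
  proof -
    have "r * c * (D + 1 / r - p - q) = r * (c * D) + c - r * c * (p + q)" if "r \<noteq> 0" for r c D p q :: real
      using that by (simp add: field_simps)
    from this[OF \<open>real n - u \<noteq> 0\<close>] show ?thesis unfolding d log_coeff_def .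
  qed
  also have "(real n - u) * kummer_coeff u n * (1 / real n + 1 / (real n + 1)) =
      real n * real (Suc n) * kummer_coeff u (Suc n) * (1 / real n + 1 / (real n + 1))"
    by (simp only: kummer_coeff_rec)
  also have "\<dots> = (2 * real n + 1) * kummer_coeff u (Suc n)"
    using False by (simp add: divide_simps)
  finally show ?thesis using False by simp
qed simp

lemmas summable_kummer' = termdiff_converges_all[OF summable_kummer]
lemmas summable_kummer'' = termdiff_converges_all[OF summable_kummer']
lemmas summable_log' = termdiff_converges_all[OF summable_log]
lemmas summable_log'' = termdiff_converges_all[OF summable_log']

lemmas DERIV_kummer = termdiffs_strong_converges_everywhere[OF summable_kummer]
lemmas DERIV_kummer' = termdiffs_strong_converges_everywhere[OF summable_kummer']
lemmas DERIV_log = termdiffs_strong_converges_everywhere[OF summable_log]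
lemmas DERIV_log' = termdiffs_strong_converges_everywhere[OF summable_log']

lemma kummer_ode:
  "x * kummer'' u x = x * kummer' u x - u * kummer u x"
proof (rule sums_unique2)
  show "(\<lambda>n. real n * diffs (kummer_coeff u) n * x ^ n) sums (x * kummer'' u x)"
    by (rule powser_euler_operator[OF summable_kummer''])
  have "(\<lambda>n. real n * kummer_coeff u n * x ^ n - u * (kummer_coeff u n * x ^ n)) sums
      (x * kummer' u x - u * kummer u x)"
    by (intro sums_diff sums_mult powser_euler_operator[OF summable_kummer'] summable_sums summable_kummer)
  moreover have "real n * kummer_coeff u n * x ^ n - u * (kummer_coeff u n * x ^ n) =
      real n * diffs (kummer_coeff u) n * x ^ n" for n
    using arg_cong[OF kummer_coeff_rec[of n], of "\<lambda>t. t * x ^ n"] by (simp add: diffs_def algebra_simps)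
  ultimately show "(\<lambda>n. real n * diffs (kummer_coeff u) n * x ^ n) sums
      (x * kummer' u x - u * kummer u x)"
    by simp
qed

lemma log_ode:
  assumes "x \<noteq> 0"
  shows "x * log_part'' u x = x * log_part' u x - u * log_part u x
    + kummer u x - (2 * kummer' u x - kummer u x / x) + 1"
proof (rule sums_unique2)
  show "(\<lambda>n. real n * diffs (log_coeff u) n * x ^ n) sums (x * log_part'' u x)"
    by (rule powser_euler_operator[OF summable_log''])
  have shift: "(\<lambda>n. kummer_coeff u (Suc n) * x ^ n) sums (kummer u x / x)"
  proof -
    have "(\<lambda>n. kummer_coeff u (Suc n) * x ^ Suc n) sums (kummer u x)"
      using sums_split_initial_segment[OF summable_sums[OF summable_kummer[of x]], of 1] by simp
    from sums_divide[OF this, of x] show ?thesis using assms by simp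
  qed
  have "(\<lambda>n. real n * log_coeff u n * x ^ n - u * (log_coeff u n * x ^ n) + kummer_coeff u n * x ^ n
      - (2 * (diffs (kummer_coeff u) n * x ^ n) - kummer_coeff u (Suc n) * x ^ n) + (if n = 0 then 1 else 0) * x ^ n) sums
      (x * log_part' u x - u * log_part u x
        + kummer u x - (2 * kummer' u x - kummer u x / x) + 1)"
    by (intro sums_add sums_diff sums_mult powser_euler_operator[OF summable_log'] summable_sums
        summable_log summable_kummer summable_kummer' shift powser_unit)
  moreover have "real n * log_coeff u n * x ^ n - u * (log_coeff u n * x ^ n) + kummer_coeff u n * x ^ n
      - (2 * (diffs (kummer_coeff u) n * x ^ n) - kummer_coeff u (Suc n) * x ^ n) + (if n = 0 then 1 else 0) * x ^ n =
      real n * diffs (log_coeff u) n * x ^ n" for n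
  proof -
    have "real n * diffs (log_coeff u) n * x ^ n = real n * real (Suc n) * log_coeff u (Suc n) * x ^ n"
      by (simp add: diffs_def)
    then show ?thesis
      unfolding log_coeff_rec by (simp add: diffs_def algebra_simps)
  qed
  ultimately show "(\<lambda>n. real n * diffs (log_coeff u) n * x ^ n) sums
      (x * log_part' u x - u * log_part u x
        + kummer u x - (2 * kummer' u x - kummer u x / x) + 1)"
    by simp
qed

lemma DERIV_tricomi: "x > 0 \<Longrightarrow> (tricomi u has_real_derivative tricomi' u x) (at x)"
  unfolding tricomi_def[abs_def] tricomi'_def
  by (rule derivative_eq_intros DERIV_kummer DERIV_log refl | assumption)+ (simp add: field_simps)

lemma DERIV_tricomi':
  assumes x: "x > 0"
  shows "(tricomi' u has_real_derivative tricomi' u x - u * tricomi u x / x) (at x)"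
proof -
  define y where "y = - u * ((kummer' u x * x - kummer u x * 1) / (x * x)
      + (inverse x * kummer' u x + kummer'' u x * ln x)
      + log_part'' u x)"
  have "(tricomi' u has_real_derivative y) (at x)"
    unfolding tricomi'_def[abs_def] y_def
    by (intro DERIV_cmult DERIV_add DERIV_divide DERIV_mult DERIV_ident DERIV_ln DERIV_kummer DERIV_kummer' DERIV_log')
       (use x in auto)
  moreover have "x * y = x * (tricomi' u x - u * tricomi u x / x)"
  proof -
    have "x * y = - u * (2 * kummer' u x - kummer u x / x
        + ln x * (x * kummer'' u x) + x * log_part'' u x)"
      using x by (simp add: y_def field_simps)
    also have "\<dots> = x * tricomi' u x - u * tricomi u x"
      unfolding kummer_ode log_ode[OF less_imp_neq[OF x, symmetric]] tricomi_def tricomi'_def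
      using x by (simp add: field_simps)
    finally show ?thesis using x by (simp add: right_diff_distrib)
  qed
  ultimately show ?thesis using x by simp
qed

lemma kummer_at_0:
  "((\<lambda>x. kummer u x / x) \<longlongrightarrow> 1) (at_right 0)"
  "(kummer u \<longlongrightarrow> 0) (at_right 0)"
  "(kummer' u \<longlongrightarrow> 1) (at_right 0)"
  "((\<lambda>x. ln x * kummer u x) \<longlongrightarrow> 0) (at_right 0)"
  "((\<lambda>x. ln x * (kummer' u x - 1)) \<longlongrightarrow> 0) (at_right 0)"
  "((\<lambda>x. log_part' u x) \<longlongrightarrow> digamma_diff u 1) (at_right 0)"
  "(log_part u \<longlongrightarrow> 0) (at_right 0)"
proof -
  have xln: "((\<lambda>x::real. x * ln x) \<longlongrightarrow> 0) (at_right 0)" by real_asymp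
  have pos: "\<forall>\<^sub>F x::real in at_right 0. x > 0" by (simp add: eventually_at_right_less)
  show 1: "((\<lambda>x. kummer u x / x) \<longlongrightarrow> 1) (at_right 0)"
    using powser_tendsto_at_right_0(2)[OF summable_kummer] by (simp add: diffs_def)
  show "(kummer u \<longlongrightarrow> 0) (at_right 0)"
    using powser_tendsto_at_right_0(1)[OF summable_kummer] by simp
  show "(kummer' u \<longlongrightarrow> 1) (at_right 0)"
    using powser_tendsto_at_right_0(1)[OF summable_kummer'] by (simp add: diffs_def)
  show "((\<lambda>x. ln x * kummer u x) \<longlongrightarrow> 0) (at_right 0)"
    by (rule Lim_transform_eventually[OF tendsto_mult[OF xln 1, simplified]])
       (use pos in eventually_elim, simp)
  show "((\<lambda>x. ln x * (kummer' u x - 1)) \<longlongrightarrow> 0) (at_right 0)"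
  proof (rule Lim_transform_eventually)
    show "((\<lambda>x. x * ln x * ((kummer' u x - diffs (kummer_coeff u) 0) / x)) \<longlongrightarrow> 0) (at_right 0)"
      using tendsto_mult[OF xln powser_tendsto_at_right_0(2)[OF summable_kummer']] by simp
    show "\<forall>\<^sub>F x in at_right 0. x * ln x * ((kummer' u x - diffs (kummer_coeff u) 0) / x) =
        ln x * (kummer' u x - 1)"
      using pos by eventually_elim (simp add: diffs_def)
  qed
  show "((\<lambda>x. log_part' u x) \<longlongrightarrow> digamma_diff u 1) (at_right 0)"
    using powser_tendsto_at_right_0(1)[OF summable_log'] by (simp add: diffs_def log_coeff_def)
  show "(log_part u \<longlongrightarrow> 0) (at_right 0)"
    using powser_tendsto_at_right_0(1)[OF summable_log] by simp
qed

lemma tricomi_at_0: "(tricomi u \<longlongrightarrow> 1) (at_right 0)"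
  unfolding tricomi_def[abs_def] by (rule tendsto_eq_intros kummer_at_0 refl | simp)+

text \<open>
  The finite part \<open>digamma_diff u 1\<close> depends on \<open>u\<close>. Comparing it for \<open>u\<close> and \<open>- u\<close> yields the
  weight of the point mass.
\<close>

lemma tricomi'_at_0:
  "((\<lambda>x. tricomi' u x + u * ln x) \<longlongrightarrow> - u * (1 + digamma_diff u 1)) (at_right 0)"
proof -
  have "((\<lambda>x. - u * (kummer u x / x + ln x * (kummer' u x - 1)
      + log_part' u x)) \<longlongrightarrow> - u * (1 + 0 + digamma_diff u 1)) (at_right 0)"
    by (intro tendsto_intros kummer_at_0)
  moreover have "- u * (kummer u x / x + ln x * (kummer' u x - 1)
      + log_part' u x) = tricomi' u x + u * ln x" for x
    by (simp add: tricomi'_def algebra_simps)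
  ultimately show ?thesis by simp
qed

text \<open>
  The Wronskian \<open>w\<close> of two solutions satisfies \<open>w' = w\<close>, and here it tends to 1 at 0.
\<close>

lemma kummer_wronskian:
  assumes x: "x > 0"
  shows "tricomi u x * kummer' u x - tricomi' u x * kummer u x = exp x"
proof -
  let ?W = "\<lambda>x. exp (- x) * (tricomi u x * kummer' u x - tricomi' u x * kummer u x)"
  have "(?W has_real_derivative 0) (at t)" if t: "t > 0" for t
  proof -
    have k: "kummer'' u t = kummer' u t - u * kummer u t / t"
      using kummer_ode[of t] t by (simp add: field_simps)
    show ?thesis
      by (rule derivative_eq_intros DERIV_kummer DERIV_kummer' DERIV_tricomi DERIV_tricomi' t refl)+
         (unfold k, simp add: algebra_simps)
  qed
  then obtain c where c: "\<And>y. y \<in> {0<..} \<Longrightarrow> ?W y = c"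
    using has_field_derivative_zero_constant[of "{0<..}" ?W] by (auto intro: has_field_derivative_at_within)
  then have const: "\<forall>\<^sub>F y in at_right 0. ?W x = ?W y"
    using x by (auto simp: eventually_at_right_field intro: exI[of _ 1])
  have "((\<lambda>y. tricomi' u y * kummer u y) \<longlongrightarrow> 0) (at_right 0)"
  proof -
    have "((\<lambda>y. (tricomi' u y + u * ln y) * kummer u y - u * (ln y * kummer u y)) \<longlongrightarrow>
        - u * (1 + digamma_diff u 1) * 0 - u * 0) (at_right 0)"
      by (intro tendsto_intros tricomi'_at_0 kummer_at_0)
    then show ?thesis by (simp add: algebra_simps)
  qed
  then have "(?W \<longlongrightarrow> exp (- 0) * (1 * 1 - 0)) (at_right 0)"
    by (intro tendsto_intros tricomi_at_0 kummer_at_0)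
  moreover have "(?W \<longlongrightarrow> ?W x) (at_right 0)"
    by (rule Lim_transform_eventually[OF tendsto_const const])
  ultimately have "?W x = 1"
    using tendsto_unique[of "at_right (0::real)"] by fastforce
  then show ?thesis by (simp add: exp_minus field_simps)
qed

lemma kummer_diffs_ratio: "(\<lambda>n. diffs (kummer_coeff u) n / kummer_coeff u n) \<longlonglongrightarrow> 1"
proof (rule Lim_transform_eventually)
  show "(\<lambda>n. (real n - u) / real n) \<longlonglongrightarrow> 1" by real_asymp
  show "\<forall>\<^sub>F n in sequentially. (real n - u) / real n = diffs (kummer_coeff u) n / kummer_coeff u n"
    using eventually_gt_at_top[of 0]
  proof eventually_elim
    case (elim n)
    then show ?case
      using kummer_coeff_nonzero[OF elim] kummer_coeff_rec[of n] by (simp add: diffs_def divide_simps mult_ac)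
  qed
qed

text \<open>
  This is where the digamma values are needed: adding a multiple of \<open>kummer u\<close> to \<open>tricomi u\<close> changes
  the limit. Since \<open>digamma_diff u n\<close> is \<open>- ln n\<close> up to terms that tend to 0, the quotient is
  \<open>- u\<close> times the average of \<open>ln (x / n)\<close> with weights \<open>kummer_coeff u n * x ^ n\<close>, up to terms that
  tend to 0.
\<close>

lemma tricomi_over_kummer_tendsto_0:
  "((\<lambda>x. tricomi u x / kummer u x) \<longlongrightarrow> 0) at_top"
proof -
  let ?c = "kummer_coeff u"
  note ratio = powser_ratio_tendsto[OF summable_kummer kummer_coeff_sign]
  have log_avg: "((\<lambda>x. powser (\<lambda>n. ?c n * (ln x - ln (real n))) x / powser ?c x) \<longlongrightarrow> 0) at_top"
    by (rule powser_log_average_tendsto_0[OF summable_kummer kummer_coeff_sign kummer_coeff_0(1) kummer_diffs_ratio])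
  have one: "((\<lambda>x. 1 / powser ?c x) \<longlongrightarrow> 0) at_top"
  proof -
    have "(\<lambda>n. (if n = 0 then 1 else 0) / ?c n) \<longlonglongrightarrow> 0"
      by (rule tendsto_eventually) (auto simp: eventually_sequentially intro!: exI[of _ 1])
    from ratio[OF this] show ?thesis
      by (simp only: sums_unique[OF powser_unit, symmetric])
  qed
  let ?r = "\<lambda>n. ?c n * (digamma_diff u n + ln (real n))"
  have r_ratio: "(\<lambda>n. ?r n / ?c n) \<longlonglongrightarrow> 0"
    by (rule Lim_transform_eventually[OF digamma_diff_asymptotics])
       (use kummer_coeff_eventually_nonzero in eventually_elim, simp)
  have "((\<lambda>x. 1 / powser ?c x - u * (powser (\<lambda>n. ?c n * (ln x - ln (real n))) x / powser ?c x
      + powser ?r x / powser ?c x)) \<longlongrightarrow> 0 - u * (0 + 0)) at_top"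
    by (intro tendsto_intros one log_avg ratio[OF r_ratio])
  moreover have "1 / powser ?c x - u * (powser (\<lambda>n. ?c n * (ln x - ln (real n))) x / powser ?c x
      + powser ?r x / powser ?c x) = tricomi u x / powser ?c x" for x
  proof -
    have r_sum: "summable (\<lambda>n. ?r n * x ^ n)"
      using summable_diff[OF summable_log[of x] powser_log_weights_summable[OF summable_kummer kummer_coeff_eventually_nonzero, of 0 x]]
      by (simp add: log_coeff_def algebra_simps)
    have "powser (\<lambda>n. ?c n * (ln x - ln (real n))) x + powser ?r x =
        (\<Sum>n. ln x * (?c n * x ^ n) + log_coeff u n * x ^ n)"
      using suminf_add[OF powser_log_weights_summable[OF summable_kummer kummer_coeff_eventually_nonzero, of "ln x" x] r_sum]
      by (simp add: log_coeff_def algebra_simps)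
    also have "\<dots> = ln x * powser ?c x + log_part u x"
      using suminf_add[OF summable_mult[OF summable_kummer[of x], of "ln x"] summable_log[of x]]
        suminf_mult[OF summable_kummer[of x], of "ln x"] by simp
    finally show ?thesis
      by (simp add: tricomi_def diff_divide_distrib add_divide_distrib[symmetric])
  qed
  ultimately show ?thesis by simp
qed

lemma kummer_log_derivative_tendsto_1:
  "((\<lambda>x. kummer' u x / kummer u x) \<longlongrightarrow> 1) at_top"
  by (rule powser_ratio_tendsto[OF summable_kummer kummer_coeff_sign kummer_diffs_ratio])

text \<open>
  The Wronskian gives \<open>(tricomi / kummer)' = - exp x / kummer\<^sup>2\<close>. Since \<open>kummer' / kummer\<close> tends to 1,
  \<open>kummer\<^sup>2\<close> eventually lies between multiples of \<open>exp (11 x / 6)\<close> and \<open>exp (13 x / 6)\<close>, and integrating from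
  infinity, where the quotient vanishes, bounds it by a multiple of \<open>exp (- 5 x / 6)\<close>.
\<close>

lemma tricomi_growth:
  "\<exists>X\<ge>1. \<exists>C. \<forall>x\<ge>X. \<bar>tricomi u x\<bar> \<le> C * exp (x / 4) \<and> \<bar>tricomi' u x\<bar> \<le> C * exp (x / 4)"
proof -
  let ?N = "kummer u" and ?N' = "kummer' u"
  note dN = DERIV_kummer
  have "\<forall>\<^sub>F x in at_top. dist (?N' x / ?N x) 1 < 1 / 12"
    by (rule tendstoD[OF kummer_log_derivative_tendsto_1]) simp
  with eventually_ge_at_top[of 1]
  have "\<forall>\<^sub>F x in at_top. x \<ge> 1 \<and> \<bar>?N' x / ?N x - 1\<bar> < 1 / 12"
    by eventually_elim (simp add: dist_real_def)
  then obtain X where X: "\<And>x. x \<ge> X \<Longrightarrow> x \<ge> 1 \<and> \<bar>?N' x / ?N x - 1\<bar> < 1 / 12"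
    unfolding eventually_at_top_linorder by blast
  have N0: "?N x \<noteq> 0" if "x \<ge> X" for x
    using X[OF that] by auto
  have NN': "11 / 12 * (?N x)\<^sup>2 \<le> ?N x * ?N' x" "?N x * ?N' x \<le> 13 / 12 * (?N x)\<^sup>2"
    if "x \<ge> X" for x
  proof -
    have "?N x * ?N' x = ?N' x / ?N x * (?N x)\<^sup>2"
      using N0[OF that] by (simp add: power2_eq_square)
    moreover have "11 / 12 \<le> ?N' x / ?N x" "?N' x / ?N x \<le> 13 / 12"
      using X[OF that] by linarith+
    ultimately show "11 / 12 * (?N x)\<^sup>2 \<le> ?N x * ?N' x" "?N x * ?N' x \<le> 13 / 12 * (?N x)\<^sup>2"
      by (simp_all only: mult_right_mono zero_le_power2)
  qed
  have dNN: "((\<lambda>x. (?N x)\<^sup>2 * exp (- (b * x))) has_real_derivative (2 * (?N x * ?N' x) - b * (?N x)\<^sup>2) * exp (- (b * x))) (at x)" for b x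
    by (rule derivative_eq_intros dN refl)+ (simp add: algebra_simps power2_eq_square)
  define K where "K = (?N X)\<^sup>2 * exp (- (11 / 6 * X))"
  define K' where "K' = (?N X)\<^sup>2 * exp (- (13 / 6 * X))"
  have K: "K > 0" "K' > 0" unfolding K_def K'_def using N0[of X] by auto
  have lower: "K * exp (11 / 6 * x) \<le> (?N x)\<^sup>2" if x: "x \<ge> X" for x
  proof -
    have "K \<le> (?N x)\<^sup>2 * exp (- (11 / 6 * x))"
      unfolding K_def
    proof (rule DERIV_nonneg_imp_nondecreasing[OF x])
      fix y assume "X \<le> y" "y \<le> x"
      then have "0 \<le> (2 * (?N y * ?N' y) - 11 / 6 * (?N y)\<^sup>2) * exp (- (11 / 6 * y))"
        using NN'[of y] by (auto simp: mult_nonpos_nonneg)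
      with dNN show "\<exists>z. ((\<lambda>x. (?N x)\<^sup>2 * exp (- (11 / 6 * x))) has_real_derivative z) (at y) \<and> 0 \<le> z"
        by blast
    qed
    then show ?thesis by (simp add: exp_minus field_simps)
  qed
  have upper: "(?N x)\<^sup>2 \<le> K' * exp (13 / 6 * x)" if x: "x \<ge> X" for x
  proof -
    have "(?N x)\<^sup>2 * exp (- (13 / 6 * x)) \<le> K'"
      unfolding K'_def
    proof (rule DERIV_nonpos_imp_nonincreasing[OF x])
      fix y assume "X \<le> y" "y \<le> x"
      then have "(2 * (?N y * ?N' y) - 13 / 6 * (?N y)\<^sup>2) * exp (- (13 / 6 * y)) \<le> 0"
        using NN'[of y] by (auto simp: mult_nonpos_nonneg)
      with dNN show "\<exists>z. ((\<lambda>x. (?N x)\<^sup>2 * exp (- (13 / 6 * x))) has_real_derivative z) (at y) \<and> z \<le> 0"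
        by blast
    qed
    then show ?thesis by (simp add: exp_minus field_simps)
  qed
  have inv: "exp x / (?N x)\<^sup>2 \<le> 1 / K * exp (- (5 / 6 * x))" if x: "x \<ge> X" for x
  proof -
    have "K * exp x = K * exp (11 / 6 * x) * exp (- (5 / 6 * x))"
      by (simp add: exp_add[symmetric] mult.assoc)
    also have "\<dots> \<le> (?N x)\<^sup>2 * exp (- (5 / 6 * x))"
      by (intro mult_right_mono lower x) auto
    finally show ?thesis using K N0[OF x] by (simp add: field_simps)
  qed
  have dVN: "((\<lambda>x. tricomi u x / ?N x) has_real_derivative - (exp x / (?N x)\<^sup>2)) (at x)" if x: "x \<ge> X" for x
  proof -
    have "x > 0" using X[OF x] by linarith
    have "((\<lambda>x. tricomi u x / ?N x) has_real_derivative (tricomi' u x * ?N x - tricomi u x * ?N' x) / (?N x * ?N x)) (at x)"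
      by (intro DERIV_divide DERIV_tricomi dN N0 x \<open>x > 0\<close>)
    moreover have "(tricomi' u x * ?N x - tricomi u x * ?N' x) = - exp x"
      using kummer_wronskian[OF \<open>x > 0\<close>] by linarith
    ultimately show ?thesis by (simp add: power2_eq_square)
  qed
  define B where "B = 6 / (5 * K)"
  have dB: "((\<lambda>x. B * exp (- (5 / 6 * x))) has_real_derivative - (1 / K * exp (- (5 / 6 * x)))) (at x)" for x
    unfolding B_def by (rule derivative_eq_intros refl)+ (use K in simp)
  have limB: "((\<lambda>x. B * exp (- (5 / 6 * x))) \<longlongrightarrow> 0) at_top"
  proof -
    have "((\<lambda>x::real. exp (- (5 / 6 * x))) \<longlongrightarrow> 0) at_top" by real_asymp
    from tendsto_mult_right_zero[OF this] show ?thesis .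
  qed
  note lim = limB tricomi_over_kummer_tendsto_0
  have quot: "\<bar>tricomi u x / ?N x\<bar> \<le> B * exp (- (5 / 6 * x))" if x: "x \<ge> X" for x
  proof -
    have "0 \<le> B * exp (- (5 / 6 * x)) - tricomi u x / ?N x"
    proof (rule nonneg_of_decreasing_to_0[where g="\<lambda>x. B * exp (- (5 / 6 * x)) - tricomi u x / ?N x" and x=x])
      show "((\<lambda>x. B * exp (- (5 / 6 * x)) - tricomi u x / ?N x) \<longlongrightarrow> 0) at_top"
        using tendsto_diff[OF lim] by simp
      fix y assume "y \<ge> x"
      with x have y: "y \<ge> X" by simp
      show "((\<lambda>x. B * exp (- (5 / 6 * x)) - tricomi u x / ?N x) has_real_derivative
          - (1 / K * exp (- (5 / 6 * y))) - - (exp y / (?N y)\<^sup>2)) (at y)"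
        by (intro DERIV_diff dB dVN y)
      show "- (1 / K * exp (- (5 / 6 * y))) - - (exp y / (?N y)\<^sup>2) \<le> 0"
        using inv[OF y] by simp
    qed
    moreover have "0 \<le> B * exp (- (5 / 6 * x)) + tricomi u x / ?N x"
    proof (rule nonneg_of_decreasing_to_0[where g="\<lambda>x. B * exp (- (5 / 6 * x)) + tricomi u x / ?N x" and x=x])
      show "((\<lambda>x. B * exp (- (5 / 6 * x)) + tricomi u x / ?N x) \<longlongrightarrow> 0) at_top"
        using tendsto_add[OF lim] by simp
      fix y assume "y \<ge> x"
      with x have y: "y \<ge> X" by simp
      show "((\<lambda>x. B * exp (- (5 / 6 * x)) + tricomi u x / ?N x) has_real_derivative
          - (1 / K * exp (- (5 / 6 * y))) + - (exp y / (?N y)\<^sup>2)) (at y)"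
        by (intro DERIV_add dB dVN y)
      have "0 \<le> 1 / K * exp (- (5 / 6 * y))" "0 \<le> exp y / (?N y)\<^sup>2" using K by auto
      then show "- (1 / K * exp (- (5 / 6 * y))) + - (exp y / (?N y)\<^sup>2) \<le> 0"
        by linarith
    qed
    ultimately show ?thesis by (simp add: abs_le_iff)
  qed
  define A where "A = sqrt (B\<^sup>2 * K')"
  have V: "\<bar>tricomi u x\<bar> \<le> A * exp (x / 4)" if x: "x \<ge> X" for x
  proof (rule power2_le_imp_le)
    have "\<bar>tricomi u x\<bar>\<^sup>2 = \<bar>tricomi u x / ?N x\<bar>\<^sup>2 * (?N x)\<^sup>2"
      using N0[OF x] by (simp add: power_divide)
    also have "\<dots> \<le> (B * exp (- (5 / 6 * x)))\<^sup>2 * (K' * exp (13 / 6 * x))"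
      by (intro mult_mono power_mono quot upper x) auto
    also have "\<dots> = B\<^sup>2 * K' * exp (x / 2)"
      by (simp add: power_mult_distrib exp_add[symmetric] exp_of_nat_mult[symmetric] mult_ac flip: exp_double)
    also have "\<dots> = (A * exp (x / 4))\<^sup>2"
      using K by (simp add: A_def power_mult_distrib flip: exp_double)
    finally show "\<bar>tricomi u x\<bar>\<^sup>2 \<le> (A * exp (x / 4))\<^sup>2" .
  qed (simp add: A_def K(2)[THEN less_imp_le])
  have expN: "exp x / \<bar>?N x\<bar> \<le> sqrt (1 / K) * exp (x / 4)" if x: "x \<ge> X" for x
  proof (rule power2_le_imp_le)
    have "(exp x / \<bar>?N x\<bar>)\<^sup>2 = exp x * (exp x / (?N x)\<^sup>2)"
      by (simp add: power2_eq_square)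
    also have "\<dots> \<le> exp x * (1 / K * exp (- (5 / 6 * x)))"
      by (intro mult_left_mono inv x) auto
    also have "\<dots> = 1 / K * exp (x / 6)"
      by (simp add: exp_add[symmetric])
    also have "\<dots> \<le> 1 / K * exp (x / 2)"
      using K X[OF x] by (intro mult_left_mono) auto
    also have "\<dots> = (sqrt (1 / K) * exp (x / 4))\<^sup>2"
      using K by (simp add: power_mult_distrib real_sqrt_divide power_divide flip: exp_double)
    finally show "(exp x / \<bar>?N x\<bar>)\<^sup>2 \<le> (sqrt (1 / K) * exp (x / 4))\<^sup>2" .
  qed (use K in simp)
  have V': "\<bar>tricomi' u x\<bar> \<le> (2 * A + sqrt (1 / K)) * exp (x / 4)" if x: "x \<ge> X" for x
  proof -
    have "x > 0" using X[OF x] by linarith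
    have "tricomi' u x = tricomi u x * (?N' x / ?N x) - exp x / ?N x"
      using kummer_wronskian[OF \<open>x > 0\<close>] N0[OF x] by (simp add: field_simps)
    then have "\<bar>tricomi' u x\<bar> \<le> \<bar>tricomi u x\<bar> * \<bar>?N' x / ?N x\<bar> + exp x / \<bar>?N x\<bar>"
      by (metis abs_divide abs_exp_cancel abs_mult abs_triangle_ineq4)
    also have "\<dots> \<le> A * exp (x / 4) * 2 + sqrt (1 / K) * exp (x / 4)"
    proof (intro add_mono mult_mono V expN x)
      show "\<bar>?N' x / ?N x\<bar> \<le> 2" using X[OF x] by linarith
    qed (auto simp: A_def K(2)[THEN less_imp_le])
    finally show ?thesis by (simp add: algebra_simps)
  qed
  have A: "A \<ge> 0" using K by (simp add: A_def)
  have "\<bar>tricomi u x\<bar> \<le> (2 * A + sqrt (1 / K)) * exp (x / 4)" if x: "x \<ge> X" for x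
    by (rule order.trans[OF V[OF x]]) (use A K in \<open>auto intro!: mult_right_mono\<close>)
  with V' X[of X] show ?thesis by blast
qed

end

section \<open>The Whittaker equation \<open>y'' = (1 / 4 - u / x) y\<close>\<close>

text \<open>This is \<open>\<Gamma>(1 - u) W\<^bsub>u, 1/2\<^esub>(x)\<close> for the Whittaker function \<open>W\<close>.\<close>

definition whittaker :: "real \<Rightarrow> real \<Rightarrow> real" where
  "whittaker u x = exp (- x / 2) * tricomi u x"

definition whittaker' :: "real \<Rightarrow> real \<Rightarrow> real" where
  "whittaker' u x = exp (- x / 2) * (tricomi' u x - tricomi u x / 2)"

context
  fixes u :: real
  assumes nonint: "u \<notin> \<int>"
begin

lemma DERIV_whittaker: "x > 0 \<Longrightarrow> (whittaker u has_real_derivative whittaker' u x) (at x)"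
  unfolding whittaker_def[abs_def] whittaker'_def
  by (rule derivative_eq_intros DERIV_tricomi nonint numeral_neq_zero refl | assumption)+ (simp add: algebra_simps)

lemma DERIV_whittaker':
  "x > 0 \<Longrightarrow> (whittaker' u has_real_derivative whittaker u x / 4 - u * whittaker u x / x) (at x)"
  unfolding whittaker_def whittaker'_def[abs_def]
  by (rule derivative_eq_intros DERIV_tricomi DERIV_tricomi' nonint numeral_neq_zero refl | assumption)+ (simp add: field_simps)

lemma continuous_on_whittaker:
  "continuous_on {0<..} (whittaker u)" "continuous_on {0<..} (whittaker' u)"
  using DERIV_whittaker DERIV_whittaker'
  by (auto intro!: continuous_at_imp_continuous_on DERIV_isCont)

lemma whittaker_at_0: "(whittaker u \<longlongrightarrow> 1) (at_right 0)"
  unfolding whittaker_def[abs_def] by (rule tendsto_eq_intros tricomi_at_0 nonint refl | simp)+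

lemma whittaker'_at_0:
  "((\<lambda>x. whittaker' u x + u * ln x) \<longlongrightarrow> - u * (1 + digamma_diff u 1) - 1 / 2) (at_right 0)"
proof -
  have e: "((\<lambda>x::real. (exp (- x / 2) - 1) * ln x) \<longlongrightarrow> 0) (at_right 0)" by real_asymp
  have "((\<lambda>x. exp (- x / 2) * (tricomi' u x + u * ln x - tricomi u x / 2) - u * ((exp (- x / 2) - 1) * ln x)) \<longlongrightarrow>
      exp (- 0 / 2) * (- u * (1 + digamma_diff u 1) - 1 / 2) - u * 0) (at_right 0)"
    by (intro tendsto_intros tricomi_at_0 tricomi'_at_0 nonint e) auto
  then show ?thesis by (simp add: whittaker'_def algebra_simps)
qed

text \<open>
  With any exponent strictly between \<open>1 / 2\<close> and 1, this makes \<open>Phi\<close>, which is a multiple of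
  \<open>(whittaker - 1) / x\<close> for \<open>x > 0\<close>, square integrable at 0.
\<close>

lemma whittaker_minus_one_at_0:
  "((\<lambda>x. (whittaker u x - 1) / x powr (3 / 4)) \<longlongrightarrow> 0) (at_right 0)"
proof (rule Lim_transform_eventually)
  let ?r = "\<lambda>x. exp (- x / 2) * u * (ln x * x powr (1 / 4) * (kummer u x / x) + x powr (1 / 4) * (log_part u x / x))"
  have e: "((\<lambda>x::real. (exp (- x / 2) - 1) / x powr (3 / 4)) \<longlongrightarrow> 0) (at_right 0)"
    "((\<lambda>x::real. ln x * x powr (1 / 4)) \<longlongrightarrow> 0) (at_right 0)"
    "((\<lambda>x::real. x powr (1 / 4)) \<longlongrightarrow> 0) (at_right 0)" by real_asymp+
  have log: "((\<lambda>x. log_part u x / x) \<longlongrightarrow> diffs (log_coeff u) 0) (at_right 0)"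
    using powser_tendsto_at_right_0(2)[of "log_coeff u", OF summable_log[OF nonint]] kummer_coeff_0[OF nonint] by simp
  show "((\<lambda>x. (exp (- x / 2) - 1) / x powr (3 / 4) - ?r x) \<longlongrightarrow> 0) (at_right 0)"
    by (rule tendsto_eq_intros e log kummer_at_0 nonint refl | simp)+
  show "\<forall>\<^sub>F x in at_right 0. (exp (- x / 2) - 1) / x powr (3 / 4) - ?r x
      = (whittaker u x - 1) / x powr (3 / 4)"
    using eventually_at_right_less
  proof eventually_elim
    case (elim x)
    then have "x powr (1 / 4) * x powr (3 / 4) = x" by (simp add: powr_add[symmetric])
    then have "x powr (1 / 4) / x = 1 / x powr (3 / 4)" using elim by (simp add: field_simps)
    moreover have "?r x
        = exp (- x / 2) * u * (ln x * kummer u x + log_part u x) * (x powr (1 / 4) / x)"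
      using elim by (simp add: field_simps)
    ultimately have "?r x
        = exp (- x / 2) * u * (ln x * kummer u x + log_part u x) / x powr (3 / 4)"
      by simp
    moreover have "whittaker u x - 1 = (exp (- x / 2) - 1)
        - exp (- x / 2) * u * (ln x * kummer u x + log_part u x)"
      by (simp add: whittaker_def tricomi_def algebra_simps)
    ultimately show ?case by (simp only: diff_divide_distrib)
  qed
qed

lemma whittaker_decay:
  "\<exists>C. (\<forall>x>0. \<bar>whittaker u x\<bar> \<le> C * exp (- x / 4)) \<and> (\<forall>x\<ge>1. \<bar>whittaker' u x\<bar> \<le> C * exp (- x / 4))"
proof -
  obtain X C where X: "X \<ge> 1" and C: "\<And>x. x \<ge> X \<Longrightarrow> \<bar>tricomi u x\<bar> \<le> C * exp (x / 4) \<and> \<bar>tricomi' u x\<bar> \<le> C * exp (x / 4)"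
    using tricomi_growth[OF nonint] by blast
  have e: "exp (- x / 2) * (c * exp (x / 4)) = c * exp (- x / 4)" for c x :: real
    by (simp add: exp_add[symmetric])
  have C0: "C \<ge> 0"
    using C[of X] by (smt (verit, best) exp_gt_zero mult_neg_pos)
  have far: "\<bar>whittaker u x\<bar> \<le> 2 * C * exp (- x / 4)" "\<bar>whittaker' u x\<bar> \<le> 2 * C * exp (- x / 4)"
    if x: "x \<ge> X" for x
  proof -
    have "\<bar>tricomi u x\<bar> \<le> 2 * C * exp (x / 4)" "\<bar>tricomi' u x - tricomi u x / 2\<bar> \<le> 2 * C * exp (x / 4)"
      using C[OF x] by linarith+
    then have "exp (- x / 2) * \<bar>tricomi u x\<bar> \<le> exp (- x / 2) * (2 * C * exp (x / 4))"
      "exp (- x / 2) * \<bar>tricomi' u x - tricomi u x / 2\<bar> \<le> exp (- x / 2) * (2 * C * exp (x / 4))"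
      by (intro mult_left_mono; simp)+
    then show "\<bar>whittaker u x\<bar> \<le> 2 * C * exp (- x / 4)" "\<bar>whittaker' u x\<bar> \<le> 2 * C * exp (- x / 4)"
      unfolding e by (simp_all only: whittaker_def whittaker'_def abs_mult abs_exp_cancel)
  qed
  obtain D where D: "\<And>x. x \<in> {0<..X} \<Longrightarrow> \<bar>whittaker u x\<bar> \<le> D"
    using bounded_near_0[OF continuous_on_whittaker(1) whittaker_at_0] by blast
  have "compact (whittaker' u ` {1..X})"
    by (intro compact_continuous_image continuous_on_subset[OF continuous_on_whittaker(2)]) auto
  then obtain D' where D': "\<And>x. x \<in> {1..X} \<Longrightarrow> \<bar>whittaker' u x\<bar> \<le> D'"
    by (meson bounded_real compact_imp_bounded imageI)
  define M where "M = max (2 * C) (max \<bar>D\<bar> \<bar>D'\<bar> * exp (X / 4))"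
  have near: "max \<bar>D\<bar> \<bar>D'\<bar> \<le> M * exp (- x / 4)" if "x \<le> X" for x
  proof -
    have "max \<bar>D\<bar> \<bar>D'\<bar> = max \<bar>D\<bar> \<bar>D'\<bar> * exp (X / 4) * exp (- X / 4)"
      by (simp add: mult.assoc exp_add[symmetric])
    also have "\<dots> \<le> M * exp (- x / 4)"
      using that C0 by (intro mult_mono) (auto simp: M_def max_def)
    finally show ?thesis .
  qed
  have far': "2 * C * exp (- x / 4) \<le> M * exp (- x / 4)" for x
    by (intro mult_right_mono) (auto simp: M_def)
  have near': "\<bar>D\<bar> \<le> M * exp (- x / 4)" "\<bar>D'\<bar> \<le> M * exp (- x / 4)" if "x \<le> X" for x
    using near[OF that] by linarith+
  have "\<bar>whittaker u x\<bar> \<le> M * exp (- x / 4)" if "x > 0" for x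
  proof (cases "x \<ge> X")
    case False
    then have "\<bar>whittaker u x\<bar> \<le> \<bar>D\<bar>" using D[of x] that by force
    then show ?thesis using near'[of x] False by linarith
  qed (rule order.trans[OF far(1) far'])
  moreover have "\<bar>whittaker' u x\<bar> \<le> M * exp (- x / 4)" if "x \<ge> 1" for x
  proof (cases "x \<ge> X")
    case False
    then have "\<bar>whittaker' u x\<bar> \<le> \<bar>D'\<bar>" using D'[of x] that by force
    then show ?thesis using near'[of x] False by linarith
  qed (rule order.trans[OF far(2) far'])
  ultimately show ?thesis by blast
qed

end

text \<open>
  The derivative of the reflection formula, in the form
  \<open>rGamma x * rGamma (1 - x) = sin (pi * x) / pi\<close>, which has no poles.
\<close>

lemma digamma_diff_reflection:
  fixes u :: real
  assumes nonint: "u \<notin> \<int>"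
  shows "sin (pi * u) / pi * (u * (digamma_diff u 1 - digamma_diff (- u) 1) + 1) = u * cos (pi * u)"
proof -
  have refl: "rGamma x * rGamma (1 - x) = sin (pi * x) / pi" for x :: real
  proof -
    have "complex_of_real (rGamma x * rGamma (1 - x)) = of_real (sin (pi * x) / pi)"
      using rGamma_reflection_complex[of "of_real x"]
      by (simp add: rGamma_complex_of_real[symmetric] sin_of_real[symmetric])
    then show ?thesis by (simp only: of_real_eq_iff)
  qed
  have n: "u \<notin> \<int>\<^sub>\<le>\<^sub>0" "1 - u \<notin> \<int>\<^sub>\<le>\<^sub>0"
    using nonint by (auto dest!: nonpos_Ints_Int dest: Ints_diff[OF Ints_1])
  have "((\<lambda>x. rGamma x * rGamma (1 - x)) has_real_derivative
      rGamma u * rGamma (1 - u) * (Digamma (1 - u) - Digamma u)) (at u)"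
    by (rule derivative_eq_intros refl n | simp)+ (simp add: algebra_simps)
  moreover have "((\<lambda>x. rGamma x * rGamma (1 - x)) has_real_derivative cos (pi * u)) (at u)"
    unfolding refl by (rule derivative_eq_intros refl | simp)+
  ultimately have "sin (pi * u) / pi * (Digamma (1 - u) - Digamma u) = cos (pi * u)"
    using DERIV_unique refl by metis
  moreover have "Digamma (u + 1) = Digamma u + 1 / u"
    using neq_int(3)[OF nonint] by (rule Digamma_plus1)
  moreover have "u \<noteq> 0" by (rule neq_int(3)[OF nonint])
  ultimately show ?thesis
    by (simp add: digamma_diff_def add.commute) (simp add: field_simps)
qed

section \<open>The function \<open>Phi\<close>\<close>

lemma Gamma_log_deriv_eq_Digamma: "x \<notin> \<int>\<^sub>\<le>\<^sub>0 \<Longrightarrow> Gamma_log_deriv x = Digamma x"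
  using DERIV_imp_deriv[OF has_field_derivative_Gamma[of x UNIV]] by (simp add: Gamma_log_deriv_def Gamma_eq_zero_iff)

lemma sgn_mult_not_Ints: "u \<notin> \<int> \<Longrightarrow> x \<noteq> 0 \<Longrightarrow> u * sgn x \<notin> \<int>" for u x :: real
  by (auto simp: sgn_if)

text \<open>
  The series in \<open>Phi\<close> is the logarithmic part of \<open>tricomi\<close> divided by \<open>\<bar>x\<bar>\<close>, whence the shifted index.
\<close>

lemma Phi_term_eq:
  assumes u: "u \<notin> \<int>" and x: "x \<noteq> 0"
  shows "Phi_term u x k = (ln \<bar>x\<bar> * kummer_coeff (u * sgn x) (Suc k) + log_coeff (u * sgn x) (Suc k)) * \<bar>x\<bar> ^ k"
proof -
  let ?v = "u * sgn x"
  have v: "?v \<notin> \<int>" by (rule sgn_mult_not_Ints[OF u x])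
  have "1 + real k - ?v \<notin> \<int>\<^sub>\<le>\<^sub>0"
  proof
    assume "1 + real k - ?v \<in> \<int>\<^sub>\<le>\<^sub>0"
    then have "(1 + real k) - (1 + real k - ?v) \<in> \<int>"
      by (intro Ints_diff) (auto intro: nonpos_Ints_Int Ints_add)
    with v show False by simp
  qed
  then have D0: "Gamma_log_deriv (1 + real k - ?v) = Digamma (1 + real k - ?v)"
    by (rule Gamma_log_deriv_eq_Digamma)
  have "a + real k \<notin> \<int>\<^sub>\<le>\<^sub>0" if "a > 0" for a
    using that nonpos_Ints_nonpos[of "a + real k"] by force
  then have "Gamma_log_deriv (a + real k) = Digamma (a + real k)" if "a > 0" for a
    using that by (intro Gamma_log_deriv_eq_Digamma)
  then have D1: "Gamma_log_deriv (1 + real k) = Digamma (1 + real k)" "Gamma_log_deriv (2 + real k) = Digamma (2 + real k)"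
    by simp_all
  have d: "digamma_diff ?v (Suc k) = Digamma (1 + real k - ?v) - Digamma (1 + real k) - Digamma (2 + real k)"
    by (simp add: digamma_diff_def add_ac)
  have c: "kummer_coeff ?v (Suc k) = pochhammer (1 - ?v) k / (fact k * fact (k + 1))"
    by (simp add: kummer_coeff_def)
  have "p * y / q * (d + l) = (l * (p / q) + p / q * d) * y" for p q d l y :: real
    by (simp add: algebra_simps add_divide_distrib)
  then show ?thesis
    unfolding Phi_term_def D0 D1 log_coeff_def d c .
qed

lemma Phi_term_sums:
  assumes u: "u \<notin> \<int>" and x: "x \<noteq> 0"
  shows "Phi_term u x sums ((ln \<bar>x\<bar> * kummer (u * sgn x) \<bar>x\<bar> + log_part (u * sgn x) \<bar>x\<bar>) / \<bar>x\<bar>)"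
proof -
  let ?v = "u * sgn x"
  have v: "?v \<notin> \<int>" by (rule sgn_mult_not_Ints[OF u x])
  let ?f = "\<lambda>k. ln \<bar>x\<bar> * (kummer_coeff ?v k * \<bar>x\<bar> ^ k) + log_coeff ?v k * \<bar>x\<bar> ^ k"
  have "?f sums (ln \<bar>x\<bar> * kummer ?v \<bar>x\<bar> + log_part ?v \<bar>x\<bar>)"
    by (intro sums_add sums_mult summable_sums summable_kummer summable_log v)
  from sums_split_initial_segment[OF this, of 1]
  have "(\<lambda>k. ?f (Suc k)) sums (ln \<bar>x\<bar> * kummer ?v \<bar>x\<bar> + log_part ?v \<bar>x\<bar>)"
    by (simp add: kummer_coeff_0[OF v])
  from sums_divide[OF this, of "\<bar>x\<bar>"]
  have "(\<lambda>k. ?f (Suc k) / \<bar>x\<bar>) sums ((ln \<bar>x\<bar> * kummer ?v \<bar>x\<bar> + log_part ?v \<bar>x\<bar>) / \<bar>x\<bar>)" .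
  moreover have "(\<lambda>k. ?f (Suc k) / \<bar>x\<bar>) = Phi_term u x"
    by (rule ext) (use x in \<open>simp add: Phi_term_eq[OF u x] field_simps\<close>)
  ultimately show ?thesis by simp
qed

text \<open>
  The decaying Whittaker functions of index \<open>u\<close> on the right and \<open>- u\<close> on the left, glued at 0. Times
  \<open>sin (pi * u) / pi\<close> this is the product of \<open>x\<close> and the distribution \<open>mu_conv_power u\<close>.
\<close>

definition whittaker_line :: "real \<Rightarrow> real \<Rightarrow> real" where
  "whittaker_line u x = (if x = 0 then 1 else whittaker (u * sgn x) \<bar>x\<bar>)"

lemma Phi_eq:
  assumes u: "u \<notin> \<int>" and x: "x \<noteq> 0"
  shows "Phi u x = sin (pi * u) / pi * (whittaker_line u x / x) - sin (pi * u) / pi * (1 / x)"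
proof -
  have s: "u / \<bar>x\<bar> = u * sgn x / x"
    using x by (auto simp: sgn_if field_simps)
  let ?L = "ln \<bar>x\<bar> * kummer (u * sgn x) \<bar>x\<bar> + log_part (u * sgn x) \<bar>x\<bar>"
  have S: "- (u * sin (pi * u) / pi) * (?L / \<bar>x\<bar>) = - (sin (pi * u) / pi * (u / \<bar>x\<bar> * ?L))"
    by simp
  have alg: "e * (- (a * (v / y * l)) + a * (1 / y)) - a * (1 / y) = a * (e * (1 - v * l) / y) - a * (1 / y)"
    for e a v l y :: real
    by (simp add: right_diff_distrib distrib_left diff_divide_distrib mult_ac)
  have "Phi u x = exp (- \<bar>x\<bar> / 2) * (- (sin (pi * u) / pi * (u / \<bar>x\<bar> * ?L)) + sin (pi * u) / pi * (1 / x)) - sin (pi * u) / pi * (1 / x)"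
    unfolding Phi_def sums_unique[OF Phi_term_sums[OF u x], symmetric] S by simp
  also have "\<dots> = sin (pi * u) / pi * (exp (- \<bar>x\<bar> / 2) * (1 - u * sgn x * ?L) / x) - sin (pi * u) / pi * (1 / x)"
    unfolding s by (rule alg)
  also have "exp (- \<bar>x\<bar> / 2) * (1 - u * sgn x * ?L) = whittaker_line u x"
    using x by (simp add: whittaker_line_def whittaker_def tricomi_def)
  finally show ?thesis .
qed

text \<open>
  The constant is \<open>16 ^ 3\<close>: with \<open>t = 1 + \<bar>x\<bar> / 16\<close>, both sides compare through \<open>t ^ 3 \<le> t ^ 4 \<le> exp (\<bar>x\<bar> / 4)\<close>.
\<close>

lemma polynomial_exp_bound: "(1 + \<bar>x\<bar>) * exp (- \<bar>x\<bar> / 4) \<le> 4096 * inverse (1 + x\<^sup>2)" for x :: real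
proof -
  let ?t = "1 + \<bar>x\<bar> / 16"
  have "(1 + \<bar>x\<bar>) * (1 + x\<^sup>2) \<le> (16 * ?t) * (16 * ?t)\<^sup>2"
  proof (intro mult_mono)
    have "1 + x\<^sup>2 \<le> (1 + \<bar>x\<bar>)\<^sup>2" by (simp add: power2_sum)
    also have "\<dots> \<le> (16 * ?t)\<^sup>2" by (intro power_mono) auto
    finally show "1 + x\<^sup>2 \<le> (16 * ?t)\<^sup>2" .
  qed auto
  also have "\<dots> \<le> 4096 * ?t ^ 4"
  proof -
    have "?t ^ 3 \<le> ?t ^ 4" by (intro power_increasing) auto
    moreover have "(16 * t) * (16 * t)\<^sup>2 = 4096 * t ^ 3" for t :: real
      by (simp add: power2_eq_square power3_eq_cube)
    ultimately show ?thesis by (metis mult_left_mono zero_le_numeral)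
  qed
  also have "\<dots> \<le> 4096 * exp (\<bar>x\<bar> / 16) ^ 4"
    by (intro mult_left_mono power_mono exp_ge_add_one_self) auto
  also have "\<dots> = 4096 * exp (\<bar>x\<bar> / 4)"
    by (simp add: exp_of_nat_mult[symmetric])
  finally have "(1 + \<bar>x\<bar>) * (1 + x\<^sup>2) \<le> 4096 * exp (\<bar>x\<bar> / 4)" .
  moreover have "1 + x\<^sup>2 > 0" by (rule add_pos_nonneg) auto
  ultimately show ?thesis by (simp add: exp_minus field_simps)
qed

text \<open>Up to a constant this dominates the square of \<open>Phi\<close>.\<close>

definition sqrt_singularity :: "real \<Rightarrow> real" where
  "sqrt_singularity x = indicator {0<..<1} \<bar>x\<bar> * \<bar>x\<bar> powr (- 1 / 2) + inverse (1 + x\<^sup>2)"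

lemma integrable_sqrt_singularity: "integrable lborel sqrt_singularity"
proof -
  let ?f = "\<lambda>x::real. indicator {0<..<1} x * x powr (- 1 / 2)"
  have f: "integrable lborel ?f"
    using integrable_inverse_sqrt by (simp add: set_integrable_def)
  have "integrable lborel (\<lambda>x. ?f x + ?f (- x) + inverse (1 + x\<^sup>2))"
    using lborel_integrable_real_affine[OF f, of "-1" 0] f
    by (intro Bochner_Integration.integrable_add integrable_inverse_one_plus_square) auto
  moreover have "?f x + ?f (- x) + inverse (1 + x\<^sup>2) = sqrt_singularity x" for x
    by (auto simp: sqrt_singularity_def indicator_def abs_if)
  ultimately show ?thesis by simp
qed

context
  fixes u :: real
  assumes u: "u \<notin> \<int>"
begin

lemma neg_not_Ints: "- u \<notin> \<int>" using u by simp

lemma whittaker_line_pos: "x > 0 \<Longrightarrow> whittaker_line u x = whittaker u x"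
  by (simp add: whittaker_line_def)

lemma whittaker_line_neg: "x > 0 \<Longrightarrow> whittaker_line u (- x) = whittaker (- u) x"
  by (simp add: whittaker_line_def)

lemma isCont_whittaker_line: "isCont (whittaker_line u) x"
proof -
  consider "x > 0" | "x < 0" | "x = 0" by linarith
  then show ?thesis
  proof cases
    case 1
    then have "isCont (whittaker u) x" using DERIV_whittaker[OF u] DERIV_isCont by blast
    moreover have "\<forall>\<^sub>F y in nhds x. whittaker_line u y = whittaker u y"
      using eventually_nhds_in_open[of "{0<..}" x] 1 by (auto elim!: eventually_mono simp: whittaker_line_pos)
    ultimately show ?thesis by (simp add: isCont_cong)
  next
    case 2
    then have "isCont (\<lambda>y. whittaker (- u) (- y)) x"
      by (intro isCont_o2[where g="whittaker (- u)" and f=uminus])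
         (auto intro!: continuous_intros DERIV_isCont[OF DERIV_whittaker] neg_not_Ints)
    moreover have "\<forall>\<^sub>F y in nhds x. whittaker_line u y = whittaker (- u) (- y)"
      using eventually_nhds_in_open[of "{..<0}" x] 2
      by (auto elim!: eventually_mono simp: whittaker_line_neg[of "- _", simplified])
    ultimately show ?thesis by (simp add: isCont_cong)
  next
    case 3
    have "(whittaker_line u \<longlongrightarrow> 1) (at_right 0)"
      by (rule Lim_transform_eventually[OF whittaker_at_0[OF u]])
         (auto simp: eventually_at_right_field whittaker_line_pos intro: exI[of _ 1])
    moreover have "((\<lambda>x. whittaker_line u (- x)) \<longlongrightarrow> 1) (at_right 0)"
      by (rule Lim_transform_eventually[OF whittaker_at_0[OF neg_not_Ints]])
         (auto simp: eventually_at_right_field whittaker_line_neg intro: exI[of _ 1])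
    then have "(whittaker_line u \<longlongrightarrow> 1) (at_left 0)"
      by (simp add: at_left_minus[of 0] filterlim_filtermap)
    ultimately have "(whittaker_line u \<longlongrightarrow> 1) (at 0)" by (rule filterlim_split_at[rotated])
    then show ?thesis using 3 by (simp add: isCont_def whittaker_line_def)
  qed
qed

lemma whittaker_line_measurable [measurable]: "whittaker_line u \<in> borel_measurable borel"
  by (intro borel_measurable_continuous_onI continuous_at_imp_continuous_on) (auto intro: isCont_whittaker_line)

lemma whittaker_line_decay: "\<exists>C\<ge>0. \<forall>x. \<bar>whittaker_line u x\<bar> \<le> C * exp (- \<bar>x\<bar> / 4)"
proof -
  obtain C1 where C1: "\<And>x. x > 0 \<Longrightarrow> \<bar>whittaker u x\<bar> \<le> C1 * exp (- x / 4)"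
    using whittaker_decay[OF u] by blast
  obtain C2 where C2: "\<And>x. x > 0 \<Longrightarrow> \<bar>whittaker (- u) x\<bar> \<le> C2 * exp (- x / 4)"
    using whittaker_decay[OF neg_not_Ints] by blast
  define C where "C = max 1 (max C1 C2)"
  have le: "C1 * exp (- x / 4) \<le> C * exp (- x / 4)" "C2 * exp (- x / 4) \<le> C * exp (- x / 4)" for x
    by (auto intro!: mult_right_mono simp: C_def)
  have "\<bar>whittaker_line u x\<bar> \<le> C * exp (- \<bar>x\<bar> / 4)" for x
  proof (cases x "0::real" rule: linorder_cases)
    case less
    then show ?thesis
      using order.trans[OF C2[of "- x"] le(2)] whittaker_line_neg[of "- x"] by simp
  next
    case greater
    then show ?thesis
      using order.trans[OF C1[of x] le(1)] whittaker_line_pos[of x] by simp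
  qed (simp add: whittaker_line_def C_def)
  moreover have "C \<ge> 0" by (simp add: C_def)
  ultimately show ?thesis by blast
qed

lemma integrable_whittaker_line_mult:
  fixes g :: "real \<Rightarrow> complex"
  assumes g [measurable]: "g \<in> borel_measurable borel" and bound: "\<And>x. norm (g x) \<le> K * (1 + \<bar>x\<bar>)"
  shows "integrable lborel (\<lambda>x. of_real (whittaker_line u x) * g x)"
proof -
  obtain C where C: "C \<ge> 0" "\<And>x. \<bar>whittaker_line u x\<bar> \<le> C * exp (- \<bar>x\<bar> / 4)"
    using whittaker_line_decay by blast
  have K: "K \<ge> 0" using order.trans[OF norm_ge_zero bound[of 0]] by simp
  show ?thesis
  proof (rule Bochner_Integration.integrable_bound)
    show "integrable lborel (\<lambda>x::real. C * K * 4096 * inverse (1 + x\<^sup>2))"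
      by (intro integrable_mult_right integrable_inverse_one_plus_square)
    show "AE x in lborel. norm (of_real (whittaker_line u x) * g x) \<le> norm (C * K * 4096 * inverse (1 + x\<^sup>2))"
    proof (rule AE_I2)
      fix x :: real
      have "norm (of_real (whittaker_line u x) * g x) \<le> (C * exp (- \<bar>x\<bar> / 4)) * (K * (1 + \<bar>x\<bar>))"
        unfolding norm_mult norm_of_real by (intro mult_mono C bound) (auto simp: C(1))
      also have "\<dots> = C * K * ((1 + \<bar>x\<bar>) * exp (- \<bar>x\<bar> / 4))" by simp
      also have "\<dots> \<le> C * K * (4096 * inverse (1 + x\<^sup>2))"
        using C(1) K by (intro mult_left_mono polynomial_exp_bound) auto
      also have "\<dots> \<le> norm (C * K * 4096 * inverse (1 + x\<^sup>2))" by simp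
      finally show "norm (of_real (whittaker_line u x) * g x) \<le> norm (C * K * 4096 * inverse (1 + x\<^sup>2))" .
    qed
  qed measurable
qed

lemma Phi_measurable [measurable]: "Phi u \<in> borel_measurable borel"
proof -
  have eq: "Phi u = (\<lambda>x. if x = 0 then Phi u 0 else sin (pi * u) / pi * (whittaker_line u x / x) - sin (pi * u) / pi * (1 / x))"
    using Phi_eq[OF u] by auto
  show ?thesis by (subst eq) measurable
qed

text \<open>
  Up to a constant, \<open>Phi\<close> is \<open>(whittaker_line u x - 1) / x\<close>: at most of order \<open>\<bar>x\<bar> powr (- 1 / 4)\<close> near 0
  and of order \<open>1 / x\<close> far from 0.
\<close>

lemma Phi_square_bound: "\<exists>C. \<forall>x. x \<noteq> 0 \<longrightarrow> \<bar>x\<bar> \<noteq> 1 \<longrightarrow> (Phi u x)\<^sup>2 \<le> C * sqrt_singularity x"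
proof -
  have near: "\<exists>C. \<forall>x\<in>{0<..1}. \<bar>(whittaker v x - 1) / x powr (3 / 4)\<bar> \<le> C" if "v \<notin> \<int>" for v
    by (rule bounded_near_0[OF _ whittaker_minus_one_at_0[OF that]])
       (intro continuous_intros continuous_on_whittaker that; simp)
  obtain C1 where C1: "\<And>x. x \<in> {0<..1} \<Longrightarrow> \<bar>(whittaker u x - 1) / x powr (3 / 4)\<bar> \<le> C1"
    using near[OF u] by blast
  obtain C2 where C2: "\<And>x. x \<in> {0<..1} \<Longrightarrow> \<bar>(whittaker (- u) x - 1) / x powr (3 / 4)\<bar> \<le> C2"
    using near[OF neg_not_Ints] by blast
  obtain C3 where C3: "C3 \<ge> 0" "\<And>x. \<bar>whittaker_line u x\<bar> \<le> C3 * exp (- \<bar>x\<bar> / 4)"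
    using whittaker_line_decay by blast
  define C where "C = max 0 (max C1 C2)"
  have small: "\<bar>whittaker_line u x - 1\<bar> \<le> C * \<bar>x\<bar> powr (3 / 4)" if "x \<noteq> 0" "\<bar>x\<bar> < 1" for x
  proof -
    have "\<bar>(whittaker_line u x - 1) / \<bar>x\<bar> powr (3 / 4)\<bar> \<le> C"
      using that C1[of x] C2[of "- x"] whittaker_line_pos[of x] whittaker_line_neg[of "- x"]
      by (cases "x > 0") (auto simp: C_def)
    then show ?thesis using that by (simp add: field_simps)
  qed
  have Phi_abs: "(Phi u x)\<^sup>2 \<le> ((whittaker_line u x - 1) / x)\<^sup>2" if "x \<noteq> 0" for x
  proof -
    have "(sin (pi * u) / pi)\<^sup>2 \<le> 1"
    proof -
      have "\<bar>sin (pi * u)\<bar> \<le> pi" using abs_sin_le_one[of "pi * u"] pi_gt3 by linarith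
      then have "\<bar>sin (pi * u) / pi\<bar> \<le> 1" by simp
      then show ?thesis by (simp only: abs_square_le_1)
    qed
    moreover have "Phi u x = sin (pi * u) / pi * ((whittaker_line u x - 1) / x)"
      unfolding Phi_eq[OF u that] by (simp add: diff_divide_distrib right_diff_distrib)
    ultimately show ?thesis
      using mult_right_mono[of "(sin (pi * u) / pi)\<^sup>2" 1 "((whittaker_line u x - 1) / x)\<^sup>2"]
      by (simp only: power_mult_distrib mult_1 zero_le_power2)
  qed
  define M where "M = max (C\<^sup>2) (2 * (C3 + 1)\<^sup>2)"
  have M: "M \<ge> 0" by (simp add: M_def le_max_iff_disj)
  have "(Phi u x)\<^sup>2 \<le> M * sqrt_singularity x" if x: "x \<noteq> 0" "\<bar>x\<bar> \<noteq> 1" for x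
  proof (cases "\<bar>x\<bar> < 1")
    case True
    have "((whittaker_line u x - 1) / x)\<^sup>2 = \<bar>whittaker_line u x - 1\<bar>\<^sup>2 / \<bar>x\<bar>\<^sup>2"
      by (simp add: power_divide)
    also have "\<dots> \<le> (C * \<bar>x\<bar> powr (3 / 4))\<^sup>2 / \<bar>x\<bar>\<^sup>2"
      by (intro divide_right_mono power_mono small x True) auto
    also have "\<dots> = C\<^sup>2 * \<bar>x\<bar> powr (- 1 / 2)"
    proof -
      have "(\<bar>x\<bar> powr (3 / 4))\<^sup>2 = \<bar>x\<bar> powr (3 / 2)"
        using x by (simp add: power2_eq_square powr_add[symmetric])
      moreover have "\<bar>x\<bar>\<^sup>2 = \<bar>x\<bar> powr 2" using x by simp
      moreover have "\<bar>x\<bar> powr (3 / 2) / \<bar>x\<bar> powr 2 = \<bar>x\<bar> powr (- 1 / 2)"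
        unfolding powr_diff[symmetric] by simp
      ultimately show ?thesis by (simp only: power_mult_distrib times_divide_eq_right[symmetric])
    qed
    also have "\<dots> \<le> M * \<bar>x\<bar> powr (- 1 / 2)" by (intro mult_right_mono) (auto simp: M_def)
    also have "\<dots> \<le> M * sqrt_singularity x"
      using M True x by (intro mult_left_mono) (auto simp: sqrt_singularity_def)
    finally show ?thesis using Phi_abs[OF x(1)] by linarith
  next
    case False
    have "\<bar>whittaker_line u x\<bar> \<le> C3"
      by (rule order.trans[OF C3(2)]) (use C3(1) in \<open>auto intro!: mult_left_le\<close>)
    then have "\<bar>whittaker_line u x - 1\<bar> \<le> C3 + 1" by linarith
    then have "((whittaker_line u x - 1) / x)\<^sup>2 \<le> (C3 + 1)\<^sup>2 / x\<^sup>2"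
      unfolding power_divide using power_mono[of "\<bar>whittaker_line u x - 1\<bar>" "C3 + 1" 2]
      by (intro divide_right_mono) auto
    also have "\<dots> \<le> 2 * (C3 + 1)\<^sup>2 * inverse (1 + x\<^sup>2)"
    proof -
      have "1 \<le> \<bar>x\<bar>" using False by simp
      then have "1 \<le> \<bar>x\<bar>\<^sup>2" using one_le_power by blast
      then have "1 / x\<^sup>2 \<le> 2 * inverse (1 + x\<^sup>2)"
        by (simp add: divide_simps) 
      from mult_left_mono[OF this, of "(C3 + 1)\<^sup>2"] show ?thesis by simp
    qed
    also have "\<dots> \<le> M * inverse (1 + x\<^sup>2)" by (intro mult_right_mono) (auto simp: M_def)
    also have "\<dots> \<le> M * sqrt_singularity x"
      using M by (intro mult_left_mono) (auto simp: sqrt_singularity_def)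
    finally show ?thesis using Phi_abs[OF x(1)] by linarith
  qed
  then show ?thesis by blast
qed

lemma integrable_Phi_square: "integrable lborel (\<lambda>x. (Phi u x)\<^sup>2)"
proof -
  obtain C where C: "\<And>x. x \<noteq> 0 \<Longrightarrow> \<bar>x\<bar> \<noteq> 1 \<Longrightarrow> (Phi u x)\<^sup>2 \<le> C * sqrt_singularity x"
    using Phi_square_bound by blast
  show ?thesis
  proof (rule Bochner_Integration.integrable_bound)
    show "integrable lborel (\<lambda>x. C * sqrt_singularity x)"
      by (intro integrable_mult_right integrable_sqrt_singularity)
    show "AE x in lborel. norm ((Phi u x)\<^sup>2) \<le> norm (C * sqrt_singularity x)"
      using AE_lborel_singleton[of 0] AE_lborel_singleton[of 1] AE_lborel_singleton[of "-1"]
    proof eventually_elim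
      case (elim x)
      then have "(Phi u x)\<^sup>2 \<le> C * sqrt_singularity x" by (intro C) auto
      then show ?case by simp
    qed
  qed measurable
qed

lemma integrable_Phi_mult_schwartz:
  assumes f: "f \<in> schwartz"
  shows "integrable lborel (\<lambda>x. of_real (Phi u x) * f x)"
proof -
  have [measurable]: "f \<in> borel_measurable borel" by (rule schwartz_measurable[OF f])
  show ?thesis
  proof (rule Bochner_Integration.integrable_bound)
    show "integrable lborel (\<lambda>x. (Phi u x)\<^sup>2 + schwartz_seminorm 0 0 f * norm (f x))"
      by (intro Bochner_Integration.integrable_add integrable_Phi_square integrable_mult_right
          integrable_norm schwartz_integrable f)
    show "AE x in lborel. norm (of_real (Phi u x) * f x) \<le> norm ((Phi u x)\<^sup>2 + schwartz_seminorm 0 0 f * norm (f x))"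
    proof (rule AE_I2)
      fix x
      have "\<bar>Phi u x\<bar> * norm (f x) \<le> \<bar>Phi u x\<bar>\<^sup>2 + (norm (f x))\<^sup>2"
      proof -
        have "0 \<le> \<bar>Phi u x\<bar> * norm (f x)" by simp
        then show ?thesis using sum_squares_bound[of "\<bar>Phi u x\<bar>" "norm (f x)"] by linarith
      qed
      also have "(norm (f x))\<^sup>2 \<le> schwartz_seminorm 0 0 f * norm (f x)"
        unfolding power2_eq_square using schwartz_seminorm_upper[OF f, of x 0 0]
        by (intro mult_right_mono) auto
      finally show "norm (of_real (Phi u x) * f x) \<le> norm ((Phi u x)\<^sup>2 + schwartz_seminorm 0 0 f * norm (f x))"
        by (simp add: norm_mult)
    qed
  qed measurable
qed

end

section \<open>Green's formula for the Whittaker equation\<close>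

text \<open>
  Test functions for which Green's formula has no contribution from infinity, as the Whittaker
  function and its derivative decay exponentially. Besides Schwartz functions they comprise
  \<open>x * exp (- \<i> l x)\<close>.
\<close>

locale linear_growth_test =
  fixes \<psi> \<psi>' \<psi>'' :: "real \<Rightarrow> complex" and K :: real
  assumes deriv: "\<And>x. (\<psi> has_vector_derivative \<psi>' x) (at x)"
    and deriv': "\<And>x. (\<psi>' has_vector_derivative \<psi>'' x) (at x)"
    and cont'': "\<And>x. isCont \<psi>'' x"
    and bound: "\<And>x. norm (\<psi> x) \<le> K * (1 + \<bar>x\<bar>)" "\<And>x. norm (\<psi>' x) \<le> K * (1 + \<bar>x\<bar>)"
      "\<And>x. norm (\<psi>'' x) \<le> K * (1 + \<bar>x\<bar>)"
begin

lemma K_nonneg: "0 \<le> K"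
  using order.trans[OF norm_ge_zero bound(1)[of 0]] by simp

lemma cont: "isCont \<psi> x" "isCont \<psi>' x"
  using deriv deriv' has_vector_derivative_continuous by blast+

lemma measurable [measurable]:
  "\<psi> \<in> borel_measurable borel" "\<psi>' \<in> borel_measurable borel" "\<psi>'' \<in> borel_measurable borel"
  using cont cont'' by (auto intro!: borel_measurable_continuous_onI continuous_at_imp_continuous_on)

lemma reflect: "linear_growth_test (\<lambda>x. \<psi> (- x)) (\<lambda>x. - \<psi>' (- x)) (\<lambda>x. \<psi>'' (- x)) K"
proof
  fix x :: real
  have u: "((\<lambda>x. - x) has_vector_derivative (- 1 :: real)) (at x)"
    by (rule has_vector_derivative_minus[OF has_vector_derivative_id])
  show "((\<lambda>x. \<psi> (- x)) has_vector_derivative - \<psi>' (- x)) (at x)"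
    using vector_diff_chain_at[OF u deriv[of "- x"]] by (simp add: o_def)
  show "((\<lambda>x. - \<psi>' (- x)) has_vector_derivative \<psi>'' (- x)) (at x)"
    using has_vector_derivative_minus[OF vector_diff_chain_at[OF u deriv'[of "- x"]]] by (simp add: o_def)
  show "isCont (\<lambda>x. \<psi>'' (- x)) x"
    using cont'' by (rule isCont_o2[where g=\<psi>'', rotated]) auto
  show "norm (\<psi> (- x)) \<le> K * (1 + \<bar>x\<bar>)" "norm (- \<psi>' (- x)) \<le> K * (1 + \<bar>x\<bar>)"
    "norm (\<psi>'' (- x)) \<le> K * (1 + \<bar>x\<bar>)"
    using bound[of "- x"] by (simp_all only: abs_minus_cancel norm_minus_cancel)
qed

lemma operator_bound: "norm (\<psi> x / 4 - \<psi>'' x) \<le> 2 * K * (1 + \<bar>x\<bar>)"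
proof -
  have "norm (\<psi> x / 4 - \<psi>'' x) \<le> norm (\<psi> x) / 4 + norm (\<psi>'' x)"
    using norm_triangle_ineq4[of "\<psi> x / 4" "\<psi>'' x"] by (simp add: norm_divide)
  also have "\<dots> \<le> 2 * (K * (1 + \<bar>x\<bar>))"
    using bound(1,3)[of x] norm_ge_zero[of "\<psi> x"] by linarith
  finally show ?thesis by (simp add: mult.assoc)
qed

lemma log_difference_tendsto_0: "((\<lambda>e. of_real (ln e) * (\<psi> e - \<psi> (- e))) \<longlongrightarrow> 0) (at_right 0)"
proof (rule Lim_null_comparison)
  have diff: "norm (\<psi> e - \<psi> (- e)) \<le> 4 * K * e" if "0 < e" "e < 1" for e
  proof -
    have "norm (\<psi> e - \<psi> (- e)) \<le> (2 * K) * norm (e - - e)"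
    proof (rule differentiable_bound[where S="{-1..1}" and f'="\<lambda>x h. h *\<^sub>R \<psi>' x"])
      show "(\<psi> has_derivative (\<lambda>h. h *\<^sub>R \<psi>' x)) (at x within {- 1..1})" for x
        using deriv[of x] by (auto simp: has_vector_derivative_def intro: has_derivative_at_withinI)
      fix x :: real assume "x \<in> {-1..1}"
      then have "K * (1 + \<bar>x\<bar>) \<le> K * 2" using K_nonneg by (intro mult_left_mono) auto
      then show "onorm (\<lambda>h. h *\<^sub>R \<psi>' x) \<le> 2 * K"
        using bound(2)[of x] by (simp add: onorm_scaleR_left[OF bounded_linear_ident] onorm_id)
    qed (use that in auto)
    then show ?thesis using that by simp
  qed
  show "\<forall>\<^sub>F e in at_right 0. norm (of_real (ln e) * (\<psi> e - \<psi> (- e))) \<le> 4 * K * (e * \<bar>ln e\<bar>)"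
    unfolding eventually_at_right_field
  proof (intro exI[of _ 1] conjI allI impI)
    fix e :: real assume "0 < e" "e < 1"
    then have "\<bar>ln e\<bar> * norm (\<psi> e - \<psi> (- e)) \<le> \<bar>ln e\<bar> * (4 * K * e)"
      by (intro mult_left_mono diff) auto
    then show "norm (of_real (ln e) * (\<psi> e - \<psi> (- e))) \<le> 4 * K * (e * \<bar>ln e\<bar>)"
      by (simp add: norm_mult mult_ac)
  qed simp
  have "((\<lambda>e::real. e * \<bar>ln e\<bar>) \<longlongrightarrow> 0) (at_right 0)" by real_asymp
  from tendsto_mult_right_zero[OF this] show "((\<lambda>e. 4 * K * (e * \<bar>ln e\<bar>)) \<longlongrightarrow> 0) (at_right 0)" .
qed

text \<open>
  By Whittaker's equation, the difference of the two integrands is the derivative of the Wronskian of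
  \<open>whittaker u\<close> and \<open>\<psi>\<close>.
\<close>

lemma whittaker_green_half_line:
  assumes u: "u \<notin> \<int>" and a: "a > 0"
  shows "set_integrable lborel {a<..} (\<lambda>x. of_real (whittaker u x) * (\<psi> x / 4 - \<psi>'' x))" (is ?I1)
    and "set_integrable lborel {a<..} (\<lambda>x. of_real (whittaker u x / x) * \<psi> x)" (is ?I2)
    and "u * (LINT x:{a<..}|lborel. of_real (whittaker u x / x) * \<psi> x) =
      (LINT x:{a<..}|lborel. of_real (whittaker u x) * (\<psi> x / 4 - \<psi>'' x))
      + of_real (whittaker' u a) * \<psi> a - of_real (whittaker u a) * \<psi>' a" (is ?E)
proof -
  note w = whittaker_line_pos[of u]
  have line: "set_integrable lborel {a<..} (\<lambda>x. of_real (whittaker u x) * g x)"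
    if "set_integrable lborel {a<..} (\<lambda>x. of_real (whittaker_line u x) * g x)" for g
    using that by (rule set_integrable_cong[THEN iffD1, rotated -1]) (use a w[OF u] in auto)
  show I1: ?I1
    by (intro line set_integrable_of_integrable integrable_whittaker_line_mult[OF u _ operator_bound]) auto
  show I2: ?I2
  proof -
    have "set_integrable lborel {a<..} (\<lambda>x. of_real (whittaker u x) * \<psi> x)"
      by (intro line set_integrable_of_integrable integrable_whittaker_line_mult[OF u _ bound(1)]) auto
    then have "set_integrable lborel {a<..} (\<lambda>x. (1 / a) *\<^sub>R (of_real (whittaker u x) * \<psi> x))"
      by (rule set_integrable_scaleR_right)
    then show ?thesis
    proof (rule set_integrable_bound)
      have "(\<lambda>x. indicator {a<..} x *\<^sub>R (of_real (whittaker u x / x) * \<psi> x)) =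
          (\<lambda>x. indicator {a<..} x *\<^sub>R (of_real (whittaker_line u x / x) * \<psi> x))"
        using a w[OF u] by (intro ext) (auto simp: indicator_def)
      moreover note [measurable] = whittaker_line_measurable[OF u]
      ultimately show "set_borel_measurable lborel {a<..} (\<lambda>x. of_real (whittaker u x / x) * \<psi> x)"
        unfolding set_borel_measurable_def by simp
      show "AE x in lborel. x \<in> {a<..} \<longrightarrow> norm (of_real (whittaker u x / x) * \<psi> x)
          \<le> norm ((1 / a) *\<^sub>R (of_real (whittaker u x) * \<psi> x))"
      proof (intro AE_I2 impI)
        fix x assume "x \<in> {a<..}"
        then have "1 / \<bar>x\<bar> \<le> 1 / \<bar>a\<bar>" using a by (simp add: frac_le)
        from mult_right_mono[OF this, of "\<bar>whittaker u x\<bar> * norm (\<psi> x)"]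
        show "norm (of_real (whittaker u x / x) * \<psi> x) \<le> norm ((1 / a) *\<^sub>R (of_real (whittaker u x) * \<psi> x))"
          by (simp add: norm_mult norm_divide)
      qed
    qed
  qed
  define F where "F x = of_real (whittaker u x) * \<psi>' x - of_real (whittaker' u x) * \<psi> x" for x
  define f where "f x = of_real u * (of_real (whittaker u x / x) * \<psi> x) - of_real (whittaker u x) * (\<psi> x / 4 - \<psi>'' x)" for x
  have F: "(F has_vector_derivative f x) (at x)" if "x \<ge> a" for x
  proof -
    have x: "x > 0" using that a by simp
    have "(F has_vector_derivative (of_real (whittaker u x) * \<psi>'' x + of_real (whittaker' u x) * \<psi>' x)
        - (of_real (whittaker' u x) * \<psi>' x + of_real (whittaker u x / 4 - u * whittaker u x / x) * \<psi> x)) (at x)"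
      unfolding F_def[abs_def]
      by (intro has_vector_derivative_diff has_vector_derivative_mult has_vector_derivative_of_real deriv deriv'
          DERIV_whittaker DERIV_whittaker' u x)
    then show ?thesis by (rule has_vector_derivative_eq_rhs) (simp add: f_def algebra_simps)
  qed
  have fi: "set_integrable lborel {a<..} f"
    unfolding f_def by (intro set_integral_diff set_integrable_mult_right I1 I2)
  have fc: "isCont f x" if "x > a" for x
  proof -
    have "x > 0" using that a by simp
    then have "isCont (whittaker u) x" using DERIV_isCont[OF DERIV_whittaker[OF u]] by blast
    with \<open>x > 0\<close> show ?thesis unfolding f_def by (intro continuous_intros cont cont'') auto
  qed
  have lim: "(F \<longlongrightarrow> 0) at_top"
  proof -
    obtain C where C: "\<And>x. x > 0 \<Longrightarrow> \<bar>whittaker u x\<bar> \<le> C * exp (- x / 4)" "\<And>x. x \<ge> 1 \<Longrightarrow> \<bar>whittaker' u x\<bar> \<le> C * exp (- x / 4)"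
      using whittaker_decay[OF u] by blast
    show ?thesis
    proof (rule Lim_null_comparison)
      show "\<forall>\<^sub>F x in at_top. norm (F x) \<le> 2 * C * K * ((1 + \<bar>x\<bar>) * exp (- x / 4))"
        using eventually_ge_at_top[of 1]
      proof eventually_elim
        case (elim x)
        have C0: "0 \<le> C * exp (- x / 4)" using C(2)[OF elim] by linarith
        have "norm (F x) \<le> \<bar>whittaker u x\<bar> * norm (\<psi>' x) + \<bar>whittaker' u x\<bar> * norm (\<psi> x)"
          unfolding F_def using norm_triangle_ineq4[of "of_real (whittaker u x) * \<psi>' x" "of_real (whittaker' u x) * \<psi> x"]
          by (simp add: norm_mult)
        also have "\<dots> \<le> (C * exp (- x / 4)) * (K * (1 + \<bar>x\<bar>)) + (C * exp (- x / 4)) * (K * (1 + \<bar>x\<bar>))"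
          using elim C0 by (intro add_mono mult_mono C bound) auto
        finally show ?case by (simp add: mult_ac)
      qed
      have "((\<lambda>x::real. (1 + \<bar>x\<bar>) * exp (- x / 4)) \<longlongrightarrow> 0) at_top" by real_asymp
      from tendsto_mult_right_zero[OF this]
      show "((\<lambda>x. 2 * C * K * ((1 + \<bar>x\<bar>) * exp (- x / 4))) \<longlongrightarrow> 0) at_top" .
    qed
  qed
  have "(LINT x:{a<..}|lborel. f x) = - F a"
    by (rule integral_derivative_half_line[where F=F, OF F fc fi lim])
  moreover have "(LINT x:{a<..}|lborel. f x) = of_real u * (LINT x:{a<..}|lborel. of_real (whittaker u x / x) * \<psi> x)
      - (LINT x:{a<..}|lborel. of_real (whittaker u x) * (\<psi> x / 4 - \<psi>'' x))"
    unfolding f_def by (subst set_integral_diff(2)[OF set_integrable_mult_right[OF I2] I1]) (simp only: set_integral_mult_right)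
  ultimately show ?E by (simp add: F_def algebra_simps)
qed

lemma whittaker_green_outside:
  assumes u: "u \<notin> \<int>" and e: "e > 0"
  shows "set_integrable lborel (outside e) (\<lambda>x. of_real (whittaker_line u x / x) * \<psi> x)"
    and "u * (LINT x:outside e|lborel. of_real (whittaker_line u x / x) * \<psi> x) =
      (LINT x:outside e|lborel. of_real (whittaker_line u x) * (\<psi> x / 4 - \<psi>'' x))
      + (of_real (whittaker' u e) * \<psi> e + of_real (whittaker' (- u) e) * \<psi> (- e)
         - of_real (whittaker u e) * \<psi>' e + of_real (whittaker (- u) e) * \<psi>' (- e))"
proof -
  interpret r: linear_growth_test "\<lambda>x. \<psi> (- x)" "\<lambda>x. - \<psi>' (- x)" "\<lambda>x. \<psi>'' (- x)" K
    by (rule reflect)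
  have nu: "- u \<notin> \<int>" using u by simp
  have split: "{x::real. e < \<bar>x\<bar>} = {e<..} \<union> {..<- e}" by auto
  note [measurable] = whittaker_line_measurable[OF u]
  have wline_int: "set_integrable lborel A (\<lambda>x. of_real (whittaker_line u x) * (\<psi> x / 4 - \<psi>'' x))" if "A \<in> sets borel" for A
    using that by (intro set_integrable_of_integrable integrable_whittaker_line_mult[OF u _ operator_bound]) auto
  have pos: "(LINT x:{e<..}|lborel. of_real (whittaker u x) * g x) = (LINT x:{e<..}|lborel. of_real (whittaker_line u x) * g x)"
    "(LINT x:{e<..}|lborel. of_real (whittaker u x / x) * g x) = (LINT x:{e<..}|lborel. of_real (whittaker_line u x / x) * g x)"
    "set_integrable lborel {e<..} (\<lambda>x. of_real (whittaker u x / x) * g x) \<longleftrightarrow>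
      set_integrable lborel {e<..} (\<lambda>x. of_real (whittaker_line u x / x) * g x)" for g :: "real \<Rightarrow> complex"
    by (intro set_lebesgue_integral_cong set_integrable_cong; use e whittaker_line_pos[OF u] in auto)+
  have neg: "(LINT x:{e<..}|lborel. of_real (whittaker (- u) x) * g (- x)) = (LINT x:{..<- e}|lborel. of_real (whittaker_line u x) * g x)"
    "(LINT x:{e<..}|lborel. of_real (whittaker (- u) x / x) * g (- x)) = - (LINT x:{..<- e}|lborel. of_real (whittaker_line u x / x) * g x)"
    "set_integrable lborel {e<..} (\<lambda>x. of_real (whittaker (- u) x / x) * g (- x)) \<longleftrightarrow>
      set_integrable lborel {..<- e} (\<lambda>x. of_real (whittaker_line u x / x) * g x)" for g :: "real \<Rightarrow> complex"
  proof -
    have 1: "(LINT x:{e<..}|lborel. of_real (whittaker (- u) x) * g (- x)) =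
        (LINT x:{e<..}|lborel. of_real (whittaker_line u (- x)) * g (- x))"
      using e whittaker_line_neg[OF u] by (intro set_lebesgue_integral_cong) auto
    show "(LINT x:{e<..}|lborel. of_real (whittaker (- u) x) * g (- x)) = (LINT x:{..<- e}|lborel. of_real (whittaker_line u x) * g x)"
      unfolding 1 by (rule set_integral_reflect(1))
    have 2: "(LINT x:{e<..}|lborel. of_real (whittaker (- u) x / x) * g (- x)) =
        (LINT x:{e<..}|lborel. - (of_real (whittaker_line u (- x) / (- x)) * g (- x)))"
      using e whittaker_line_neg[OF u] by (intro set_lebesgue_integral_cong) auto
    show "(LINT x:{e<..}|lborel. of_real (whittaker (- u) x / x) * g (- x)) = - (LINT x:{..<- e}|lborel. of_real (whittaker_line u x / x) * g x)"
      unfolding 2 set_integral_reflect(1)[of e "\<lambda>x. - (of_real (whittaker_line u x / x) * g x)"]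
      by (simp add: set_lebesgue_integral_def)
    have 3: "set_integrable lborel {e<..} (\<lambda>x. of_real (whittaker (- u) x / x) * g (- x)) \<longleftrightarrow>
        set_integrable lborel {e<..} (\<lambda>x. - (of_real (whittaker_line u (- x) / (- x)) * g (- x)))"
      using e whittaker_line_neg[OF u] by (intro set_integrable_cong) auto
    show "set_integrable lborel {e<..} (\<lambda>x. of_real (whittaker (- u) x / x) * g (- x)) \<longleftrightarrow>
      set_integrable lborel {..<- e} (\<lambda>x. of_real (whittaker_line u x / x) * g x)"
      unfolding 3 set_integral_reflect(2)[of e "\<lambda>x. - (of_real (whittaker_line u x / x) * g x)"]
      by (simp add: set_integrable_def)
  qed
  note G = whittaker_green_half_line[OF u e] and R = r.whittaker_green_half_line[OF nu e]
  note I1 = G(2)[unfolded pos] and I2 = R(2)[unfolded neg(3)]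
  show "set_integrable lborel (outside e) (\<lambda>x. of_real (whittaker_line u x / x) * \<psi> x)"
    unfolding split by (intro set_integrable_Un I1 I2) auto
  have disj: "{e<..} \<inter> {..<- e} = {}" using e by auto
  have "- u * (LINT x:{e<..}|lborel. of_real (whittaker (- u) x / x) * \<psi> (- x)) =
      (LINT x:{e<..}|lborel. of_real (whittaker (- u) x) * ((\<lambda>x. \<psi> x / 4 - \<psi>'' x) (- x)))
      + of_real (whittaker' (- u) e) * \<psi> (- e) + of_real (whittaker (- u) e) * \<psi>' (- e)"
    using R(3) by simp
  then have "u * (LINT x:{..<- e}|lborel. of_real (whittaker_line u x / x) * \<psi> x) =
      (LINT x:{..<- e}|lborel. of_real (whittaker_line u x) * (\<psi> x / 4 - \<psi>'' x))
      + of_real (whittaker' (- u) e) * \<psi> (- e) + of_real (whittaker (- u) e) * \<psi>' (- e)"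
    unfolding neg(2)[of \<psi>] by (simp add: neg(1)[of "\<lambda>x. \<psi> x / 4 - \<psi>'' x"])
  with G(3)[unfolded pos] show "u * (LINT x:outside e|lborel. of_real (whittaker_line u x / x) * \<psi> x) =
      (LINT x:outside e|lborel. of_real (whittaker_line u x) * (\<psi> x / 4 - \<psi>'' x))
      + (of_real (whittaker' u e) * \<psi> e + of_real (whittaker' (- u) e) * \<psi> (- e)
         - of_real (whittaker u e) * \<psi>' e + of_real (whittaker (- u) e) * \<psi>' (- e))"
    unfolding split set_integral_Un[OF disj I1 I2]
      set_integral_Un[OF disj wline_int[of "{e<..}", simplified] wline_int[of "{..<- e}", simplified]]
    by (simp add: distrib_left)
qed

text \<open>
  The derivatives of \<open>whittaker_line u\<close> from the two sides of 0 diverge like \<open>- u * ln \<bar>x\<bar>\<close>. The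
  divergent parts cancel, while the finite parts differ by a jump: it produces the point mass, and the
  reflection formula evaluates it.
\<close>

lemma whittaker_green_line:
  assumes u: "u \<notin> \<int>"
  shows "((\<lambda>e. of_real (sin (pi * u) / pi) * (u * (LINT x:outside e|lborel. of_real (whittaker_line u x / x) * \<psi> x)))
    \<longlongrightarrow> of_real (sin (pi * u) / pi) * (LINT x|lborel. of_real (whittaker_line u x) * (\<psi> x / 4 - \<psi>'' x))
      - of_real (u * cos (pi * u)) * \<psi> 0) (at_right 0)"
proof -
  have nu: "- u \<notin> \<int>" using u by simp
  let ?s = "complex_of_real (sin (pi * u) / pi)"
  let ?I = "LINT x|lborel. of_real (whittaker_line u x) * (\<psi> x / 4 - \<psi>'' x)"
  let ?b = "\<lambda>e. of_real (whittaker' u e) * \<psi> e + of_real (whittaker' (- u) e) * \<psi> (- e)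
         - of_real (whittaker u e) * \<psi>' e + of_real (whittaker (- u) e) * \<psi>' (- e) :: complex"
  have at0: "((\<lambda>e. g e) \<longlongrightarrow> g 0) (at_right 0)" "((\<lambda>e. g (- e)) \<longlongrightarrow> g 0) (at_right 0)"
    if "\<And>x. isCont g x" for g :: "real \<Rightarrow> complex"
  proof -
    have "isCont (\<lambda>e. g (- e)) 0" using that by (rule isCont_o2[where g=g, rotated]) auto
    with that[of 0] show "((\<lambda>e. g e) \<longlongrightarrow> g 0) (at_right 0)" "((\<lambda>e. g (- e)) \<longlongrightarrow> g 0) (at_right 0)"
      by (auto simp: isCont_def intro: tendsto_within_subset)
  qed
  have "((\<lambda>e. of_real (whittaker' u e + u * ln e) * \<psi> e + of_real (whittaker' (- u) e + (- u) * ln e) * \<psi> (- e)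
      - of_real u * (of_real (ln e) * (\<psi> e - \<psi> (- e)))
      - of_real (whittaker u e) * \<psi>' e + of_real (whittaker (- u) e) * \<psi>' (- e)) \<longlongrightarrow>
      of_real (- u * (1 + digamma_diff u 1) - 1 / 2) * \<psi> 0
      + of_real (- (- u) * (1 + digamma_diff (- u) 1) - 1 / 2) * \<psi> 0
      - of_real u * 0 - of_real 1 * \<psi>' 0 + of_real 1 * \<psi>' 0) (at_right 0)"
    by (intro tendsto_intros whittaker_at_0 whittaker'_at_0 u nu at0 cont log_difference_tendsto_0)
  then have b: "(?b \<longlongrightarrow> - of_real (u * (digamma_diff u 1 - digamma_diff (- u) 1) + 1) * \<psi> 0) (at_right 0)"
    by (simp add: algebra_simps)
  have lim: "((\<lambda>e. ?s * ((LINT x:outside e|lborel. of_real (whittaker_line u x) * (\<psi> x / 4 - \<psi>'' x)) + ?b e))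
      \<longlongrightarrow> ?s * (?I + - of_real (u * (digamma_diff u 1 - digamma_diff (- u) 1) + 1) * \<psi> 0)) (at_right 0)"
    by (intro tendsto_intros b integrable_outside_tendsto integrable_whittaker_line_mult[OF u _ operator_bound]) auto
  have val: "?s * (?I + - of_real (u * (digamma_diff u 1 - digamma_diff (- u) 1) + 1) * \<psi> 0)
      = ?s * ?I - of_real (u * cos (pi * u)) * \<psi> 0"
  proof -
    have "of_real a * (z + - of_real b * w) = of_real a * z - of_real (a * b) * w" for a b :: real and z w :: complex
      by (simp add: algebra_simps)
    from this[of "sin (pi * u) / pi" ?I "u * (digamma_diff u 1 - digamma_diff (- u) 1) + 1" "\<psi> 0"]
    show ?thesis by (simp only: digamma_diff_reflection[OF u] of_real_mult)
  qed
  have eq: "\<forall>\<^sub>F e in at_right 0. ?s *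
        ((LINT x:outside e|lborel. of_real (whittaker_line u x) * (\<psi> x / 4 - \<psi>'' x)) + ?b e) =
      ?s * (u * (LINT x:outside e|lborel. of_real (whittaker_line u x / x) * \<psi> x))"
    using eventually_at_right_less by eventually_elim (simp only: whittaker_green_outside(2)[OF u])
  show ?thesis
    by (rule Lim_transform_eventually[OF lim[unfolded val] eq])
qed

end

section \<open>The Fourier transform of the Whittaker function\<close>

lemma DERIV_mu_phase: "((\<lambda>l. arctan (2 * l)) has_real_derivative 1 / (2 * (1 / 4 + l\<^sup>2))) (at l)"
  by (rule derivative_eq_intros refl | simp)+ (simp add: power2_eq_square divide_simps add_pos_nonneg)

lemma mu_symbol_deriv:
  "(mu_symbol u has_vector_derivative - \<i> * of_real u / of_real (1 / 4 + l\<^sup>2) * mu_symbol u l) (at l)"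
proof -
  have "- 2 * \<i> * of_real u * of_real (1 / (2 * t)) = - \<i> * of_real u / of_real t" for t
    by simp
  from has_vector_derivative_exp_mult[OF DERIV_mu_phase, of "- 2 * \<i> * of_real u" l, unfolded this]
  show ?thesis unfolding mu_symbol_def[abs_def] .
qed

lemma isCont_mu_symbol: "isCont (mu_symbol u) l"
  using mu_symbol_deriv has_vector_derivative_continuous by blast

lemma mu_symbol_measurable [measurable]: "mu_symbol u \<in> borel_measurable borel"
  by (intro borel_measurable_continuous_onI continuous_at_imp_continuous_on) (auto intro: isCont_mu_symbol)

lemma norm_mu_symbol: "norm (mu_symbol u l) = 1"
  by (simp add: mu_symbol_def norm_exp_eq_Re)

lemma mu_symbol_inverse: "exp (2 * \<i> * of_real u * of_real (arctan (2 * l))) * mu_symbol u l = 1"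
  by (simp add: mu_symbol_def exp_add[symmetric])

lemma quarter_plus_square: "1 / 4 + l\<^sup>2 > 0" "1 / (1 / 4 + l\<^sup>2) \<le> 4 * inverse (1 + l\<^sup>2)" for l :: real
proof -
  show pos: "1 / 4 + l\<^sup>2 > 0" by (rule add_pos_nonneg) auto
  have "1 + l\<^sup>2 > 0" by (rule add_pos_nonneg) auto
  with pos show "1 / (1 / 4 + l\<^sup>2) \<le> 4 * inverse (1 + l\<^sup>2)" by (simp add: divide_simps)
qed

text \<open>The integrand is the derivative of a multiple of the symbol itself.\<close>

lemma mu_symbol_integral:
  assumes u: "u \<noteq> 0"
  shows "integrable lborel (\<lambda>l. mu_symbol u l / of_real (1 / 4 + l\<^sup>2))"
    and "(LINT l|lborel. mu_symbol u l / of_real (1 / 4 + l\<^sup>2)) = of_real (2 * sin (pi * u) / u)"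
proof -
  let ?k = "\<lambda>l. mu_symbol u l / of_real (1 / 4 + l\<^sup>2)"
  show int: "integrable lborel ?k"
  proof (rule Bochner_Integration.integrable_bound)
    show "integrable lborel (\<lambda>l::real. 4 * inverse (1 + l\<^sup>2))"
      by (intro integrable_mult_right integrable_inverse_one_plus_square)
    show "AE l in lborel. norm (?k l) \<le> norm (4 * inverse (1 + l\<^sup>2))"
    proof (rule AE_I2)
      fix l :: real
      have "norm (?k l) = 1 / (1 / 4 + l\<^sup>2)"
        using quarter_plus_square(1)[of l] by (simp only: norm_divide norm_mu_symbol norm_of_real abs_of_pos)
      then show "norm (?k l) \<le> norm (4 * inverse (1 + l\<^sup>2))"
        using quarter_plus_square(2)[of l] by simp
    qed
  qed measurable
  have lim: "((\<lambda>l. \<i> / of_real u * mu_symbol u l) \<longlongrightarrow> \<i> / of_real u * exp (- 2 * \<i> * of_real u * of_real t)) F"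
    if "((\<lambda>l. arctan (2 * l)) \<longlongrightarrow> t) F" for t F
    unfolding mu_symbol_def by (intro tendsto_intros that)
  have "(LINT l|lborel. ?k l) =
      \<i> / of_real u * exp (- 2 * \<i> * of_real u * of_real (pi / 2)) - \<i> / of_real u * exp (- 2 * \<i> * of_real u * of_real (- (pi / 2)))"
  proof (rule integral_derivative_line[OF _ _ int])
    show "((\<lambda>l. \<i> / of_real u * mu_symbol u l) has_vector_derivative ?k l) (at l)" for l
      using has_vector_derivative_mult_right[OF mu_symbol_deriv[of u l], of "\<i> / of_real u"]
      by (rule has_vector_derivative_eq_rhs) (use u in \<open>simp add: field_simps\<close>)
    show "isCont ?k l" for l
    proof -
      have "complex_of_real (1 / 4 + l\<^sup>2) \<noteq> 0"
        using quarter_plus_square(1)[of l] by (simp only: of_real_eq_0_iff less_imp_neq not_sym)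
      then show ?thesis by (intro continuous_intros isCont_mu_symbol)
    qed
    have f: "filterlim (\<lambda>l::real. 2 * l) at_top at_top" "filterlim (\<lambda>l::real. 2 * l) at_bot at_bot" by real_asymp+
    show "((\<lambda>l. \<i> / of_real u * mu_symbol u l) \<longlongrightarrow> \<i> / of_real u * exp (- 2 * \<i> * of_real u * of_real (pi / 2))) at_top"
      by (intro lim filterlim_compose[OF tendsto_arctan_at_top f(1)])
    show "((\<lambda>l. \<i> / of_real u * mu_symbol u l) \<longlongrightarrow> \<i> / of_real u * exp (- 2 * \<i> * of_real u * of_real (- (pi / 2)))) at_bot"
      by (intro lim filterlim_compose[OF tendsto_arctan_at_bot f(2)])
  qed
  also have "\<dots> = of_real (2 * sin (pi * u) / u)"
  proof -
    have "exp (- 2 * \<i> * of_real u * of_real (pi / 2)) = cnj (cis (pi * u))"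
      "exp (- 2 * \<i> * of_real u * of_real (- (pi / 2))) = cis (pi * u)"
      by (simp_all add: cis_conv_exp exp_cnj mult_ac)
    then show ?thesis
      using u by (simp add: complex_eq_iff)
  qed
  finally show "(LINT l|lborel. ?k l) = of_real (2 * sin (pi * u) / u)" .
qed

context
  fixes u :: real
  assumes u: "u \<notin> \<int>"
begin

lemma sin_nonzero: "sin (pi * u) \<noteq> 0"
proof
  assume "sin (pi * u) = 0"
  then obtain i where "pi * u = of_int i * pi" by (auto simp: sin_zero_iff_int2)
  then have "u = of_int i" by simp
  with u show False by simp
qed

abbreviation "W \<equiv> fourier (\<lambda>x. complex_of_real (whittaker_line u x))"

lemma integrable_whittaker_line: "integrable lborel (\<lambda>x. complex_of_real (whittaker_line u x))"
  using integrable_whittaker_line_mult[OF u, of "\<lambda>_. 1" 1] by simp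

lemma integrable_ident_whittaker_line: "integrable lborel (\<lambda>x. of_real x * complex_of_real (whittaker_line u x))"
  using integrable_whittaker_line_mult[OF u, of "\<lambda>x. of_real x" 1] by (simp add: mult.commute)

text \<open>Green's formula with the test function \<open>x * exp (- \<i> l x)\<close>, which kills the point mass at 0.\<close>

lemma fourier_whittaker_relation:
  "of_real u * W l = of_real (1 / 4 + l\<^sup>2) * fourier (\<lambda>x. of_real x * of_real (whittaker_line u x)) l
     + 2 * \<i> * of_real l * W l"
proof -
  let ?e = "\<lambda>x. exp (- \<i> * of_real (l * x))"
  define \<psi> where "\<psi> x = of_real x * ?e x" for x
  define \<psi>' where "\<psi>' x = (1 - \<i> * of_real (l * x)) * ?e x" for x
  define \<psi>'' where "\<psi>'' x = (- 2 * \<i> * of_real l - of_real (l\<^sup>2 * x)) * ?e x" for x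
  have e: "(?e has_vector_derivative - \<i> * of_real l * ?e x) (at x)" for x
    by (rule has_vector_derivative_exp_mult) (auto intro!: derivative_eq_intros)
  have e': "isCont ?e x" for x by (intro continuous_intros)
  interpret t: linear_growth_test \<psi> \<psi>' \<psi>'' "1 + 2 * \<bar>l\<bar> + l\<^sup>2"
  proof
    fix x :: real
    have "(\<psi> has_vector_derivative of_real x * (- \<i> * of_real l * ?e x) + of_real 1 * ?e x) (at x)"
      unfolding \<psi>_def[abs_def] by (intro has_vector_derivative_mult has_vector_derivative_of_real DERIV_ident e)
    then show "(\<psi> has_vector_derivative \<psi>' x) (at x)"
      by (rule has_vector_derivative_eq_rhs) (simp add: \<psi>'_def algebra_simps)
    have "((\<lambda>x. 1 - \<i> * of_real (l * x)) has_vector_derivative 0 - \<i> * of_real (l * 1)) (at x)"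
      by (intro has_vector_derivative_diff has_vector_derivative_const has_vector_derivative_mult_right
          has_vector_derivative_of_real DERIV_cmult DERIV_ident)
    from has_vector_derivative_mult[OF this e[of x]]
    show "(\<psi>' has_vector_derivative \<psi>'' x) (at x)"
      unfolding \<psi>'_def[abs_def]
      by (rule has_vector_derivative_eq_rhs) (simp add: \<psi>''_def algebra_simps power2_eq_square)
    show "isCont \<psi>'' x" unfolding \<psi>''_def[abs_def] by (intro continuous_intros)
    have ne: "norm (?e x) = 1" by (simp add: norm_exp_eq_Re)
    have K: "\<bar>x\<bar> \<le> (1 + 2 * \<bar>l\<bar> + l\<^sup>2) * (1 + \<bar>x\<bar>)" "1 + \<bar>l\<bar> * \<bar>x\<bar> \<le> (1 + 2 * \<bar>l\<bar> + l\<^sup>2) * (1 + \<bar>x\<bar>)"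
      "2 * \<bar>l\<bar> + l\<^sup>2 * \<bar>x\<bar> \<le> (1 + 2 * \<bar>l\<bar> + l\<^sup>2) * (1 + \<bar>x\<bar>)"
    proof -
      have "0 \<le> \<bar>l\<bar> * \<bar>x\<bar>" "0 \<le> l\<^sup>2 * \<bar>x\<bar>" "0 \<le> \<bar>x\<bar>" "0 \<le> \<bar>l\<bar>" "0 \<le> l\<^sup>2" by auto
      then show "\<bar>x\<bar> \<le> (1 + 2 * \<bar>l\<bar> + l\<^sup>2) * (1 + \<bar>x\<bar>)" "1 + \<bar>l\<bar> * \<bar>x\<bar> \<le> (1 + 2 * \<bar>l\<bar> + l\<^sup>2) * (1 + \<bar>x\<bar>)"
        "2 * \<bar>l\<bar> + l\<^sup>2 * \<bar>x\<bar> \<le> (1 + 2 * \<bar>l\<bar> + l\<^sup>2) * (1 + \<bar>x\<bar>)"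
        unfolding distrib_left distrib_right mult_1 mult_1_right mult.assoc by linarith+
    qed
    show "norm (\<psi> x) \<le> (1 + 2 * \<bar>l\<bar> + l\<^sup>2) * (1 + \<bar>x\<bar>)"
      unfolding \<psi>_def norm_mult ne using K(1) by simp
    have "norm (1 - \<i> * of_real (l * x)) \<le> 1 + \<bar>l\<bar> * \<bar>x\<bar>"
      using norm_triangle_ineq4[of 1 "\<i> * of_real (l * x)"] by (simp add: norm_mult)
    then show "norm (\<psi>' x) \<le> (1 + 2 * \<bar>l\<bar> + l\<^sup>2) * (1 + \<bar>x\<bar>)"
      unfolding \<psi>'_def norm_mult ne using K(2) by linarith
    have "norm (- 2 * \<i> * of_real l - of_real (l\<^sup>2 * x)) \<le> 2 * \<bar>l\<bar> + l\<^sup>2 * \<bar>x\<bar>"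
      using norm_triangle_ineq4[of "- 2 * \<i> * of_real l" "of_real (l\<^sup>2 * x)"] by (simp add: norm_mult norm_power)
    then show "norm (\<psi>'' x) \<le> (1 + 2 * \<bar>l\<bar> + l\<^sup>2) * (1 + \<bar>x\<bar>)"
      unfolding \<psi>''_def norm_mult ne using K(3) by linarith
  qed
  let ?s = "complex_of_real (sin (pi * u) / pi)"
  let ?xw = "fourier (\<lambda>x. of_real x * of_real (whittaker_line u x)) l"
  have cancel: "(LINT x:outside e|lborel. of_real (whittaker_line u x / x) * \<psi> x) =
      (LINT x:outside e|lborel. ?e x * of_real (whittaker_line u x))" if "e > 0" for e
    using that by (intro set_lebesgue_integral_cong) (auto simp: \<psi>_def)
  have "\<forall>\<^sub>F e in at_right 0. ?s * (of_real u * (LINT x:outside e|lborel. ?e x * of_real (whittaker_line u x))) =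
      ?s * (of_real u * (LINT x:outside e|lborel. of_real (whittaker_line u x / x) * \<psi> x))"
    using eventually_at_right_less by eventually_elim (simp only: cancel)
  moreover have "((\<lambda>e. ?s * (of_real u * (LINT x:outside e|lborel. ?e x * of_real (whittaker_line u x)))) \<longlongrightarrow> ?s * (of_real u * W l)) (at_right 0)"
    unfolding fourier_def by (intro tendsto_intros integrable_outside_tendsto integrable_fourier_kernel integrable_whittaker_line)
  ultimately have "((\<lambda>e. ?s * (of_real u * (LINT x:outside e|lborel. of_real (whittaker_line u x / x) * \<psi> x))) \<longlongrightarrow> ?s * (of_real u * W l)) (at_right 0)"
    by (rule Lim_transform_eventually[rotated])
  then have "?s * (of_real u * W l) = ?s * (LINT x|lborel. of_real (whittaker_line u x) * (\<psi> x / 4 - \<psi>'' x)) - of_real (u * cos (pi * u)) * \<psi> 0"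
    by (rule tendsto_unique[rotated]) (use t.whittaker_green_line[OF u] in auto)
  then have "of_real u * W l = (LINT x|lborel. of_real (whittaker_line u x) * (\<psi> x / 4 - \<psi>'' x))"
    using sin_nonzero by (simp add: \<psi>_def)
  also have "\<dots> = (LINT x|lborel. of_real (1 / 4 + l\<^sup>2) * (?e x * (of_real x * of_real (whittaker_line u x)))
      + 2 * \<i> * of_real l * (?e x * of_real (whittaker_line u x)))"
    by (intro Bochner_Integration.integral_cong) (auto simp: \<psi>_def \<psi>''_def algebra_simps)
  also have "\<dots> = of_real (1 / 4 + l\<^sup>2) * ?xw + 2 * \<i> * of_real l * W l"
    unfolding fourier_def
    by (subst Bochner_Integration.integral_add)
       (intro integrable_mult_right integrable_fourier_kernel integrable_whittaker_line integrable_ident_whittaker_line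
        | simp only: integral_mult_right_zero)+
  finally show ?thesis .
qed

text \<open>
  The relation above is a first-order differential equation for \<open>W\<close>, which the symbol divided by
  \<open>1 / 4 + l\<^sup>2\<close> solves as well. The constant comes from Fourier inversion at 0.
\<close>

lemma fourier_whittaker_line:
  "of_real (sin (pi * u) / pi) * (of_real (1 / 4 + l\<^sup>2) * W l) = of_real u * mu_symbol u l"
proof -
  let ?q = "\<lambda>l::real. complex_of_real (1 / 4 + l\<^sup>2)"
  let ?p = "\<lambda>l. exp (2 * \<i> * of_real u * of_real (arctan (2 * l)))"
  have u0: "u \<noteq> 0" using u by auto
  have q0: "?q l \<noteq> 0" for l
    using quarter_plus_square(1)[of l] by (simp only: of_real_eq_0_iff less_imp_neq not_sym)
  have "((\<lambda>l. ?q l * W l * ?p l) has_vector_derivative 0) (at l)" for l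
  proof -
    let ?xw = "fourier (\<lambda>x. of_real x * of_real (whittaker_line u x)) l"
    have "(W has_vector_derivative fourier (\<lambda>x. - \<i> * of_real x * of_real (whittaker_line u x)) l) (at l)"
      by (rule fourier_has_vector_derivative[OF integrable_whittaker_line integrable_ident_whittaker_line])
    then have W: "(W has_vector_derivative - \<i> * ?xw) (at l)"
      by (simp only: mult.assoc fourier_cmult)
    have q: "(?q has_vector_derivative of_real (2 * l)) (at l)"
      by (intro has_vector_derivative_of_real) (auto intro!: derivative_eq_intros)
    have p: "(?p has_vector_derivative 2 * \<i> * of_real u * of_real (1 / (2 * (1 / 4 + l\<^sup>2))) * ?p l) (at l)"
      by (rule has_vector_derivative_exp_mult[OF DERIV_mu_phase])
    have p': "2 * \<i> * of_real u * of_real (1 / (2 * t)) = \<i> * of_real u / of_real t" for t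
      by simp
    have "((\<lambda>l. ?q l * W l * ?p l) has_vector_derivative
        ?q l * W l * (\<i> * of_real u / ?q l * ?p l) + (?q l * (- \<i> * ?xw) + of_real (2 * l) * W l) * ?p l) (at l)"
      by (intro has_vector_derivative_mult q W p[unfolded p'])
    then show ?thesis
    proof (rule has_vector_derivative_eq_rhs)
      have "?q l * W l * (\<i> * of_real u / ?q l * ?p l) + (?q l * (- \<i> * ?xw) + of_real (2 * l) * W l) * ?p l
          = \<i> * (of_real u * W l - (?q l * ?xw + 2 * \<i> * of_real l * W l)) * ?p l"
      proof -
        have "q * w * (\<i> * a / q * p) + (q * (- \<i> * y) + 2 * b * w) * p = \<i> * (a * w - (q * y + 2 * \<i> * b * w)) * p"
          if "q \<noteq> 0" for q w a p y b :: complex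
          using that by (simp add: algebra_simps)
        from this[OF q0[of l]] show ?thesis by (simp only: of_real_mult of_real_numeral)
      qed
      then show "?q l * W l * (\<i> * of_real u / ?q l * ?p l) + (?q l * (- \<i> * ?xw) + of_real (2 * l) * W l) * ?p l = 0"
        unfolding fourier_whittaker_relation[of l, symmetric] by simp
    qed
  qed
  then have "\<exists>c. \<forall>l\<in>UNIV. ?q l * W l * ?p l = c"
    by (intro has_derivative_zero_constant) (auto simp: has_vector_derivative_def)
  then obtain c where c: "\<And>l. ?q l * W l * ?p l = c" by blast
  have qW: "?q l * W l = c * mu_symbol u l" for l
  proof -
    have "c * mu_symbol u l = ?q l * W l * (?p l * mu_symbol u l)" by (simp only: c[of l, symmetric] mult.assoc)
    then show ?thesis by (simp only: mu_symbol_inverse mult_1_right)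
  qed
  then have W: "W l = c * (mu_symbol u l / ?q l)" for l
    using q0[of l] by (simp add: field_simps)
  note k = mu_symbol_integral[OF u0]
  have "integrable lborel W"
    unfolding W[abs_def] by (intro integrable_mult_right k)
  obtain C where C: "C \<ge> 0" "\<And>x. \<bar>whittaker_line u x\<bar> \<le> C * exp (- \<bar>x\<bar> / 4)"
    using whittaker_line_decay[OF u] by blast
  have "(LINT l|lborel. W l) = 2 * pi * complex_of_real (whittaker_line u 0)"
  proof (rule fourier_inversion_at_0[OF integrable_whittaker_line \<open>integrable lborel W\<close>])
    show "norm (complex_of_real (whittaker_line u x)) \<le> C" for x
      by (simp, rule order.trans[OF C(2)]) (use C(1) in \<open>auto intro!: mult_left_le\<close>)
    show "isCont (\<lambda>x. complex_of_real (whittaker_line u x)) 0"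
      by (intro continuous_intros isCont_whittaker_line u)
  qed
  then have "c * of_real (2 * sin (pi * u) / u) = 2 * of_real pi"
    unfolding W[abs_def] integral_mult_right_zero k(2) by (simp add: whittaker_line_def)
  then have "of_real (sin (pi * u) / pi) * c = of_real u"
    using u0 by (simp add: field_simps)
  then show ?thesis unfolding qW by (simp only: mult.assoc[symmetric])
qed

section \<open>The decomposition\<close>

lemma schwartz_test_function:
  assumes f: "f \<in> schwartz"
  shows "\<exists>K. linear_growth_test f (higher_vderiv 1 f) (higher_vderiv 2 f) K"
proof -
  define K where "K = schwartz_seminorm 0 0 f + schwartz_seminorm 0 1 f + schwartz_seminorm 0 2 f"
  have "norm (higher_vderiv n f x) \<le> K * (1 + \<bar>x\<bar>)" if "n \<in> {0, 1, 2}" for n x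
  proof -
    have "norm (higher_vderiv n f x) \<le> schwartz_seminorm 0 n f"
      using schwartz_seminorm_upper[OF f, of x 0 n] by simp
    also have "\<dots> \<le> K"
      using that schwartz_seminorm_nonneg[OF f, of 0 0] schwartz_seminorm_nonneg[OF f, of 0 1]
        schwartz_seminorm_nonneg[OF f, of 0 2] by (auto simp: K_def)
    also have "\<dots> \<le> K * (1 + \<bar>x\<bar>)"
      using schwartz_seminorm_nonneg[OF f] by (simp add: K_def distrib_left)
    finally show ?thesis .
  qed
  from this[of 0] this[of 1] this[of 2] show ?thesis
    using schwartz_vderiv[OF f, of 0] schwartz_vderiv[OF f, of 1] schwartz_continuous[OF f, where n=2]
    by (intro exI[of _ K]) (unfold_locales; simp add: numeral_2_eq_2)
qed

text \<open>
  The operator \<open>1 / 4 - d\<^sup>2 / dx\<^sup>2\<close> in Green's formula acts on \<open>fourier \<phi>\<close> as multiplication of \<open>\<phi>\<close> by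
  \<open>1 / 4 + l\<^sup>2\<close>. The multiplication formula moves this factor to the transform \<open>W\<close>, where it gives the symbol.
\<close>

lemma whittaker_line_principal_value:
  assumes \<phi>: "\<phi> \<in> schwartz"
  shows "((\<lambda>e. of_real (sin (pi * u) / pi) * (LINT x:outside e|lborel. of_real (whittaker_line u x / x) * fourier \<phi> x))
    \<longlongrightarrow> (LINT l|lborel. mu_symbol u l * \<phi> l) - of_real (cos (pi * u)) * fourier \<phi> 0) (at_right 0)"
proof -
  let ?\<psi> = "fourier \<phi>" and ?s = "complex_of_real (sin (pi * u) / pi)"
  define g where "g l = of_real (1 / 4 + l\<^sup>2) * \<phi> l" for l
  have u0: "u \<noteq> 0" using u by auto
  have \<psi>: "?\<psi> \<in> schwartz" by (rule fourier_schwartz[OF \<phi>])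
  obtain K where "linear_growth_test ?\<psi> (higher_vderiv 1 ?\<psi>) (higher_vderiv 2 ?\<psi>) K"
    using schwartz_test_function[OF \<psi>] by blast
  then interpret t: linear_growth_test ?\<psi> "higher_vderiv 1 ?\<psi>" "higher_vderiv 2 ?\<psi>" K .
  have xx: "(\<lambda>l. of_real l * (of_real l * \<phi> l)) \<in> schwartz" by (intro schwartz_mult_ident \<phi>)
  have g: "g \<in> schwartz"
    using schwartz_add[OF schwartz_cmult[OF \<phi>, of "1 / 4"] xx]
    by (simp add: g_def[abs_def] algebra_simps power2_eq_square)
  have op: "?\<psi> x / 4 - higher_vderiv 2 ?\<psi> x = fourier g x" for x
  proof -
    have "higher_vderiv 2 ?\<psi> x = - fourier (\<lambda>l. of_real l * (of_real l * \<phi> l)) x"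
      unfolding higher_vderiv_fourier[OF \<phi>]
      using fourier_cmult[of "-1" "\<lambda>l. of_real l * (of_real l * \<phi> l)" x] by (simp add: power2_eq_square mult_ac)
    moreover have "fourier g x = fourier (\<lambda>l. (1 / 4) * \<phi> l + of_real l * (of_real l * \<phi> l)) x"
      by (simp add: g_def[abs_def] algebra_simps power2_eq_square)
    then have "fourier g x = (1 / 4) * ?\<psi> x + fourier (\<lambda>l. of_real l * (of_real l * \<phi> l)) x"
      by (simp only: fourier_add[OF schwartz_integrable[OF schwartz_cmult[OF \<phi>]] schwartz_integrable[OF xx]] fourier_cmult)
    ultimately show ?thesis by simp
  qed
  have "?s * (LINT x|lborel. of_real (whittaker_line u x) * (?\<psi> x / 4 - higher_vderiv 2 ?\<psi> x)) =
      ?s * (LINT l|lborel. W l * g l)"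
    unfolding op fourier_multiplication_formula[OF integrable_whittaker_line schwartz_integrable[OF g]] ..
  also have "\<dots> = (LINT l|lborel. ?s * (W l * g l))"
    by (simp only: integral_mult_right_zero)
  also have "\<dots> = (LINT l|lborel. of_real u * (mu_symbol u l * \<phi> l))"
  proof (intro Bochner_Integration.integral_cong refl)
    fix l
    have "?s * (W l * g l) = ?s * (of_real (1 / 4 + l\<^sup>2) * W l) * \<phi> l" by (simp only: g_def mult_ac)
    also have "\<dots> = of_real u * (mu_symbol u l * \<phi> l)" by (simp only: fourier_whittaker_line mult.assoc)
    finally show "?s * (W l * g l) = of_real u * (mu_symbol u l * \<phi> l)" .
  qed
  finally have I: "?s * (LINT x|lborel. of_real (whittaker_line u x) * (?\<psi> x / 4 - higher_vderiv 2 ?\<psi> x)) =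
      of_real u * (LINT l|lborel. mu_symbol u l * \<phi> l)" by simp
  have "(1 / of_real u) * (?s * (of_real u * z)) = ?s * z"
    "(1 / of_real u) * (of_real u * z - of_real (u * v) * w) = z - of_real v * w" for z w :: complex and v :: real
    using u0 by (simp_all add: diff_divide_distrib)
  with tendsto_mult_left[OF t.whittaker_green_line[OF u, unfolded I], of "1 / of_real u"]
  show ?thesis by (simp only:)
qed

text \<open>
  Away from 0, \<open>1 / x\<close> is a combination of \<open>whittaker_line u x / x\<close> and \<open>Phi u x\<close>, because
  \<open>sin (pi * u)\<close> is nonzero. So the limit that defines the principal value exists, and its value follows.
\<close>

lemma mu_decomposition:
  assumes \<phi>: "\<phi> \<in> schwartz"
  shows "(LINT l|lborel. mu_symbol u l * \<phi> l) =
    of_real (cos (pi * u)) * dirac_zero (fourier \<phi>) + of_real (sin (pi * u) / pi) * pv_inverse (fourier \<phi>)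
    + regular_distribution (\<lambda>x. of_real (Phi u x)) (fourier \<phi>)"
proof -
  let ?\<psi> = "fourier \<phi>" and ?s = "complex_of_real (sin (pi * u) / pi)"
  have \<psi>: "?\<psi> \<in> schwartz" by (rule fourier_schwartz[OF \<phi>])
  obtain K where "linear_growth_test ?\<psi> (higher_vderiv 1 ?\<psi>) (higher_vderiv 2 ?\<psi>) K"
    using schwartz_test_function[OF \<psi>] by blast
  then interpret t: linear_growth_test ?\<psi> "higher_vderiv 1 ?\<psi>" "higher_vderiv 2 ?\<psi>" K .
  let ?R = "(LINT l|lborel. mu_symbol u l * \<phi> l) - of_real (cos (pi * u)) * ?\<psi> 0 - (LINT x|lborel. of_real (Phi u x) * ?\<psi> x)"
  have s0: "?s \<noteq> 0" using sin_nonzero by simp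
  have split: "(LINT x:outside e|lborel. ?\<psi> x / of_real x) = (1 / ?s) *
      (?s * (LINT x:outside e|lborel. of_real (whittaker_line u x / x) * ?\<psi> x)
        - (LINT x:outside e|lborel. of_real (Phi u x) * ?\<psi> x))" if e: "e > 0" for e
  proof -
    have "(LINT x:outside e|lborel. ?\<psi> x / of_real x) =
        (LINT x:outside e|lborel. (1 / ?s) * (?s * (of_real (whittaker_line u x / x) * ?\<psi> x) - of_real (Phi u x) * ?\<psi> x))"
    proof (intro set_lebesgue_integral_cong allI impI)
      fix x assume "x \<in> outside e"
      then have x: "x \<noteq> 0" using e by auto
      have "?s * (of_real (whittaker_line u x / x) * ?\<psi> x) - of_real (Phi u x) * ?\<psi> x = ?s * (?\<psi> x / of_real x)"
        unfolding Phi_eq[OF u x] by (simp add: algebra_simps)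
      then show "?\<psi> x / of_real x = (1 / ?s) * (?s * (of_real (whittaker_line u x / x) * ?\<psi> x) - of_real (Phi u x) * ?\<psi> x)"
        using s0 by simp
    qed auto
    also have "\<dots> = (1 / ?s) * (?s * (LINT x:outside e|lborel. of_real (whittaker_line u x / x) * ?\<psi> x)
        - (LINT x:outside e|lborel. of_real (Phi u x) * ?\<psi> x))"
      unfolding set_integral_mult_right
      by (subst set_integral_diff(2)[OF set_integrable_mult_right[OF t.whittaker_green_outside(1)[OF u e]]
            set_integrable_of_integrable[OF integrable_Phi_mult_schwartz[OF u \<psi>]]])
         (simp_all only: set_integral_mult_right, simp)
    finally show ?thesis .
  qed
  have "((\<lambda>e. (1 / ?s) * (?s * (LINT x:outside e|lborel. of_real (whittaker_line u x / x) * ?\<psi> x)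
        - (LINT x:outside e|lborel. of_real (Phi u x) * ?\<psi> x))) \<longlongrightarrow> (1 / ?s) * ?R) (at_right 0)"
    by (intro tendsto_intros whittaker_line_principal_value[OF \<phi>] integrable_outside_tendsto
        integrable_Phi_mult_schwartz[OF u \<psi>])
  then have "((\<lambda>e. LINT x:outside e|lborel. ?\<psi> x / of_real x) \<longlongrightarrow> (1 / ?s) * ?R) (at_right 0)"
    by (rule Lim_transform_eventually)
       (use eventually_at_right_less[of "0::real"] in \<open>auto elim!: eventually_mono simp only: split\<close>)
  then have "pv_inverse ?\<psi> = (1 / ?s) * ?R"
    using \<psi> by (simp add: pv_inverse_def tendsto_Lim)
  then have "?s * pv_inverse ?\<psi> = ?R" using s0 by simp
  then show ?thesis
    using \<psi> by (simp add: dirac_zero_def regular_distribution_def)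
qed

end

section \<open>Inverting the Fourier transform of a bounded symbol\<close>

lemma fourier_fourier:
  assumes f: "f \<in> schwartz"
  shows "1 / (2 * pi) * fourier (fourier f) (- l) = f l"
proof -
  have "fourier (\<lambda>l. 1 / (2 * pi) * fourier f (- l)) l = of_real (1 / (2 * pi)) * fourier (fourier f) (- l)"
    using fourier_cmult[of "1 / (2 * pi)" "\<lambda>l. fourier f (- l)" l] fourier_reflect[of "fourier f" l] by simp
  then show ?thesis using schwartz_fourier_inversion[OF f] by simp
qed

lemma fourier_surj_schwartz:
  assumes f: "f \<in> schwartz"
  shows "\<exists>\<phi>\<in>schwartz. fourier \<phi> = f"
  using schwartz_fourier_inversion[OF f] schwartz_cmult[OF schwartz_reflect[OF fourier_schwartz[OF f]], of "1 / (2 * pi)"]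
  by auto

text \<open>
  Integrability of the transform needs the weight \<open>1 + l\<^sup>2\<close>, which costs two derivatives of \<open>f\<close>.
\<close>

lemma fourier_integral_norm_le:
  assumes f: "f \<in> schwartz"
  shows "(LINT l|lborel. norm (fourier f l)) \<le> pi\<^sup>2 * (\<Sum>m\<le>2. \<Sum>n\<le>2. schwartz_seminorm m n f)"
proof -
  let ?s = "\<lambda>m n. schwartz_seminorm m n f"
  have F: "fourier f \<in> schwartz" by (rule fourier_schwartz[OF f])
  have f2: "higher_vderiv 2 f \<in> schwartz" by (rule schwartz_higher_vderiv[OF f])
  have "schwartz_seminorm 0 0 (fourier f) \<le> (LINT x|lborel. norm (f x))"
    unfolding schwartz_seminorm_def
    by (rule cSUP_least) (auto intro: norm_fourier_le schwartz_integrable f)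
  also have "\<dots> \<le> pi * (?s 0 0 + ?s 2 0)" by (rule schwartz_integral_norm_le[OF f])
  finally have 1: "schwartz_seminorm 0 0 (fourier f) \<le> pi * (?s 0 0 + ?s 2 0)" .
  have "schwartz_seminorm 2 0 (fourier f) \<le> (LINT x|lborel. norm (higher_vderiv 2 f x))"
    unfolding schwartz_seminorm_def
  proof (rule cSUP_least)
    fix l
    have "\<bar>l\<bar>\<^sup>2 * norm (fourier f l) = norm (fourier (higher_vderiv 2 f) l)"
      unfolding fourier_higher_derivative[OF f] by (simp add: norm_mult norm_power)
    also have "\<dots> \<le> (LINT x|lborel. norm (higher_vderiv 2 f x))"
      by (intro norm_fourier_le schwartz_integrable f2)
    finally show "\<bar>l\<bar>\<^sup>2 * norm (higher_vderiv 0 (fourier f) l) \<le> (LINT x|lborel. norm (higher_vderiv 2 f x))"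
      by simp
  qed simp
  also have "\<dots> \<le> pi * (schwartz_seminorm 0 0 (higher_vderiv 2 f) + schwartz_seminorm 2 0 (higher_vderiv 2 f))"
    by (rule schwartz_integral_norm_le[OF f2])
  also have "\<dots> = pi * (?s 0 2 + ?s 2 2)"
    by (simp add: schwartz_seminorm_def)
  finally have 2: "schwartz_seminorm 2 0 (fourier f) \<le> pi * (?s 0 2 + ?s 2 2)" .
  have "(LINT l|lborel. norm (fourier f l)) \<le> pi * (schwartz_seminorm 0 0 (fourier f) + schwartz_seminorm 2 0 (fourier f))"
    by (rule schwartz_integral_norm_le[OF F])
  also have "\<dots> \<le> pi * (pi * (?s 0 0 + ?s 2 0) + pi * (?s 0 2 + ?s 2 2))"
    using 1 2 by (intro mult_left_mono add_mono) auto
  also have "\<dots> = pi\<^sup>2 * (?s 0 0 + ?s 2 0 + ?s 0 2 + ?s 2 2)"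
    by (simp add: power2_eq_square algebra_simps)
  also have "\<dots> \<le> pi\<^sup>2 * (\<Sum>m\<le>2. \<Sum>n\<le>2. ?s m n)"
    using schwartz_seminorm_nonneg[OF f] by (intro mult_left_mono) (auto simp: numeral_2_eq_2 add_nonneg_nonneg)
  finally show ?thesis .
qed

text \<open>
  The distribution is the pairing of \<open>m\<close> with the inverse Fourier transform. It is unique because every
  Schwartz function is a Fourier transform.
\<close>

lemma tempered_distribution_of_bounded_symbol:
  fixes m :: "real \<Rightarrow> complex"
  assumes m [measurable]: "m \<in> borel_measurable borel" and bound: "\<And>l. norm (m l) \<le> 1"
  shows "\<exists>!T. T \<in> tempered_distributions \<and> fourier_distribution T = regular_distribution m"
proof (rule ex_ex1I)
  define T where "T = restrict (\<lambda>f. LINT l|lborel. m l * (1 / (2 * pi) * fourier f (- l))) schwartz"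
  have int: "integrable lborel (\<lambda>l. m l * (1 / (2 * pi) * fourier f (- l)))" if f: "f \<in> schwartz" for f
  proof -
    have g: "integrable lborel (\<lambda>l. 1 / (2 * pi) * fourier f (- l))"
      by (intro schwartz_integrable schwartz_cmult schwartz_reflect fourier_schwartz f)
    show ?thesis
    proof (rule Bochner_Integration.integrable_bound[OF g])
      show "(\<lambda>l. m l * (1 / (2 * pi) * fourier f (- l))) \<in> borel_measurable lborel"
        using borel_measurable_integrable[OF g] by measurable
      show "AE l in lborel. norm (m l * (1 / (2 * pi) * fourier f (- l))) \<le> norm (1 / (2 * pi) * fourier f (- l))"
        using bound by (intro AE_I2) (simp only: norm_mult mult_left_le_one_le norm_ge_zero mult_nonneg_nonneg)
    qed
  qed
  have "T \<in> tempered_distributions"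
    unfolding tempered_distributions_def
  proof (intro CollectI conjI ballI allI)
    show "T \<in> extensional schwartz" by (simp add: T_def)
    show "T (\<lambda>x. f x + g x) = T f + T g" if f: "f \<in> schwartz" and g: "g \<in> schwartz" for f g
    proof -
      have "T (\<lambda>x. f x + g x) = (LINT l|lborel. m l * (1 / (2 * pi) * fourier f (- l)) + m l * (1 / (2 * pi) * fourier g (- l)))"
        using schwartz_add[OF f g]
        by (simp only: T_def restrict_apply' fourier_add[OF schwartz_integrable[OF f] schwartz_integrable[OF g]] distrib_left)
      then show ?thesis using f g by (simp only: Bochner_Integration.integral_add[OF int[OF f] int[OF g]] T_def restrict_apply')
    qed
    show "T (\<lambda>x. c * f x) = c * T f" if f: "f \<in> schwartz" for f c
    proof -
      have "T (\<lambda>x. c * f x) = (LINT l|lborel. c * (m l * (1 / (2 * pi) * fourier f (- l))))"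
        using schwartz_cmult[OF f] by (simp add: T_def fourier_cmult mult_ac)
      then show ?thesis using f by (simp add: T_def)
    qed
    show "\<exists>C N. \<forall>f\<in>schwartz. norm (T f) \<le> C * (\<Sum>m\<le>N. \<Sum>n\<le>N. schwartz_seminorm m n f)"
    proof (intro exI ballI)
      fix f assume f: "f \<in> schwartz"
      have h: "integrable lborel (\<lambda>l. fourier f (- l))"
        by (intro schwartz_integrable schwartz_reflect fourier_schwartz f)
      have "norm (T f) \<le> (LINT l|lborel. norm (m l * (1 / (2 * pi) * fourier f (- l))))"
        using f by (simp add: T_def integral_norm_bound del: times_divide_eq_left times_divide_eq_right)
      also have "\<dots> \<le> (LINT l|lborel. 1 / (2 * pi) * norm (fourier f (- l)))"
      proof (rule integral_mono)
        fix l
        have "norm (m l) * (1 / (2 * pi) * norm (fourier f (- l))) \<le> 1 * (1 / (2 * pi) * norm (fourier f (- l)))"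
          by (intro mult_right_mono bound) auto
        then show "norm (m l * (1 / (2 * pi) * fourier f (- l))) \<le> 1 / (2 * pi) * norm (fourier f (- l))"
          by (simp add: norm_mult norm_divide)
      qed (intro integrable_norm integrable_mult_right int f h)+
      also have "\<dots> = 1 / (2 * pi) * (LINT l|lborel. norm (fourier f (- l)))"
        by (rule integral_mult_right_zero)
      also have "(LINT l|lborel. norm (fourier f (- l))) = (LINT l|lborel. norm (fourier f l))"
        by (subst (2) lborel_integral_real_affine[of "- 1" _ 0]) auto
      also have "1 / (2 * pi) * \<dots> \<le> 1 / (2 * pi) * (pi\<^sup>2 * (\<Sum>m\<le>2. \<Sum>n\<le>2. schwartz_seminorm m n f))"
        by (intro mult_left_mono fourier_integral_norm_le f) auto
      finally show "norm (T f) \<le> (1 / (2 * pi) * pi\<^sup>2) * (\<Sum>m\<le>2. \<Sum>n\<le>2. schwartz_seminorm m n f)"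
        by (simp only: mult.assoc)
    qed
  qed
  moreover have "fourier_distribution T = regular_distribution m"
    unfolding fourier_distribution_def regular_distribution_def
  proof (rule restrict_ext)
    fix \<phi> assume \<phi>: "\<phi> \<in> schwartz"
    then show "T (fourier \<phi>) = (LINT l|lborel. m l * \<phi> l)"
      by (simp only: T_def restrict_apply' fourier_schwartz fourier_fourier)
  qed
  ultimately show "\<exists>T. T \<in> tempered_distributions \<and> fourier_distribution T = regular_distribution m"
    by blast
next
  fix S T
  assume S: "S \<in> tempered_distributions \<and> fourier_distribution S = regular_distribution m"
    and T: "T \<in> tempered_distributions \<and> fourier_distribution T = regular_distribution m"
  show "S = T"
  proof (rule extensionalityI)
    show "S \<in> extensional schwartz" "T \<in> extensional schwartz"
      using S T by (auto simp: tempered_distributions_def)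
    fix f assume "f \<in> schwartz"
    then obtain \<phi> where \<phi>: "\<phi> \<in> schwartz" "fourier \<phi> = f" using fourier_surj_schwartz by blast
    have "fourier_distribution S \<phi> = fourier_distribution T \<phi>" using S T by simp
    then show "S f = T f" using \<phi> by (simp add: fourier_distribution_def)
  qed
qed

theorem proposition3p1:
  fixes u :: real
  assumes "u \<notin> \<int>"
  shows "(\<exists>!T. T \<in> tempered_distributions \<and>
            fourier_distribution T = regular_distribution (mu_symbol u)) \<and>
         (\<forall>x. x \<noteq> 0 \<longrightarrow> summable (Phi_term u x)) \<and>
         square_integrable (Phi u) \<and>
         (\<forall>\<phi>\<in>schwartz. mu_conv_power u \<phi> =
            of_real (cos (pi * u)) * dirac_zero \<phi>
            + of_real (sin (pi * u) / pi) * pv_inverse \<phi>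
            + regular_distribution (\<lambda>x. of_real (Phi u x)) \<phi>)"
proof (intro conjI allI impI ballI)
  show ex1: "\<exists>!T. T \<in> tempered_distributions \<and> fourier_distribution T = regular_distribution (mu_symbol u)"
    by (rule tempered_distribution_of_bounded_symbol) (auto simp: norm_mu_symbol)
  show "summable (Phi_term u x)" if "x \<noteq> 0" for x
    using Phi_term_sums[OF assms that] by (rule sums_summable)
  show "square_integrable (Phi u)"
    using Phi_measurable[OF assms] integrable_Phi_square[OF assms] by (simp add: square_integrable_def)
  fix f assume "f \<in> schwartz"
  then obtain \<phi> where \<phi>: "\<phi> \<in> schwartz" "fourier \<phi> = f" using fourier_surj_schwartz by blast
  have "fourier_distribution (mu_conv_power u) = regular_distribution (mu_symbol u)"
    unfolding mu_conv_power_def using theI'[OF ex1] by blast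
  then have "fourier_distribution (mu_conv_power u) \<phi> = regular_distribution (mu_symbol u) \<phi>" by simp
  then have "mu_conv_power u f = (LINT l|lborel. mu_symbol u l * \<phi> l)"
    using \<phi> by (simp add: fourier_distribution_def regular_distribution_def)
  then show "mu_conv_power u f = of_real (cos (pi * u)) * dirac_zero f + of_real (sin (pi * u) / pi) * pv_inverse f
      + regular_distribution (\<lambda>x. of_real (Phi u x)) f"
    using mu_decomposition[OF assms \<phi>(1)] \<phi>(2) by simp
qed

end
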